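(* Let $T>0$, $\sigma\in\mathbb{R}$, $0<R\le 1$, and $\alpha(r)=\lambda e^{-\rho r}+(1-\lambda)e^{-\gamma r}$ with $\gamma>\rho>0$ and $\lambda\in(0,1)$. Let $P\in C(\Delta[0,T])$ be the unique continuous solution of $$\left\{\begin{aligned} & P_s(t,s)+2P(t,s)\big[\bar\Theta_1(s)+\bar\Theta_2(s)\big]+\sigma^2P(t,s)+\alpha(s-t)\big[-\bar\Theta_1(s)^2+R\,\bar\Theta_2(s)^2\big]=0,\quad (t,s)\in\Delta[0,T],\\ & P(t,T)=\alpha(T-t),\quad t\in[0,T], \end{aligned}\right.$$ where $$\bar\Theta_1(s)=P(s,s),\qquad \bar\Theta_2(s)=-\frac{P(s,s)}{R},\qquad s\in[0,T].$$ Then the closed-loop strategy $(\bar\Theta_1,\bar\Theta_2)$ satisfies the local saddle property; that is, $(\bar\Theta_1,\bar\Theta_2)$ is an equilibrium closed-loop saddle strategy for the two-person zero-sum game with non-constant discounting described in the context.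
   Context: $\Delta[0,T]=\{(t,s)\in[0,T]^2: 0\le t\le s\le T\}$; $P_s$ is the partial derivative in the second variable. Let $(\Omega,\mathcal{F},\mathbb{F},\mathbb{P})$ be a complete filtered probability space carrying a one-dimensional standard Brownian motion $W$, with $\mathbb{F}=\{\mathcal{F}_t\}_{t\ge0}$ the augmented natural filtration of $W$. $L^2_{\mathbb{F}}(t,T)$ is the set of $\mathbb{F}$-progressively measurable $\varphi:[t,T]\times\Omega\to\mathbb{R}$ with $\mathbb{E}\int_t^T|\varphi(s)|^2ds<\infty$. Game. For $t\in[0,T)$, a square-integrable $\mathcal{F}_t$-measurable $\xi$, and $u_1,u_2\in L^2_{\mathbb{F}}(t,T)$, the state solves $$dX(s)=[u_1(s)+u_2(s)]ds+\sigma X(s)dW(s),\ s\in[t,T],\qquad X(t)=\xi,$$ and the payoff is $$J(t,\xi;u_1,u_2)=\mathbb{E}_t\Big\{\alpha(T-t)X(T)^2+\int_t^T\alpha(s-t)\big(-u_1(s)^2+R\,u_2(s)^2\big)ds\Big\},$$ where $\mathbb{E}_t=\mathbb{E}[\,\cdot\,|\mathcal{F}_t]$. Player 1 chooses $u_1$ to maximize $J$, Player 2 chooses $u_2$ to minimize $J$. Local saddle property. Let $\bar\Theta_1,\bar\Theta_2$ be deterministic functions on $[0,T]$ in $L^2[0,T]$, and let $\bar X$ be the corresponding state process, $d\bar X=(\bar\Theta_1+\bar\Theta_2)\bar X\,ds+\sigma\bar X\,dW$ on $[0,T]$ (with arbitrary initial value $\bar X(0)\in\mathbb{R}$). The pair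 $(\bar\Theta_1,\bar\Theta_2)$ satisfies the local saddle property, and is then called an equilibrium closed-loop saddle strategy, if for any $t\in[0,T)$ and any $u_1,u_2\in L^2_{\mathbb{F}}(t,T)$, $$\limsup_{\varepsilon\to0^+}\frac{J(t,X^\varepsilon(t);\Theta_1^\varepsilon X^\varepsilon,\bar\Theta_2X^\varepsilon)-J(t,\bar X(t);\bar\Theta_1\bar X,\bar\Theta_2\bar X)}{\varepsilon}\le0,$$ $$\limsup_{\varepsilon\to0^+}\frac{J(t,X^\varepsilon(t);\bar\Theta_1X^\varepsilon,\Theta_2^\varepsilon X^\varepsilon)-J(t,\bar X(t);\bar\Theta_1\bar X,\bar\Theta_2\bar X)}{\varepsilon}\ge0,$$ where, for $i=1,2$, $\Theta_i^\varepsilon(s)X^\varepsilon(s)$ denotes the control equal to $u_i(s)$ for $s\in[t,t+\varepsilon)$ and to $\bar\Theta_i(s)X^\varepsilon(s)$ for $s\in[t+\varepsilon,T]$, and in each line $X^\varepsilon$ is the state process on $[t,T]$ generated by the pair of controls appearing in that line, with $X^\varepsilon(t)=\bar X(t)$. The inequalities between random variables are understood almost surely (along any sequence $\varepsilon_n\downarrow0$). *)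

theory Defs
  imports "HOL-Probability.Probability"
begin

section \<open>Brownian motion and its augmented natural filtration\<close>

definition natural_filtration :: "'a measure \<Rightarrow> (real \<Rightarrow> 'a \<Rightarrow> real) \<Rightarrow> real \<Rightarrow> 'a measure" where
  "natural_filtration M W s =
     sigma (space M) {W r -` A \<inter> space M | r A. 0 \<le> r \<and> r \<le> s \<and> A \<in> sets borel}"

definition augmented_filtration :: "'a measure \<Rightarrow> (real \<Rightarrow> 'a \<Rightarrow> real) \<Rightarrow> real \<Rightarrow> 'a measure" where
  "augmented_filtration M W s = sigma (space M) (sets (natural_filtration M W s) \<union> null_sets M)"

definition brownian_motion :: "'a measure \<Rightarrow> (real \<Rightarrow> 'a \<Rightarrow> real) \<Rightarrow> bool" where
  "brownian_motion M W \<longleftrightarrow>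
     (\<forall>t\<ge>0. W t \<in> borel_measurable M) \<and>
     (AE \<omega> in M. W 0 \<omega> = 0) \<and>
     (AE \<omega> in M. continuous_on {0..} (\<lambda>t. W t \<omega>)) \<and>
     (\<forall>s t. 0 \<le> s \<and> s < t \<longrightarrow>
        distributed M lborel (\<lambda>\<omega>. W t \<omega> - W s \<omega>) (normal_density 0 (sqrt (t - s))) \<and>
        prob_space.indep_set M
          (sets (vimage_algebra (space M) (\<lambda>\<omega>. W t \<omega> - W s \<omega>) borel))
          (sets (natural_filtration M W s)))"


section \<open>Square-integrable progressively measurable processes\<close>

definition progressively_measurable ::
    "(real \<Rightarrow> 'a measure) \<Rightarrow> real \<Rightarrow> real \<Rightarrow> (real \<Rightarrow> 'a \<Rightarrow> real) \<Rightarrow> bool" where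
  "progressively_measurable F t T \<phi> \<longleftrightarrow>
     (\<forall>s\<in>{t..T}. (\<lambda>(r, \<omega>). \<phi> r \<omega>) \<in> borel_measurable (restrict_space borel {t..s} \<Otimes>\<^sub>M F s))"

definition L2_prog ::
    "'a measure \<Rightarrow> (real \<Rightarrow> 'a measure) \<Rightarrow> real \<Rightarrow> real \<Rightarrow> (real \<Rightarrow> 'a \<Rightarrow> real) set" where
  "L2_prog M F t T =
     {\<phi>. progressively_measurable F t T \<phi> \<and>
         (\<integral>\<^sup>+\<omega>. (\<integral>\<^sup>+s\<in>{t..T}. ennreal ((\<phi> s \<omega>)\<^sup>2) \<partial>lborel) \<partial>M) < \<infinity>}"


section \<open>The Ito integral\<close>

text \<open>
  A simple process on \<open>[t, T]\<close> is \<open>\<Sum>i<n. \<eta> i \<cdot> 1\<^bsub>(\<tau> i, \<tau> (i+1)]\<^esub>\<close> for a partition \<open>\<tau>\<close> of \<open>[t, T]\<close>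
  into \<open>n\<close> intervals and bounded weights \<open>\<eta> i\<close>, measurable at the left end point.
\<close>

definition simple_process ::
    "'a measure \<Rightarrow> (real \<Rightarrow> 'a measure) \<Rightarrow> real \<Rightarrow> real \<Rightarrow> nat \<Rightarrow> (nat \<Rightarrow> real) \<Rightarrow> (nat \<Rightarrow> 'a \<Rightarrow> real) \<Rightarrow> bool"
  where
  "simple_process M F t T n \<tau> \<eta> \<longleftrightarrow>
     \<tau> 0 = t \<and> \<tau> n = T \<and> (\<forall>i<n. \<tau> i \<le> \<tau> (Suc i)) \<and>
     (\<forall>i<n. \<eta> i \<in> borel_measurable (F (\<tau> i)) \<and> bounded (\<eta> i ` space M))"

definition simple_value :: "nat \<Rightarrow> (nat \<Rightarrow> real) \<Rightarrow> (nat \<Rightarrow> 'a \<Rightarrow> real) \<Rightarrow> real \<Rightarrow> 'a \<Rightarrow> real" where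
  "simple_value n \<tau> \<eta> s \<omega> = (\<Sum>i<n. \<eta> i \<omega> * indicator {\<tau> i<..\<tau> (Suc i)} s)"

definition simple_integral ::
    "(real \<Rightarrow> 'a \<Rightarrow> real) \<Rightarrow> nat \<Rightarrow> (nat \<Rightarrow> real) \<Rightarrow> (nat \<Rightarrow> 'a \<Rightarrow> real) \<Rightarrow> real \<Rightarrow> 'a \<Rightarrow> real" where
  "simple_integral W n \<tau> \<eta> s \<omega> =
     (\<Sum>i<n. \<eta> i \<omega> * (W (min (\<tau> (Suc i)) s) \<omega> - W (min (\<tau> i) s) \<omega>))"

text \<open>
  \<open>I s = \<integral>\<^sub>t\<^sup>s \<phi> dW\<close> for \<open>s \<in> [t, T]\<close>: the continuous adapted process that is the mean-square limit of
  the integrals of simple processes converging to \<open>\<phi>\<close> in \<open>L\<^sup>2(ds \<otimes> P)\<close>.  By the Ito isometry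
  it is determined by \<open>\<phi>\<close> up to indistinguishability.
\<close>

definition has_ito_integral ::
    "'a measure \<Rightarrow> (real \<Rightarrow> 'a measure) \<Rightarrow> (real \<Rightarrow> 'a \<Rightarrow> real) \<Rightarrow> real \<Rightarrow> real \<Rightarrow>
     (real \<Rightarrow> 'a \<Rightarrow> real) \<Rightarrow> (real \<Rightarrow> 'a \<Rightarrow> real) \<Rightarrow> bool" where
  "has_ito_integral M F W t T \<phi> I \<longleftrightarrow>
     \<phi> \<in> L2_prog M F t T \<and>
     (\<forall>s\<in>{t..T}. I s \<in> borel_measurable (F s)) \<and>
     (AE \<omega> in M. continuous_on {t..T} (\<lambda>s. I s \<omega>)) \<and>
     (\<exists>n \<tau> \<eta>.
        (\<forall>k. simple_process M F t T (n k) (\<tau> k) (\<eta> k)) \<and>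
        (\<lambda>k. \<integral>\<^sup>+\<omega>. (\<integral>\<^sup>+s\<in>{t..T}. ennreal ((simple_value (n k) (\<tau> k) (\<eta> k) s \<omega> - \<phi> s \<omega>)\<^sup>2) \<partial>lborel) \<partial>M)
          \<longlonglongrightarrow> 0 \<and>
        (\<forall>s\<in>{t..T}.
           (\<lambda>k. \<integral>\<^sup>+\<omega>. ennreal ((simple_integral W (n k) (\<tau> k) (\<eta> k) s \<omega> - I s \<omega>)\<^sup>2) \<partial>M) \<longlonglongrightarrow> 0))"


section \<open>State equation and payoff\<close>

text \<open>
  \<open>X\<close> solves \<open>dX = (u\<^sub>1 + u\<^sub>2) ds + \<sigma> X dW\<close> on \<open>[t, T]\<close> with \<open>X t = \<xi>\<close>, in integrated form.  Path
  continuity and \<open>X t = \<xi>\<close> almost surely follow from the equation; the solution for given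
  \<open>\<xi>, u\<^sub>1, u\<^sub>2\<close> is unique up to indistinguishability.  In feedback form \<open>u\<^sub>1\<close> and \<open>u\<^sub>2\<close> may
  themselves be expressions in \<open>X\<close>.
\<close>

definition state_process ::
    "'a measure \<Rightarrow> (real \<Rightarrow> 'a measure) \<Rightarrow> (real \<Rightarrow> 'a \<Rightarrow> real) \<Rightarrow> real \<Rightarrow> real \<Rightarrow> real \<Rightarrow> ('a \<Rightarrow> real) \<Rightarrow>
     (real \<Rightarrow> 'a \<Rightarrow> real) \<Rightarrow> (real \<Rightarrow> 'a \<Rightarrow> real) \<Rightarrow> (real \<Rightarrow> 'a \<Rightarrow> real) \<Rightarrow> bool" where
  "state_process M F W T \<sigma> t \<xi> u1 u2 X \<longleftrightarrow>
     \<xi> \<in> borel_measurable (F t) \<and> integrable M (\<lambda>\<omega>. (\<xi> \<omega>)\<^sup>2) \<and>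
     u1 \<in> L2_prog M F t T \<and> u2 \<in> L2_prog M F t T \<and> X \<in> L2_prog M F t T \<and>
     (\<exists>I. has_ito_integral M F W t T (\<lambda>s \<omega>. \<sigma> * X s \<omega>) I \<and>
        (AE \<omega> in M. \<forall>s\<in>{t..T}. X s \<omega> = \<xi> \<omega> + (LBINT r:{t..s}. u1 r \<omega> + u2 r \<omega>) + I s \<omega>))"

text \<open>The payoff \<open>J(t, \<xi>; u\<^sub>1, u\<^sub>2)\<close>, where \<open>X\<close> is the state generated by \<open>\<xi>, u\<^sub>1, u\<^sub>2\<close>.\<close>

definition payoff ::
    "'a measure \<Rightarrow> (real \<Rightarrow> 'a measure) \<Rightarrow> real \<Rightarrow> real \<Rightarrow> (real \<Rightarrow> real) \<Rightarrow> real \<Rightarrow>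
     (real \<Rightarrow> 'a \<Rightarrow> real) \<Rightarrow> (real \<Rightarrow> 'a \<Rightarrow> real) \<Rightarrow> (real \<Rightarrow> 'a \<Rightarrow> real) \<Rightarrow> 'a \<Rightarrow> real" where
  "payoff M F T R \<alpha> t X u1 u2 =
     real_cond_exp M (F t)
       (\<lambda>\<omega>. \<alpha> (T - t) * (X T \<omega>)\<^sup>2 +
            (LBINT s:{t..T}. \<alpha> (s - t) * (- (u1 s \<omega>)\<^sup>2 + R * (u2 s \<omega>)\<^sup>2)))"


section \<open>Equilibrium closed-loop saddle strategies\<close>

definition feedback :: "(real \<Rightarrow> real) \<Rightarrow> (real \<Rightarrow> 'a \<Rightarrow> real) \<Rightarrow> real \<Rightarrow> 'a \<Rightarrow> real" where
  "feedback \<Theta> X s \<omega> = \<Theta> s * X s \<omega>"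

definition perturbed_feedback ::
    "real \<Rightarrow> real \<Rightarrow> (real \<Rightarrow> 'a \<Rightarrow> real) \<Rightarrow> (real \<Rightarrow> real) \<Rightarrow> (real \<Rightarrow> 'a \<Rightarrow> real) \<Rightarrow> real \<Rightarrow> 'a \<Rightarrow> real" where
  "perturbed_feedback t \<epsilon> u \<Theta> X s \<omega> = (if s < t + \<epsilon> then u s \<omega> else \<Theta> s * X s \<omega>)"

definition L2_interval :: "real \<Rightarrow> (real \<Rightarrow> real) \<Rightarrow> bool" where
  "L2_interval T \<Theta> \<longleftrightarrow>
     set_borel_measurable lborel {0..T} \<Theta> \<and> set_integrable lborel {0..T} (\<lambda>s. (\<Theta> s)\<^sup>2)"

text \<open>
  The state processes \<open>X \<epsilon>\<close> are only determined up to null sets, and the almost sure upper limit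
  as \<open>\<epsilon> \<down> 0\<close> is taken along sequences.
\<close>

definition equilibrium_saddle_strategy ::
    "'a measure \<Rightarrow> (real \<Rightarrow> 'a measure) \<Rightarrow> (real \<Rightarrow> 'a \<Rightarrow> real) \<Rightarrow> real \<Rightarrow> real \<Rightarrow> real \<Rightarrow>
     (real \<Rightarrow> real) \<Rightarrow> (real \<Rightarrow> real) \<Rightarrow> (real \<Rightarrow> real) \<Rightarrow> bool" where
  "equilibrium_saddle_strategy M F W T \<sigma> R \<alpha> \<Theta>1 \<Theta>2 \<longleftrightarrow>
     L2_interval T \<Theta>1 \<and> L2_interval T \<Theta>2 \<and>
     (\<forall>x0 Xbar. state_process M F W T \<sigma> 0 (\<lambda>_. x0) (feedback \<Theta>1 Xbar) (feedback \<Theta>2 Xbar) Xbar \<longrightarrow>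
       (\<forall>t\<in>{0..<T}. \<forall>u1\<in>L2_prog M F t T. \<forall>u2\<in>L2_prog M F t T.
         (\<forall>X. (\<forall>\<epsilon>\<in>{0<..<T - t}.
                 state_process M F W T \<sigma> t (Xbar t)
                   (perturbed_feedback t \<epsilon> u1 \<Theta>1 (X \<epsilon>)) (feedback \<Theta>2 (X \<epsilon>)) (X \<epsilon>)) \<longrightarrow>
              (\<forall>e. (\<forall>n. e n \<in> {0<..<T - t}) \<and> e \<longlonglongrightarrow> 0 \<longrightarrow>
                (AE \<omega> in M. limsup (\<lambda>n. ereal (
                   (payoff M F T R \<alpha> t (X (e n))
                      (perturbed_feedback t (e n) u1 \<Theta>1 (X (e n))) (feedback \<Theta>2 (X (e n))) \<omega>
                    - payoff M F T R \<alpha> t Xbar (feedback \<Theta>1 Xbar) (feedback \<Theta>2 Xbar) \<omega>) / e n)) \<le> 0))) \<and>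
         (\<forall>X. (\<forall>\<epsilon>\<in>{0<..<T - t}.
                 state_process M F W T \<sigma> t (Xbar t)
                   (feedback \<Theta>1 (X \<epsilon>)) (perturbed_feedback t \<epsilon> u2 \<Theta>2 (X \<epsilon>)) (X \<epsilon>)) \<longrightarrow>
              (\<forall>e. (\<forall>n. e n \<in> {0<..<T - t}) \<and> e \<longlonglongrightarrow> 0 \<longrightarrow>
                (AE \<omega> in M. limsup (\<lambda>n. ereal (
                   (payoff M F T R \<alpha> t (X (e n))
                      (feedback \<Theta>1 (X (e n))) (perturbed_feedback t (e n) u2 \<Theta>2 (X (e n))) \<omega>
                    - payoff M F T R \<alpha> t Xbar (feedback \<Theta>1 Xbar) (feedback \<Theta>2 Xbar) \<omega>) / e n)) \<ge> 0)))))"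


section \<open>The equilibrium Riccati equation\<close>

definition discount :: "real \<Rightarrow> real \<Rightarrow> real \<Rightarrow> real \<Rightarrow> real" where
  "discount lam \<rho> \<gamma> r = lam * exp (- \<rho> * r) + (1 - lam) * exp (- \<gamma> * r)"

definition Delta :: "real \<Rightarrow> (real \<times> real) set" where
  "Delta T = {(t, s). 0 \<le> t \<and> t \<le> s \<and> s \<le> T}"

text \<open>The derivative in \<open>s\<close> is one-sided at the end points of \<open>[t, T]\<close>.\<close>

definition riccati_solution ::
    "real \<Rightarrow> real \<Rightarrow> real \<Rightarrow> (real \<Rightarrow> real) \<Rightarrow> (real \<Rightarrow> real) \<Rightarrow> (real \<Rightarrow> real) \<Rightarrow> (real \<Rightarrow> real \<Rightarrow> real) \<Rightarrow> bool"
  where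
  "riccati_solution T \<sigma> R \<alpha> \<Theta>1 \<Theta>2 P \<longleftrightarrow>
     continuous_on (Delta T) (\<lambda>(t, s). P t s) \<and>
     (\<forall>(t, s)\<in>Delta T. \<exists>Ps.
        ((\<lambda>s. P t s) has_real_derivative Ps) (at s within {t..T}) \<and>
        Ps + 2 * P t s * (\<Theta>1 s + \<Theta>2 s) + \<sigma>\<^sup>2 * P t s
          + \<alpha> (s - t) * (- (\<Theta>1 s)\<^sup>2 + R * (\<Theta>2 s)\<^sup>2) = 0) \<and>
     (\<forall>t\<in>{0..T}. P t T = \<alpha> (T - t))"

end

theory Submission
  imports Defs
begin

text \<open>
  Testing \<open>P(t,s) X(s)\<^sup>2\<close> against the indicator of an event of \<open>F t\<close> and inserting the Riccati equation gives
  \<open>J(t,\<xi>;v\<^sub>1,v\<^sub>2) = P(t,t) \<xi>\<^sup>2 + E\<^sub>t \<integral>\<^sub>t\<^sup>T [2PX(v\<^sub>1 - \<Theta>\<^sub>1X) - \<alpha>(v\<^sub>1\<^sup>2 - \<Theta>\<^sub>1\<^sup>2X\<^sup>2)] + [2PX(v\<^sub>2 - \<Theta>\<^sub>2X) + \<alpha>R(v\<^sub>2\<^sup>2 - \<Theta>\<^sub>2\<^sup>2X\<^sup>2)] ds\<close>.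
  The integrand vanishes where both players follow the feedback, so for a perturbation only \<open>[t, t+\<epsilon>)\<close> contributes,
  and completing the square there bounds the gain of the deviating player by \<open>h(s) X(s)\<^sup>2\<close> with \<open>h\<close>
  continuous and \<open>h(t) = 0\<close>.  Since \<open>E\<^sub>t \<integral> X\<^sup>2 ds\<close> over \<open>[t, t+\<epsilon>]\<close> is \<open>O(\<epsilon>)\<close>, the gain is \<open>o(\<epsilon>)\<close>.

  The formula for \<open>E\<^sub>t[p(s) X(s)\<^sup>2]\<close> needs no Ito calculus: writing \<open>X = \<xi> + \<integral> b ds + I\<close> and
  expanding the square, the martingale property of \<open>I\<close> turns \<open>E[b(r) I(s)]\<close> into \<open>E[b(r) I(r)]\<close>,
  the isometry handles \<open>I\<^sup>2\<close>, and the remaining products are absolutely continuous.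
\<close>

section \<open>Square-integrable functions\<close>

text \<open>Conditional expectations are compared through integrals over events of
  \<open>F t\<close>, so the stochastic statements become identities between deterministic integrals
  on the product of time and probability. The payoff formula holds along any state with its own
  controls; the perturbed state never has to be compared with \<open>Xbar\<close>, since both share
  the value at \<open>t\<close> and the leading term \<open>P t t * \<xi>^2\<close> cancels. The
  obstacle is time inconsistency: the weight seen from \<open>t\<close> is \<open>P t s\<close>,
  whereas the strategy at \<open>s\<close> uses the diagonal \<open>P s s\<close>. Pointwise
  optimality may therefore fail for \<open>s > t\<close>, and the completed square leaves the defect
  \<open>h\<close>. It vanishes at \<open>t\<close> because \<open>\<alpha> 0 = 1\<close>, which is
  all that a first-order condition requires. The relation \<open>R * \<Theta>2 = - \<Theta>1\<close>
  makes the defects of the two players agree up to the factor \<open>1 / R\<close>. An almost sure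
  upper limit needs one exceptional set: the energy bound supplies the same integrable variable for
  all \<epsilon>, and a sequence of \<epsilon> leaves countably many null sets.\<close>

definition square_integrable :: "'b measure \<Rightarrow> ('b \<Rightarrow> real) \<Rightarrow> bool" where
  "square_integrable N f \<longleftrightarrow> f \<in> borel_measurable N \<and> integrable N (\<lambda>x. (f x)\<^sup>2)"

lemma square_integrableD:
  assumes "square_integrable N f"
  shows "f \<in> borel_measurable N" "integrable N (\<lambda>x. (f x)\<^sup>2)"
  using assms by (auto simp: square_integrable_def)

lemma square_integrable_nn:
  assumes "f \<in> borel_measurable N" "(\<integral>\<^sup>+x. ennreal ((f x)\<^sup>2) \<partial>N) < \<infinity>"
  shows "square_integrable N f"
  using assms by (auto simp: square_integrable_def integrable_iff_bounded)

lemma square_integrable_mult_integrable: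
  assumes "square_integrable N f" "square_integrable N g"
  shows "integrable N (\<lambda>x. f x * g x)"
proof (rule Bochner_Integration.integrable_bound)
  show "integrable N (\<lambda>x. (f x)\<^sup>2 + (g x)\<^sup>2)"
    using assms by (auto simp: square_integrable_def)
  show "(\<lambda>x. f x * g x) \<in> borel_measurable N"
    using assms by (auto simp: square_integrable_def)
  have "\<bar>a * b\<bar> \<le> a\<^sup>2 + b\<^sup>2" for a b :: real
    using sum_squares_bound[of "\<bar>a\<bar>" "\<bar>b\<bar>"] zero_le_power2[of a] zero_le_power2[of b]
    unfolding abs_mult power2_abs by linarith
  then show "AE x in N. norm (f x * g x) \<le> norm ((f x)\<^sup>2 + (g x)\<^sup>2)"
    by simp
qed

lemma square_integrable_bound:
  assumes "square_integrable N g" "f \<in> borel_measurable N" "AE x in N. \<bar>f x\<bar> \<le> \<bar>g x\<bar>"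
  shows "square_integrable N f"
  unfolding square_integrable_def
proof
  show "integrable N (\<lambda>x. (f x)\<^sup>2)"
    using assms by (intro Bochner_Integration.integrable_bound[OF square_integrableD(2)[OF assms(1)]])
      (auto simp: abs_le_square_iff)
qed fact

lemma square_integrable_cmult:
  assumes "square_integrable N f"
  shows "square_integrable N (\<lambda>x. c * f x)"
  using assms by (auto simp: square_integrable_def power_mult_distrib)

lemma square_integrable_bounded_mult:
  assumes "square_integrable N f" "c \<in> borel_measurable N" "\<And>x. x \<in> space N \<Longrightarrow> \<bar>c x\<bar> \<le> B"
  shows "square_integrable N (\<lambda>x. c x * f x)"
proof (rule square_integrable_bound)
  show "square_integrable N (\<lambda>x. B * f x)" by (rule square_integrable_cmult) fact
  show "(\<lambda>x. c x * f x) \<in> borel_measurable N"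
    using assms by (auto simp: square_integrable_def)
  show "AE x in N. \<bar>c x * f x\<bar> \<le> \<bar>B * f x\<bar>"
    using assms(3) by (auto simp: abs_mult intro!: mult_right_mono AE_I2) (meson abs_ge_self order_trans)
qed

lemma square_integrable_add:
  assumes "square_integrable N f" "square_integrable N g"
  shows "square_integrable N (\<lambda>x. f x + g x)"
  using assms square_integrable_mult_integrable[OF assms]
  by (auto simp: square_integrable_def power2_sum mult.assoc)

lemma square_integrable_diff:
  assumes "square_integrable N f" "square_integrable N g"
  shows "square_integrable N (\<lambda>x. f x - g x)"
  using square_integrable_add[OF assms(1) square_integrable_cmult[OF assms(2), of "-1"]] by simp

lemma square_integrable_zero: "square_integrable N (\<lambda>x. 0)"
  by (simp add: square_integrable_def)

lemma square_integrable_sum: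
  assumes "\<And>i. i \<in> I \<Longrightarrow> square_integrable N (f i)"
  shows "square_integrable N (\<lambda>x. \<Sum>i\<in>I. f i x)"
  using assms
  by (induction I rule: infinite_finite_induct) (auto simp: square_integrable_zero square_integrable_add)

lemma square_integrable_cong_AE:
  assumes "square_integrable N f" "g \<in> borel_measurable N" "AE x in N. g x = f x"
  shows "square_integrable N g"
  using assms by (intro square_integrable_bound[OF assms(1)]) auto

section \<open>Cauchy-Schwarz and mean-square limits\<close>

text \<open>Expanding the integral of \<open>(C f - B g)^2\<close> gives
  \<open>C (A C - B^2) \<ge> 0\<close>, which can be divided by \<open>C\<close> unless
  \<open>C = 0\<close>; in that case \<open>g\<close> vanishes almost everywhere and so does the
  mixed integral.\<close>

lemma Cauchy_Schwarz_integral: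
  assumes f: "square_integrable N f" and g: "square_integrable N g"
  shows "(\<integral>x. f x * g x \<partial>N)\<^sup>2 \<le> (\<integral>x. (f x)\<^sup>2 \<partial>N) * (\<integral>x. (g x)\<^sup>2 \<partial>N)"
proof -
  define A B C where "A = (\<integral>x. (f x)\<^sup>2 \<partial>N)" and "B = (\<integral>x. f x * g x \<partial>N)" and "C = (\<integral>x. (g x)\<^sup>2 \<partial>N)"
  note [simp] = square_integrableD(2)[OF f] square_integrableD(2)[OF g] square_integrable_mult_integrable[OF f g]
  have C: "C \<ge> 0" by (simp add: C_def)
  show ?thesis
  proof (cases "C = 0")
    case True
    then have "AE x in N. (g x)\<^sup>2 = 0"
      unfolding C_def by (subst (asm) integral_nonneg_eq_0_iff_AE) auto
    then have "B = (\<integral>x. 0 \<partial>N)"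
      unfolding B_def using f g by (intro integral_cong_AE) (auto simp: square_integrable_def)
    then show ?thesis using True by (simp add: B_def C_def)
  next
    case False
    have "0 \<le> (\<integral>x. (C * f x - B * g x)\<^sup>2 \<partial>N)" by simp
    also have "(\<lambda>x. (C * f x - B * g x)\<^sup>2) = (\<lambda>x. C\<^sup>2 * (f x)\<^sup>2 - 2 * C * B * (f x * g x) + B\<^sup>2 * (g x)\<^sup>2)"
      by (auto simp: power2_eq_square algebra_simps)
    also have "(\<integral>x. C\<^sup>2 * (f x)\<^sup>2 - 2 * C * B * (f x * g x) + B\<^sup>2 * (g x)\<^sup>2 \<partial>N) = C\<^sup>2 * A - 2 * C * B * B + B\<^sup>2 * C"
      by (simp add: A_def B_def C_def)
    also have "\<dots> = C * (A * C - B\<^sup>2)" by (simp add: power2_eq_square algebra_simps)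
    finally have "0 \<le> C * (A * C - B\<^sup>2)" .
    then have "B\<^sup>2 \<le> A * C" using C False
      by (simp add: zero_le_mult_iff)
    then show ?thesis by (simp add: A_def B_def C_def)
  qed
qed

text \<open>One approximant at finite distance is enough: \<open>g\<close> is \<open>f k\<close>
  minus a square-integrable difference. Convergence is phrased with the nonnegative integral because
  the Ito integral is defined that way, before integrability of the limit is known.\<close>

lemma L2_limit_square_integrable:
  assumes f: "\<And>k. square_integrable N (f k)" and g: "g \<in> borel_measurable N"
    and lim: "(\<lambda>k::nat. \<integral>\<^sup>+x. ennreal ((f k x - g x)\<^sup>2) \<partial>N) \<longlonglongrightarrow> 0"
  shows "square_integrable N g"
proof -
  have "eventually (\<lambda>k. (\<integral>\<^sup>+x. ennreal ((f k x - g x)\<^sup>2) \<partial>N) < 1) sequentially"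
    using lim by (rule order_tendstoD) simp
  then obtain k where k: "(\<integral>\<^sup>+x. ennreal ((f k x - g x)\<^sup>2) \<partial>N) < 1"
    by (auto dest: eventually_happens)
  have "square_integrable N (\<lambda>x. f k x - g x)"
    using f[of k] g order.strict_trans[OF k, of \<infinity>]
    by (intro square_integrable_nn) (auto simp: square_integrable_def)
  from square_integrable_diff[OF f[of k] this] show ?thesis by simp
qed

lemma L2_limit_real:
  assumes f: "\<And>k. square_integrable N (f k)" and g: "square_integrable N g"
    and lim: "(\<lambda>k::nat. \<integral>\<^sup>+x. ennreal ((f k x - g x)\<^sup>2) \<partial>N) \<longlonglongrightarrow> 0"
  shows "(\<lambda>k. \<integral>x. (f k x - g x)\<^sup>2 \<partial>N) \<longlonglongrightarrow> 0"
proof -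
  have "(\<integral>\<^sup>+x. ennreal ((f k x - g x)\<^sup>2) \<partial>N) = ennreal (\<integral>x. (f k x - g x)\<^sup>2 \<partial>N)" for k
    using square_integrable_diff[OF f[of k] g]
    by (intro nn_integral_eq_integral) (auto simp: square_integrable_def)
  with lim show ?thesis by (simp add: ennreal_tendsto_0_iff)
qed

text \<open>Cauchy-Schwarz bounds the error by the norm of \<open>h\<close> times the distance of
  \<open>f k\<close> from \<open>g\<close>. With a fixed test variable \<open>h\<close> this carries
  the martingale property from simple integrals to their limits.\<close>

lemma L2_tendsto_integral_mult:
  assumes h: "square_integrable N h" and f: "\<And>k. square_integrable N (f k)" and g: "square_integrable N g"
    and lim: "(\<lambda>k::nat. \<integral>\<^sup>+x. ennreal ((f k x - g x)\<^sup>2) \<partial>N) \<longlonglongrightarrow> 0"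
  shows "(\<lambda>k. \<integral>x. h x * f k x \<partial>N) \<longlonglongrightarrow> (\<integral>x. h x * g x \<partial>N)"
proof -
  have "(\<lambda>k. \<integral>x. h x * (f k x - g x) \<partial>N) \<longlonglongrightarrow> 0"
  proof (rule Lim_null_comparison)
    show "eventually (\<lambda>k. norm (\<integral>x. h x * (f k x - g x) \<partial>N) \<le> sqrt ((\<integral>x. (h x)\<^sup>2 \<partial>N) * (\<integral>x. (f k x - g x)\<^sup>2 \<partial>N))) sequentially"
      using Cauchy_Schwarz_integral[OF h square_integrable_diff[OF f g]]
      by (auto intro!: always_eventually real_le_rsqrt)
    show "(\<lambda>k. sqrt ((\<integral>x. (h x)\<^sup>2 \<partial>N) * (\<integral>x. (f k x - g x)\<^sup>2 \<partial>N))) \<longlonglongrightarrow> 0"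
      using tendsto_real_sqrt[OF tendsto_mult_right_zero[OF L2_limit_real[OF f g lim], of "(\<integral>x. (h x)\<^sup>2 \<partial>N)"]]
      by simp
  qed
  moreover have "(\<integral>x. h x * (f k x - g x) \<partial>N) = (\<integral>x. h x * f k x \<partial>N) - (\<integral>x. h x * g x \<partial>N)" for k
    using square_integrable_mult_integrable[OF h f[of k]] square_integrable_mult_integrable[OF h g]
    by (simp add: right_diff_distrib)
  ultimately show ?thesis by (simp add: LIM_zero_iff)
qed

text \<open>The weight \<open>c\<close> will be the indicator of an event, or of an event times a
  time interval, so that both sides of the isometry pass to the limit by the same argument.\<close>

lemma L2_tendsto_integral_square:
  assumes f: "\<And>k. square_integrable N (f k)" and g: "square_integrable N g"
    and lim: "(\<lambda>k::nat. \<integral>\<^sup>+x. ennreal ((f k x - g x)\<^sup>2) \<partial>N) \<longlonglongrightarrow> 0"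
    and c: "c \<in> borel_measurable N" "\<And>x. x \<in> space N \<Longrightarrow> \<bar>c x\<bar> \<le> 1"
  shows "(\<lambda>k. \<integral>x. c x * (f k x)\<^sup>2 \<partial>N) \<longlonglongrightarrow> (\<integral>x. c x * (g x)\<^sup>2 \<partial>N)"
proof -
  have cg: "square_integrable N (\<lambda>x. c x * g x)"
    by (rule square_integrable_bounded_mult[OF g c])
  have int: "integrable N (\<lambda>x. c x * (h x)\<^sup>2)" if h: "square_integrable N h" for h
    using square_integrable_mult_integrable[OF square_integrable_bounded_mult[OF h c] h]
    by (simp add: power2_eq_square mult.assoc)
  note fg = square_integrable_diff[OF f g]
  have 1: "(\<lambda>k. \<integral>x. c x * (f k x - g x)\<^sup>2 \<partial>N) \<longlonglongrightarrow> 0"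
  proof (rule Lim_null_comparison[OF _ L2_limit_real[OF f g lim]])
    have "norm (\<integral>x. c x * (f k x - g x)\<^sup>2 \<partial>N) \<le> (\<integral>x. norm (c x * (f k x - g x)\<^sup>2) \<partial>N)" for k
      by (rule integral_norm_bound)
    also have "(\<integral>x. norm (c x * (f k x - g x)\<^sup>2) \<partial>N) \<le> (\<integral>x. (f k x - g x)\<^sup>2 \<partial>N)" for k
      using integrable_norm[OF int[OF fg[of k]]] square_integrableD(2)[OF fg[of k]] c(2)
      by (intro integral_mono) (auto simp: abs_mult intro!: mult_left_le_one_le)
    finally show "eventually (\<lambda>k. norm (\<integral>x. c x * (f k x - g x)\<^sup>2 \<partial>N) \<le> (\<integral>x. (f k x - g x)\<^sup>2 \<partial>N)) sequentially"
      by simp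
  qed
  \<comment> \<open>Expansion around the limit, \<open>f^2 = (f - g)^2 + 2 g f - g^2\<close>: the
    first term tends to zero in norm, the second converges as a pairing with the fixed function
    \<open>c g\<close>.\<close>
  have eq: "(\<integral>x. c x * (f k x)\<^sup>2 \<partial>N) = (\<integral>x. c x * (f k x - g x)\<^sup>2 \<partial>N) + 2 * (\<integral>x. (c x * g x) * f k x \<partial>N)
      - (\<integral>x. c x * (g x)\<^sup>2 \<partial>N)" for k
  proof -
    have "(\<lambda>x. c x * (f k x)\<^sup>2) = (\<lambda>x. c x * (f k x - g x)\<^sup>2 + 2 * ((c x * g x) * f k x) - c x * (g x)\<^sup>2)"
      by (auto simp: power2_eq_square algebra_simps)
    then show ?thesis
      using int[OF fg[of k]] int[OF g] square_integrable_mult_integrable[OF cg f[of k]] by simp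
  qed
  have "(\<lambda>k. \<integral>x. c x * (f k x)\<^sup>2 \<partial>N) \<longlonglongrightarrow> 0 + 2 * (\<integral>x. (c x * g x) * g x \<partial>N) - (\<integral>x. c x * (g x)\<^sup>2 \<partial>N)"
    unfolding eq by (intro tendsto_intros 1 L2_tendsto_integral_mult[OF cg f g lim])
  also have "0 + 2 * (\<integral>x. (c x * g x) * g x \<partial>N) - (\<integral>x. c x * (g x)\<^sup>2 \<partial>N) = (\<integral>x. c x * (g x)\<^sup>2 \<partial>N)"
    by (simp add: power2_eq_square mult.assoc)
  finally show ?thesis .
qed

section \<open>Products of absolutely continuous functions\<close>

lemma (in pair_sigma_finite) integrable_tensor:
  fixes f g :: "_ \<Rightarrow> real"
  assumes f: "integrable M1 f" and g: "integrable M2 g"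
  shows "integrable (M1 \<Otimes>\<^sub>M M2) (\<lambda>(x, y). f x * g y)"
    and "integral\<^sup>L (M1 \<Otimes>\<^sub>M M2) (\<lambda>(x, y). f x * g y) = integral\<^sup>L M1 f * integral\<^sup>L M2 g"
proof -
  have [measurable]: "f \<in> borel_measurable M1" "g \<in> borel_measurable M2"
    using f g by (auto dest: borel_measurable_integrable)
  show int: "integrable (M1 \<Otimes>\<^sub>M M2) (\<lambda>(x, y). f x * g y)"
    by (intro Fubini_integrable) (auto simp: f g abs_mult)
  show "integral\<^sup>L (M1 \<Otimes>\<^sub>M M2) (\<lambda>(x, y). f x * g y) = integral\<^sup>L M1 f * integral\<^sup>L M2 g"
    using integral_fst[OF int] by simp
qed

text \<open>Integration by parts as Fubini: the product of two integrals is the integral of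
  \<open>f r * g q\<close> over a square, cut along its diagonal. Primitives start at minus
  infinity, and a lower end point enters through the supports of \<open>f\<close> and
  \<open>g\<close>. It serves for paths in \<open>second_moment_identity\<close> and for
  deterministic functions in \<open>weighted_second_moment\<close>.\<close>

lemma absolutely_continuous_product:
  fixes f g :: "real \<Rightarrow> real" and F0 G0 :: real
  assumes f: "integrable lborel f" and g: "integrable lborel g"
  defines "F \<equiv> \<lambda>s. F0 + (\<integral>r. indicator {..s} r * f r \<partial>lborel)"
    and "G \<equiv> \<lambda>s. G0 + (\<integral>r. indicator {..s} r * g r \<partial>lborel)"
  shows "F s * G s = F0 * G0 + (\<integral>r. indicator {..s} r * (f r * G r + F r * g r) \<partial>lborel)"
proof -
  have [measurable]: "f \<in> borel_measurable borel" "g \<in> borel_measurable borel"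
    using f g by (auto dest: borel_measurable_integrable)
  define fs where "fs = (\<lambda>r. indicator {..s} r * f r)"
  define gs where "gs = (\<lambda>r. indicator {..s} r * g r)"
  have fs: "integrable lborel fs" and gs: "integrable lborel gs"
    unfolding fs_def gs_def using integrable_mult_indicator[of "{..s}", OF _ f] integrable_mult_indicator[of "{..s}", OF _ g]
    by auto
  have [measurable]: "fs \<in> borel_measurable borel" "gs \<in> borel_measurable borel"
    by (auto simp: fs_def gs_def)
  note k = lborel_pair.integrable_tensor(1)[OF fs gs]
  \<comment> \<open>The two triangles of the square. Both contain the diagonal, which for fixed
    \<open>r\<close> is the single null point \<open>q = r\<close>.\<close>
  define k1 where "k1 = (\<lambda>r q. fs r * gs q * indicator {..r} q)"
  define k2 where "k2 = (\<lambda>r q. fs r * gs q * indicator {r..} q)"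
  have k1: "integrable (lborel \<Otimes>\<^sub>M lborel) (case_prod k1)"
    by (rule Bochner_Integration.integrable_bound[OF k])
      (auto simp: k1_def indicator_def split_beta')
  have k2: "integrable (lborel \<Otimes>\<^sub>M lborel) (case_prod k2)"
    by (rule Bochner_Integration.integrable_bound[OF k])
      (auto simp: k2_def indicator_def split_beta')
  have i1: "integrable lborel (\<lambda>r. \<integral>q. k1 r q \<partial>lborel)" "integrable lborel (\<lambda>r. \<integral>q. k2 q r \<partial>lborel)"
    using lborel_pair.integrable_fst[OF k1] lborel_pair.integrable_snd[OF k2] by auto
  have "indicator {..s} r * (f r * G r + F r * g r)
      = G0 * fs r + F0 * gs r + (\<integral>q. k1 r q \<partial>lborel) + (\<integral>q. k2 q r \<partial>lborel)" for r
  proof (cases "r \<le> s")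
    case True
    have "fs r * (\<integral>q. indicator {..r} q * g q \<partial>lborel) = (\<integral>q. k1 r q \<partial>lborel)"
      unfolding k1_def gs_def using True
      by (subst integral_mult_right_zero[symmetric], intro Bochner_Integration.integral_cong)
         (auto simp: indicator_def)
    moreover have "gs r * (\<integral>q. indicator {..r} q * f q \<partial>lborel) = (\<integral>q. k2 q r \<partial>lborel)"
      unfolding k2_def fs_def using True
      by (subst integral_mult_right_zero[symmetric], intro Bochner_Integration.integral_cong)
         (auto simp: indicator_def)
    ultimately show ?thesis using True
      by (simp add: F_def G_def fs_def gs_def algebra_simps)
  qed (auto simp: fs_def gs_def k1_def k2_def)
  then have "(\<integral>r. indicator {..s} r * (f r * G r + F r * g r) \<partial>lborel)
      = G0 * integral\<^sup>L lborel fs + F0 * integral\<^sup>L lborel gs + (\<integral>r. \<integral>q. k1 r q \<partial>lborel \<partial>lborel) + (\<integral>r. \<integral>q. k2 q r \<partial>lborel \<partial>lborel)"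
    using fs gs i1 by simp
  also have "(\<integral>r. \<integral>q. k2 q r \<partial>lborel \<partial>lborel) = (\<integral>r. \<integral>q. k2 r q \<partial>lborel \<partial>lborel)"
    using lborel_pair.Fubini_integral[OF k2] by simp
  also have "G0 * integral\<^sup>L lborel fs + F0 * integral\<^sup>L lborel gs + (\<integral>r. \<integral>q. k1 r q \<partial>lborel \<partial>lborel)
      + (\<integral>r. \<integral>q. k2 r q \<partial>lborel \<partial>lborel)
      = G0 * integral\<^sup>L lborel fs + F0 * integral\<^sup>L lborel gs + (\<integral>r. (\<integral>q. k1 r q \<partial>lborel) + (\<integral>q. k2 r q \<partial>lborel) \<partial>lborel)"
    using i1 lborel_pair.integrable_fst[OF k2] by simp
  also have "(\<integral>r. (\<integral>q. k1 r q \<partial>lborel) + (\<integral>q. k2 r q \<partial>lborel) \<partial>lborel) = (\<integral>r. fs r * integral\<^sup>L lborel gs \<partial>lborel)"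
  proof (intro Bochner_Integration.integral_cong refl)
    fix r
    have ints: "integrable lborel (k1 r)" "integrable lborel (k2 r)"
      using gs by (auto simp: k1_def k2_def mult.assoc mult.commute[of "gs _"] indicator_def
          intro!: Bochner_Integration.integrable_bound[OF gs])
    have "(\<integral>q. k1 r q \<partial>lborel) + (\<integral>q. k2 r q \<partial>lborel) = (\<integral>q. k1 r q + k2 r q \<partial>lborel)"
      using ints by simp
    also have "\<dots> = (\<integral>q. fs r * gs q \<partial>lborel)"
    proof (rule integral_cong_AE)
      show "AE q in lborel. k1 r q + k2 r q = fs r * gs q"
        using AE_lborel_singleton[of r] by eventually_elim (auto simp: k1_def k2_def indicator_def)
    qed (auto simp: k1_def k2_def)
    finally show "(\<integral>q. k1 r q \<partial>lborel) + (\<integral>q. k2 r q \<partial>lborel) = fs r * integral\<^sup>L lborel gs" by simp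
  qed
  also have "\<dots> = integral\<^sup>L lborel fs * integral\<^sup>L lborel gs" by simp
  finally show ?thesis
    by (simp add: F_def G_def fs_def gs_def algebra_simps)
qed

section \<open>Increments of Brownian motion\<close>

locale brownian_space = prob_space M for M :: "'a measure" +
  fixes W :: "real \<Rightarrow> 'a \<Rightarrow> real"
  assumes brownian: "brownian_motion M W"
begin

abbreviation F :: "real \<Rightarrow> 'a measure" where
  "F \<equiv> augmented_filtration M W"

lemma W_measurable: "0 \<le> r \<Longrightarrow> W r \<in> borel_measurable M"
  using brownian by (auto simp: brownian_motion_def)

lemma space_natural: "space (natural_filtration M W s) = space M"
  by (simp add: natural_filtration_def space_measure_of_conv)

lemma sets_natural:
  "sets (natural_filtration M W s) =
    sigma_sets (space M) {W r -` A \<inter> space M | r A. 0 \<le> r \<and> r \<le> s \<and> A \<in> sets borel}"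
  unfolding natural_filtration_def by (rule sets_measure_of) auto

lemma natural_sub: "sets (natural_filtration M W s) \<subseteq> sets M"
  unfolding sets_natural
  by (rule sets.sigma_sets_subset) (auto intro: measurable_sets[OF W_measurable])

lemma space_F [simp]: "space (F s) = space M"
  by (simp add: augmented_filtration_def space_measure_of_conv)

lemma sets_F: "sets (F s) = sigma_sets (space M) (sets (natural_filtration M W s) \<union> null_sets M)"
  unfolding augmented_filtration_def
  using natural_sub sets.space_closed[of M] by (intro sets_measure_of) (auto simp: null_sets_def)

lemma F_sub: "sets (F s) \<subseteq> sets M"
  unfolding sets_F using natural_sub by (intro sets.sigma_sets_subset) auto

lemma natural_mono:
  assumes "s \<le> t"
  shows "sets (natural_filtration M W s) \<subseteq> sets (natural_filtration M W t)"
  unfolding sets_natural using assms by (intro sigma_sets_mono') force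

lemma F_mono:
  assumes "s \<le> t"
  shows "sets (F s) \<subseteq> sets (F t)"
  unfolding sets_F using natural_mono[OF assms] by (intro sigma_sets_mono') auto

lemma subalgebra_F: "subalgebra M (F s)"
  by (simp add: subalgebra_def F_sub)

lemma measurable_F: "f \<in> measurable (F s) N \<Longrightarrow> f \<in> measurable M N"
  using F_sub[of s] by (auto simp: measurable_def)

lemma measurable_F_mono: "f \<in> measurable (F s) N \<Longrightarrow> s \<le> t \<Longrightarrow> f \<in> measurable (F t) N"
  using F_mono[of s t] by (auto simp: measurable_def)

lemma finite_measure_subalgebra_F: "finite_measure_subalgebra M (F s)"
  by (intro finite_measure_subalgebra.intro finite_measure_axioms finite_measure_subalgebra_axioms.intro
      subalgebra_F)

lemma W_adapted:
  assumes "0 \<le> r" "r \<le> s"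
  shows "W r \<in> borel_measurable (F s)"
proof (rule measurableI)
  fix A :: "real set" assume "A \<in> sets borel"
  then have "W r -` A \<inter> space M \<in> sets (natural_filtration M W s)"
    unfolding sets_natural using assms by (intro sigma_sets.Basic) auto
  then show "W r -` A \<inter> space (F s) \<in> sets (F s)"
    unfolding sets_F by (auto intro: sigma_sets.Basic)
qed simp

text \<open>Independence of increments is given for the natural filtration, while processes are
  adapted to the augmented one. Agreement with a natural event up to a null set holds for both kinds
  of generators and survives complements and countable unions.\<close>

lemma F_natural_approx:
  assumes "A \<in> sets (F s)"
  shows "\<exists>B\<in>sets (natural_filtration M W s). AE \<omega> in M. \<omega> \<in> A \<longleftrightarrow> \<omega> \<in> B"
  using assms unfolding sets_F
proof (induction A rule: sigma_sets.induct)
  case (Basic A)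
  then show ?case
  proof
    assume "A \<in> null_sets M"
    then have "AE \<omega> in M. \<omega> \<in> A \<longleftrightarrow> \<omega> \<in> {}"
      by (auto dest: AE_not_in)
    then show ?thesis by (intro bexI[of _ "{}"]) auto
  qed auto
next
  case Empty
  then show ?case by (intro bexI[of _ "{}"]) auto
next
  case (Compl A)
  then obtain B where B: "B \<in> sets (natural_filtration M W s)" "AE \<omega> in M. \<omega> \<in> A \<longleftrightarrow> \<omega> \<in> B" by auto
  then have "space M - B \<in> sets (natural_filtration M W s)"
    using sets.compl_sets[OF B(1)] by (simp add: space_natural)
  with B(2) show ?case by (intro bexI[of _ "space M - B"]) auto
next
  case (Union A)
  then obtain B where B: "\<And>i. B i \<in> sets (natural_filtration M W s)" "\<And>i. AE \<omega> in M. \<omega> \<in> A i \<longleftrightarrow> \<omega> \<in> B i"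
    by metis
  have "AE \<omega> in M. \<forall>i::nat. \<omega> \<in> A i \<longleftrightarrow> \<omega> \<in> B i"
    using B(2) by (simp add: AE_all_countable)
  then have "AE \<omega> in M. \<omega> \<in> (\<Union>i. A i) \<longleftrightarrow> \<omega> \<in> (\<Union>i. B i)" by eventually_elim auto
  with B(1) show ?case by (intro bexI[of _ "\<Union>i. B i"]) auto
qed

text \<open>Replacing an event of \<open>Z\<close> by an almost surely equal natural event changes
  neither its probability nor that of its intersection with an increment event.\<close>

lemma indep_increment:
  assumes st: "0 \<le> s" "s < t" and Z: "Z \<in> borel_measurable (F s)"
  shows "indep_var borel Z borel (\<lambda>\<omega>. W t \<omega> - W s \<omega>)"
proof -
  let ?D = "\<lambda>\<omega>. W t \<omega> - W s \<omega>"
  have D [measurable]: "?D \<in> borel_measurable M"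
    using W_measurable st by auto
  have ind: "indep_set (sets (vimage_algebra (space M) ?D borel)) (sets (natural_filtration M W s))"
    using brownian st by (auto simp: brownian_motion_def)
  have "indep_set (sigma_sets (space M) {Z -` A \<inter> space M | A. A \<in> sets borel})
    (sigma_sets (space M) {?D -` A \<inter> space M | A. A \<in> sets borel})"
  proof (rule indep_setI)
    have Zsub: "sigma_sets (space M) {Z -` A \<inter> space M | A. A \<in> sets borel} \<subseteq> sets (F s)"
      using sets.sigma_sets_subset[of "{Z -` A \<inter> space M | A. A \<in> sets borel}" "F s"]
        measurable_sets[OF Z] by auto
    then show "sigma_sets (space M) {Z -` A \<inter> space M | A. A \<in> sets borel} \<subseteq> events"
      using F_sub by blast
    show "sigma_sets (space M) {?D -` A \<inter> space M | A. A \<in> sets borel} \<subseteq> events"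
      by (rule sets.sigma_sets_subset) (auto intro: measurable_sets[OF D])
    fix a b assume a: "a \<in> sigma_sets (space M) {Z -` A \<inter> space M | A. A \<in> sets borel}"
      and b: "b \<in> sigma_sets (space M) {?D -` A \<inter> space M | A. A \<in> sets borel}"
    obtain c where c: "c \<in> sets (natural_filtration M W s)" "AE \<omega> in M. \<omega> \<in> a \<longleftrightarrow> \<omega> \<in> c"
      using F_natural_approx a Zsub by blast
    have ev: "a \<in> events" "b \<in> events" "c \<in> events"
      using a b c Zsub F_sub natural_sub
        \<open>sigma_sets (space M) {?D -` A \<inter> space M | A. A \<in> sets borel} \<subseteq> events\<close> by blast+
    have "b \<in> sets (vimage_algebra (space M) ?D borel)"
      using b by (simp add: sets_vimage_algebra)
    then have "prob (b \<inter> c) = prob b * prob c"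
      using indep_setD[OF ind] c(1) by blast
    moreover have "prob (a \<inter> b) = prob (b \<inter> c)" "prob a = prob c"
      using c(2) ev by (auto intro!: finite_measure_eq_AE)
    ultimately show "prob (a \<inter> b) = prob a * prob b" by simp
  qed
  then show ?thesis
    unfolding indep_var_eq using measurable_F[OF Z] D by auto
qed

lemma increment_moments:
  assumes st: "0 \<le> s" "s \<le> t"
  shows "integrable M (\<lambda>\<omega>. W t \<omega> - W s \<omega>)" "integrable M (\<lambda>\<omega>. (W t \<omega> - W s \<omega>)\<^sup>2)"
    "(\<integral>\<omega>. W t \<omega> - W s \<omega> \<partial>M) = 0" "(\<integral>\<omega>. (W t \<omega> - W s \<omega>)\<^sup>2 \<partial>M) = t - s"
proof -
  let ?D = "\<lambda>\<omega>. W t \<omega> - W s \<omega>"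
  have "integrable M ?D \<and> integrable M (\<lambda>\<omega>. (?D \<omega>)\<^sup>2) \<and> (\<integral>\<omega>. ?D \<omega> \<partial>M) = 0 \<and> (\<integral>\<omega>. (?D \<omega>)\<^sup>2 \<partial>M) = t - s"
  \<comment> \<open>The normal law is available for \<open>s < t\<close> only; the zero increment is
    treated directly.\<close>
  proof (cases "s = t")
    case False
    then have st': "s < t" using st by simp
    then have dist: "distributed M lborel ?D (normal_density 0 (sqrt (t - s)))"
      using brownian st by (auto simp: brownian_motion_def)
    have pos: "0 < sqrt (t - s)" using st' by simp
    have 1: "integrable M ?D"
      using integrable_normal_moment_nz_1[OF pos, of 0] distributed_integrable[OF dist, of "\<lambda>x. x"] by simp
    have 2: "integrable M (\<lambda>\<omega>. (?D \<omega>)\<^sup>2)"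
      using integrable_normal_moment[OF pos, of 0 2] distributed_integrable[OF dist, of "\<lambda>x. x\<^sup>2"] by simp
    have 3: "(\<integral>\<omega>. ?D \<omega> \<partial>M) = 0"
      using normal_distributed_expectation[OF pos dist] .
    have 4: "(\<integral>\<omega>. (?D \<omega>)\<^sup>2 \<partial>M) = t - s"
      using normal_distributed_variance[OF pos dist] 3 st' by simp
    show ?thesis using 1 2 3 4 by simp
  qed simp
  then show "integrable M ?D" "integrable M (\<lambda>\<omega>. (?D \<omega>)\<^sup>2)" "(\<integral>\<omega>. ?D \<omega> \<partial>M) = 0" "(\<integral>\<omega>. (?D \<omega>)\<^sup>2 \<partial>M) = t - s"
    by auto
qed

text \<open>Independence factors both expectations. Mean zero is the source of the martingale
  property, variance \<open>t - s\<close> that of the isometry.\<close>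

lemma increment_mult:
  assumes st: "0 \<le> s" "s \<le> t" and Z: "Z \<in> borel_measurable (F s)" "integrable M Z"
  shows "integrable M (\<lambda>\<omega>. Z \<omega> * (W t \<omega> - W s \<omega>))" "(\<integral>\<omega>. Z \<omega> * (W t \<omega> - W s \<omega>) \<partial>M) = 0"
    "integrable M (\<lambda>\<omega>. Z \<omega> * (W t \<omega> - W s \<omega>)\<^sup>2)"
    "(\<integral>\<omega>. Z \<omega> * (W t \<omega> - W s \<omega>)\<^sup>2 \<partial>M) = (\<integral>\<omega>. Z \<omega> \<partial>M) * (t - s)"
proof -
  let ?D = "\<lambda>\<omega>. W t \<omega> - W s \<omega>"
  note mom = increment_moments[OF st]
  have "integrable M (\<lambda>\<omega>. Z \<omega> * ?D \<omega>) \<and> (\<integral>\<omega>. Z \<omega> * ?D \<omega> \<partial>M) = 0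
    \<and> integrable M (\<lambda>\<omega>. Z \<omega> * (?D \<omega>)\<^sup>2) \<and> (\<integral>\<omega>. Z \<omega> * (?D \<omega>)\<^sup>2 \<partial>M) = (\<integral>\<omega>. Z \<omega> \<partial>M) * (t - s)"
  proof (cases "s = t")
    case False
    then have ind: "indep_var borel Z borel ?D"
      using indep_increment[OF _ _ Z(1)] st by simp
    have ind2: "indep_var borel Z borel (\<lambda>\<omega>. (?D \<omega>)\<^sup>2)"
      using indep_var_compose[OF ind, of "\<lambda>x. x" borel "\<lambda>x. x\<^sup>2" borel] by (simp add: comp_def)
    show ?thesis
      using indep_var_integrable[OF ind Z(2) mom(1)] indep_var_lebesgue_integral[OF ind Z(2) mom(1)]
        indep_var_integrable[OF ind2 Z(2) mom(2)] indep_var_lebesgue_integral[OF ind2 Z(2) mom(2)] mom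
      by simp
  qed simp
  then show "integrable M (\<lambda>\<omega>. Z \<omega> * (W t \<omega> - W s \<omega>))" "(\<integral>\<omega>. Z \<omega> * (W t \<omega> - W s \<omega>) \<partial>M) = 0"
    "integrable M (\<lambda>\<omega>. Z \<omega> * (W t \<omega> - W s \<omega>)\<^sup>2)"
    "(\<integral>\<omega>. Z \<omega> * (W t \<omega> - W s \<omega>)\<^sup>2 \<partial>M) = (\<integral>\<omega>. Z \<omega> \<partial>M) * (t - s)"
    by auto
qed

end

section \<open>The Ito integral\<close>

lemma integrable_indicator_lborel: "integrable lborel (indicator {a..b::real} :: real \<Rightarrow> real)"
  by (simp add: integrable_indicator_iff emeasure_lborel_Icc_eq)

lemma disjoint_sum_square:
  fixes x :: "nat \<Rightarrow> real"
  assumes "\<And>i j. i < n \<Longrightarrow> j < n \<Longrightarrow> i \<noteq> j \<Longrightarrow> x i * x j = 0"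
  shows "(\<Sum>i<n. x i)\<^sup>2 = (\<Sum>i<n. (x i)\<^sup>2)"
proof -
  have "(\<Sum>j<n. x i * x j) = (x i)\<^sup>2" if "i < n" for i
  proof -
    have "(\<Sum>j<n. x i * x j) = (\<Sum>j<n. if j = i then (x i)\<^sup>2 else 0)"
      using assms that by (intro sum.cong) (auto simp: power2_eq_square)
    then show ?thesis using that by simp
  qed
  then show ?thesis by (simp add: power2_eq_square sum_product)
qed

context brownian_space
begin

sublocale prod: pair_sigma_finite "lborel :: real measure" M ..

lemma square_integrable_indicator:
  assumes "A \<in> sets M" "square_integrable M f"
  shows "square_integrable M (\<lambda>\<omega>. indicator A \<omega> * f \<omega>)"
  using assms by (intro square_integrable_bounded_mult[where B = 1]) (auto simp: indicator_def)

lemma square_integrable_const: "square_integrable M (\<lambda>\<omega>. c)"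
  by (simp add: square_integrable_def)

text \<open>Each new term is a weight known at \<open>c m\<close> times an independent increment,
  hence orthogonal to everything square integrable known at \<open>c m\<close>, \<open>S m\<close>
  included. The induction carries measurability of \<open>S m\<close> along because this
  orthogonality needs it. Localizing on events of \<open>F (c 0)\<close> expresses the conditional
  isometry without conditional expectations.\<close>

lemma martingale_transform:
  fixes \<eta> :: "nat \<Rightarrow> 'a \<Rightarrow> real"
  assumes c: "0 \<le> c 0" "\<And>i. i < n \<Longrightarrow> c i \<le> c (Suc i)"
    and \<eta>: "\<And>i. i < n \<Longrightarrow> \<eta> i \<in> borel_measurable (F (c i))"
    and bdd: "\<And>i. i < n \<Longrightarrow> bounded (\<eta> i ` space M)"
  defines "S \<equiv> \<lambda>m \<omega>. \<Sum>i<m. \<eta> i \<omega> * (W (c (Suc i)) \<omega> - W (c i) \<omega>)"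
  assumes m: "m \<le> n"
  shows "S m \<in> borel_measurable (F (c m))" "square_integrable M (S m)"
    "\<And>Z. Z \<in> borel_measurable (F (c 0)) \<Longrightarrow> square_integrable M Z \<Longrightarrow> (\<integral>\<omega>. Z \<omega> * S m \<omega> \<partial>M) = 0"
    "\<And>A. A \<in> sets (F (c 0)) \<Longrightarrow> (\<integral>\<omega>. indicator A \<omega> * (S m \<omega>)\<^sup>2 \<partial>M)
        = (\<Sum>i<m. (\<integral>\<omega>. indicator A \<omega> * (\<eta> i \<omega>)\<^sup>2 \<partial>M) * (c (Suc i) - c i))"
proof -
  have "0 \<le> c m \<and> c 0 \<le> c m \<and> S m \<in> borel_measurable (F (c m)) \<and> square_integrable M (S m)
    \<and> (\<forall>Z. Z \<in> borel_measurable (F (c 0)) \<longrightarrow> square_integrable M Z \<longrightarrow> (\<integral>\<omega>. Z \<omega> * S m \<omega> \<partial>M) = 0)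
    \<and> (\<forall>A. A \<in> sets (F (c 0)) \<longrightarrow> (\<integral>\<omega>. indicator A \<omega> * (S m \<omega>)\<^sup>2 \<partial>M)
        = (\<Sum>i<m. (\<integral>\<omega>. indicator A \<omega> * (\<eta> i \<omega>)\<^sup>2 \<partial>M) * (c (Suc i) - c i)))"
    using m
  proof (induction m)
    case 0
    then show ?case using c(1) by (simp add: S_def square_integrable_zero)
  next
    case (Suc m)
    then have mn: "m < n" by simp
    let ?D = "\<lambda>\<omega>. W (c (Suc m)) \<omega> - W (c m) \<omega>"
    have cm: "0 \<le> c m" "c 0 \<le> c m" "c m \<le> c (Suc m)" using Suc c(2)[OF mn] by auto
    have Sm: "S m \<in> borel_measurable (F (c m))" and Sq: "square_integrable M (S m)"
      using Suc by auto
    note \<eta>m = \<eta>[OF mn]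
    obtain B where B: "\<And>\<omega>. \<omega> \<in> space M \<Longrightarrow> \<bar>\<eta> m \<omega>\<bar> \<le> B"
      using bdd[OF mn] by (auto simp: bounded_iff)
    have \<eta>mult: "square_integrable M (\<lambda>\<omega>. \<eta> m \<omega> * f \<omega>)" if "square_integrable M f" for f
      using square_integrable_bounded_mult[OF that measurable_F[OF \<eta>m] B] by simp
    have \<eta>sq: "square_integrable M (\<eta> m)"
      using \<eta>mult[OF square_integrable_const[of 1]] by simp
    have Dsq: "square_integrable M ?D"
      using increment_moments[OF cm(1,3)] by (auto simp: square_integrable_def)
    have \<eta>D: "square_integrable M (\<lambda>\<omega>. \<eta> m \<omega> * ?D \<omega>)" by (rule \<eta>mult[OF Dsq])
    have S_Suc: "S (Suc m) = (\<lambda>\<omega>. S m \<omega> + \<eta> m \<omega> * ?D \<omega>)"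
      by (auto simp: S_def)
    have 0: "0 \<le> c (Suc m)" "c 0 \<le> c (Suc m)" using cm by auto
    have 1: "S (Suc m) \<in> borel_measurable (F (c (Suc m)))"
      unfolding S_Suc using W_adapted[of "c m" "c (Suc m)"] W_adapted[of "c (Suc m)" "c (Suc m)"] cm
      by (intro borel_measurable_add borel_measurable_times borel_measurable_diff
          measurable_F_mono[OF Sm] measurable_F_mono[OF \<eta>m]) auto
    have 2: "square_integrable M (S (Suc m))"
      unfolding S_Suc by (rule square_integrable_add[OF Sq \<eta>D])
    have 3: "(\<integral>\<omega>. Z \<omega> * S (Suc m) \<omega> \<partial>M) = 0" if Z: "Z \<in> borel_measurable (F (c 0))" "square_integrable M Z" for Z
    proof -
      have "(\<integral>\<omega>. (Z \<omega> * \<eta> m \<omega>) * ?D \<omega> \<partial>M) = 0"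
        by (rule increment_mult[OF cm(1,3)])
          (auto intro!: borel_measurable_times measurable_F_mono[OF Z(1)] cm \<eta>m
            square_integrable_mult_integrable[OF Z(2) \<eta>sq])
      then show ?thesis
        using Suc Z square_integrable_mult_integrable[OF Z(2) Sq] square_integrable_mult_integrable[OF Z(2) \<eta>D]
        by (simp add: S_Suc distrib_left mult.assoc)
    qed
    have 4: "(\<integral>\<omega>. indicator A \<omega> * (S (Suc m) \<omega>)\<^sup>2 \<partial>M)
        = (\<Sum>i<Suc m. (\<integral>\<omega>. indicator A \<omega> * (\<eta> i \<omega>)\<^sup>2 \<partial>M) * (c (Suc i) - c i))"
      if A: "A \<in> sets (F (c 0))" for A
    proof -
      have AM: "A \<in> sets M" using A F_sub by auto
      have Am: "indicator A \<in> borel_measurable (F (c m))"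
        using A F_mono[OF cm(2)] by (intro borel_measurable_indicator) auto
      note ASq = square_integrable_indicator[OF AM Sq]
      note A\<eta> = square_integrable_indicator[OF AM \<eta>sq]
      \<comment> \<open>The cross term: \<open>S m\<close> and \<open>\<eta> m\<close> are both
        known at \<open>c m\<close>, so the increment averages out.\<close>
      have e1: "(\<integral>\<omega>. ((indicator A \<omega> * S m \<omega>) * \<eta> m \<omega>) * ?D \<omega> \<partial>M) = 0"
        by (rule increment_mult[OF cm(1,3)])
          (auto intro!: borel_measurable_times Sm Am cm \<eta>m
            square_integrable_mult_integrable[OF ASq \<eta>sq])
      have e2: "(\<integral>\<omega>. ((indicator A \<omega> * \<eta> m \<omega>) * \<eta> m \<omega>) * (?D \<omega>)\<^sup>2 \<partial>M)
          = (\<integral>\<omega>. (indicator A \<omega> * \<eta> m \<omega>) * \<eta> m \<omega> \<partial>M) * (c (Suc m) - c m)"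
        by (rule increment_mult[OF cm(1,3)])
          (auto intro!: borel_measurable_times Am cm \<eta>m
            square_integrable_mult_integrable[OF A\<eta> \<eta>sq])
      have "(\<lambda>\<omega>. indicator A \<omega> * (S (Suc m) \<omega>)\<^sup>2) = (\<lambda>\<omega>. (indicator A \<omega> * S m \<omega>) * S m \<omega>
          + 2 * ((indicator A \<omega> * S m \<omega>) * (\<eta> m \<omega> * ?D \<omega>))
          + (indicator A \<omega> * (\<eta> m \<omega> * ?D \<omega>)) * (\<eta> m \<omega> * ?D \<omega>))"
        by (auto simp: S_Suc power2_eq_square algebra_simps)
      then have "(\<integral>\<omega>. indicator A \<omega> * (S (Suc m) \<omega>)\<^sup>2 \<partial>M) = (\<integral>\<omega>. (indicator A \<omega> * S m \<omega>) * S m \<omega> \<partial>M)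
          + 2 * (\<integral>\<omega>. (indicator A \<omega> * S m \<omega>) * (\<eta> m \<omega> * ?D \<omega>) \<partial>M)
          + (\<integral>\<omega>. (indicator A \<omega> * (\<eta> m \<omega> * ?D \<omega>)) * (\<eta> m \<omega> * ?D \<omega>) \<partial>M)"
        using square_integrable_mult_integrable[OF ASq Sq] square_integrable_mult_integrable[OF ASq \<eta>D]
          square_integrable_mult_integrable[OF square_integrable_indicator[OF AM \<eta>D] \<eta>D]
        by simp
      also have "\<dots> = (\<integral>\<omega>. indicator A \<omega> * (S m \<omega>)\<^sup>2 \<partial>M) + (\<integral>\<omega>. indicator A \<omega> * (\<eta> m \<omega>)\<^sup>2 \<partial>M) * (c (Suc m) - c m)"
        using e1 e2 by (simp add: power2_eq_square mult_ac)
      finally show ?thesis using Suc A by simp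
    qed
    show ?case using 0 1 2 3 4 by blast
  qed
  then show "S m \<in> borel_measurable (F (c m))" "square_integrable M (S m)"
    "\<And>Z. Z \<in> borel_measurable (F (c 0)) \<Longrightarrow> square_integrable M Z \<Longrightarrow> (\<integral>\<omega>. Z \<omega> * S m \<omega> \<partial>M) = 0"
    "\<And>A. A \<in> sets (F (c 0)) \<Longrightarrow> (\<integral>\<omega>. indicator A \<omega> * (S m \<omega>)\<^sup>2 \<partial>M)
        = (\<Sum>i<m. (\<integral>\<omega>. indicator A \<omega> * (\<eta> i \<omega>)\<^sup>2 \<partial>M) * (c (Suc i) - c i))"
    by blast+
qed

lemma simple_process_partition:
  assumes sp: "simple_process M F t T n \<tau> \<eta>"
  shows "i \<le> j \<Longrightarrow> j \<le> n \<Longrightarrow> \<tau> i \<le> \<tau> j" "i \<le> n \<Longrightarrow> t \<le> \<tau> i"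
proof -
  show mono: "\<tau> i \<le> \<tau> j" if "i \<le> j" "j \<le> n" for i j
    using that
  proof (induction j rule: dec_induct)
    case (step k)
    then have "\<tau> k \<le> \<tau> (Suc k)" using sp by (auto simp: simple_process_def)
    with step show ?case by auto
  qed simp
  show "t \<le> \<tau> i" if "i \<le> n"
    using mono[of 0 i] that sp by (auto simp: simple_process_def)
qed

text \<open>Clipping the partition to \<open>[a, s]\<close> turns the increment of the integral into
  a martingale transform started at \<open>a\<close>, which admits test variables from
  \<open>F a\<close> instead of just \<open>F t\<close>.\<close>

lemma simple_integral_facts:
  assumes sp: "simple_process M F t T n \<tau> \<eta>" and as: "0 \<le> t" "t \<le> a" "a \<le> s"
  shows "square_integrable M (\<lambda>\<omega>. simple_integral W n \<tau> \<eta> s \<omega> - simple_integral W n \<tau> \<eta> a \<omega>)"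
    "\<And>Z. Z \<in> borel_measurable (F a) \<Longrightarrow> square_integrable M Z \<Longrightarrow>
      (\<integral>\<omega>. Z \<omega> * (simple_integral W n \<tau> \<eta> s \<omega> - simple_integral W n \<tau> \<eta> a \<omega>) \<partial>M) = 0"
    "\<And>A. A \<in> sets (F a) \<Longrightarrow>
      (\<integral>\<omega>. indicator A \<omega> * (simple_integral W n \<tau> \<eta> s \<omega> - simple_integral W n \<tau> \<eta> a \<omega>)\<^sup>2 \<partial>M)
      = (\<integral>(r, \<omega>). indicator A \<omega> * indicator {a..s} r * (simple_value n \<tau> \<eta> r \<omega>)\<^sup>2 \<partial>(lborel \<Otimes>\<^sub>M M))"
proof -
  define c where "c = (\<lambda>i. max a (min s (\<tau> i)))"
  \<comment> \<open>If \<open>\<tau> i > s\<close>, clipping moves the grid point back to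
    \<open>s\<close>, where \<open>\<eta> i\<close> need not be measurable yet. The clipped
    increment is zero there, so the weight may be set to zero.\<close>
  define \<eta>' where "\<eta>' = (\<lambda>i \<omega>. if \<tau> i \<le> s then \<eta> i \<omega> else 0)"
  have \<tau>0: "\<tau> 0 = t" using sp by (simp add: simple_process_def)
  have c0: "c 0 = a" using as by (simp add: c_def \<tau>0)
  have step: "\<tau> i \<le> \<tau> (Suc i)" if "i < n" for i using sp that by (simp add: simple_process_def)
  have cstep: "c i \<le> c (Suc i)" if "i < n" for i
    using step[OF that] by (auto simp: c_def)
  have \<eta>m: "\<eta>' i \<in> borel_measurable (F (c i))" if "i < n" for i
  proof (cases "\<tau> i \<le> s")
    case True
    then have "\<tau> i \<le> c i" by (auto simp: c_def)
    moreover have "\<eta> i \<in> borel_measurable (F (\<tau> i))" using sp that by (simp add: simple_process_def)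
    ultimately show ?thesis using True by (simp add: \<eta>'_def measurable_F_mono)
  qed (simp add: \<eta>'_def)
  have bdd\<eta>: "bounded (\<eta> i ` space M)" if "i < n" for i
    using sp that by (simp add: simple_process_def)
  then have bdd: "bounded (\<eta>' i ` space M)" if "i < n" for i
    using that by (auto simp: \<eta>'_def bounded_iff)
  let ?S = "\<lambda>\<omega>. \<Sum>i<n. \<eta>' i \<omega> * (W (c (Suc i)) \<omega> - W (c i) \<omega>)"
  have S: "simple_integral W n \<tau> \<eta> s \<omega> - simple_integral W n \<tau> \<eta> a \<omega> = ?S \<omega>" for \<omega>
    unfolding simple_integral_def sum_subtractf[symmetric]
  proof (intro sum.cong refl)
    fix i assume "i \<in> {..<n}"
    then have "\<tau> i \<le> \<tau> (Suc i)" using step by simp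
    moreover have "W (min s x) \<omega> - W (min a x) \<omega> = W (max a (min s x)) \<omega> - W a \<omega>" for x
      using as by (auto simp: min_def max_def)
    note this[of "\<tau> i"] this[of "\<tau> (Suc i)"]
    ultimately show "\<eta> i \<omega> * (W (min (\<tau> (Suc i)) s) \<omega> - W (min (\<tau> i) s) \<omega>) -
         \<eta> i \<omega> * (W (min (\<tau> (Suc i)) a) \<omega> - W (min (\<tau> i) a) \<omega>) =
         \<eta>' i \<omega> * (W (c (Suc i)) \<omega> - W (c i) \<omega>)"
      unfolding c_def \<eta>'_def min.commute[of "\<tau> _"]
      by (cases "\<tau> i \<le> s") (simp_all add: right_diff_distrib[symmetric])
  qed
  note mt = martingale_transform[of c n \<eta>' n, OF _ cstep \<eta>m bdd order.refl, unfolded c0]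
  have a0: "0 \<le> a" using as by simp
  show "square_integrable M (\<lambda>\<omega>. simple_integral W n \<tau> \<eta> s \<omega> - simple_integral W n \<tau> \<eta> a \<omega>)"
    unfolding S by (rule mt(2)[OF a0])
  show "(\<integral>\<omega>. Z \<omega> * (simple_integral W n \<tau> \<eta> s \<omega> - simple_integral W n \<tau> \<eta> a \<omega>) \<partial>M) = 0"
    if "Z \<in> borel_measurable (F a)" "square_integrable M Z" for Z
    unfolding S using mt(3)[OF a0] that by simp
  fix A assume A: "A \<in> sets (F a)"
  have AM: "A \<in> sets M" using A F_sub by auto
  have fin: "integrable lborel (indicator {a..s} :: real \<Rightarrow> real)" by (rule integrable_indicator_lborel)
  have ind: "integrable lborel (\<lambda>r. indicator {a..s} r * indicator {\<tau> i<..\<tau> (Suc i)} r :: real)" for i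
    using integrable_mult_indicator[OF _ fin, of "{\<tau> i<..\<tau> (Suc i)}"] by (simp add: mult.commute)
  \<comment> \<open>The two sets differ at most in the point \<open>a\<close>: the time interval is
    closed on the left, the pieces of a simple process are half-open.\<close>
  have len: "(\<integral>r. indicator {a..s} r * indicator {\<tau> i<..\<tau> (Suc i)} r \<partial>lborel) = c (Suc i) - c i" if "i < n" for i
  proof -
    have "(\<integral>r. indicator {a..s} r * indicator {\<tau> i<..\<tau> (Suc i)} r \<partial>lborel) = (\<integral>r. (indicator {c i<..c (Suc i)} r :: real) \<partial>lborel)"
    proof (rule integral_cong_AE)
      show "AE r in lborel. indicator {a..s} r * indicator {\<tau> i<..\<tau> (Suc i)} r = (indicator {c i<..c (Suc i)} r :: real)"
        using AE_lborel_singleton[of a] by eventually_elim (auto simp: c_def indicator_def)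
    qed auto
    then show ?thesis using cstep[OF that] by simp
  qed
  have A\<eta>: "integrable M (\<lambda>\<omega>. indicator A \<omega> * (\<eta> i \<omega>)\<^sup>2)" if i: "i < n" for i
  proof -
    obtain B where B: "\<And>\<omega>. \<omega> \<in> space M \<Longrightarrow> \<bar>\<eta> i \<omega>\<bar> \<le> B"
      using bdd\<eta>[OF i] by (auto simp: bounded_iff)
    have "\<eta> i \<in> borel_measurable (F (\<tau> i))" using sp i by (simp add: simple_process_def)
    from square_integrable_bounded_mult[OF square_integrable_const[of 1] measurable_F[OF this] B]
    have "square_integrable M (\<eta> i)" by simp
    from square_integrable_mult_integrable[OF square_integrable_indicator[OF AM this] this]
    show ?thesis by (simp add: power2_eq_square mult.assoc)
  qed
  have sq: "indicator A \<omega> * indicator {a..s} r * (simple_value n \<tau> \<eta> r \<omega>)\<^sup>2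
      = (\<Sum>i<n. (indicator {a..s} r * indicator {\<tau> i<..\<tau> (Suc i)} r) * (indicator A \<omega> * (\<eta> i \<omega>)\<^sup>2))" for r \<omega>
  proof -
    have dis: "indicator {\<tau> i<..\<tau> (Suc i)} r * (indicator {\<tau> j<..\<tau> (Suc j)} r :: real) = 0"
      if "i < j" "j < n" for i j
      using simple_process_partition(1)[OF sp, of "Suc i" j] that by (auto simp: indicator_def)
    have "(simple_value n \<tau> \<eta> r \<omega>)\<^sup>2 = (\<Sum>i<n. (\<eta> i \<omega> * indicator {\<tau> i<..\<tau> (Suc i)} r)\<^sup>2)"
      unfolding simple_value_def
    proof (rule disjoint_sum_square)
      fix i j assume "i < n" "j < n" "i \<noteq> j"
      then have "indicator {\<tau> i<..\<tau> (Suc i)} r * (indicator {\<tau> j<..\<tau> (Suc j)} r :: real) = 0"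
        using dis[of i j] dis[of j i] by (cases "i < j") (auto simp: mult.commute)
      then show "\<eta> i \<omega> * indicator {\<tau> i<..\<tau> (Suc i)} r * (\<eta> j \<omega> * indicator {\<tau> j<..\<tau> (Suc j)} r) = 0"
        by auto
    qed
    moreover have "(indicator S r :: real)\<^sup>2 = indicator S r" for S by (simp add: indicator_def)
    ultimately show ?thesis
      by (simp add: sum_distrib_left power_mult_distrib mult_ac conj_ac)
  qed
  have "(\<integral>(r, \<omega>). indicator A \<omega> * indicator {a..s} r * (simple_value n \<tau> \<eta> r \<omega>)\<^sup>2 \<partial>(lborel \<Otimes>\<^sub>M M))
    = (\<integral>x. (\<Sum>i<n. case x of (r, \<omega>) \<Rightarrow> (indicator {a..s} r * indicator {\<tau> i<..\<tau> (Suc i)} r) * (indicator A \<omega> * (\<eta> i \<omega>)\<^sup>2)) \<partial>(lborel \<Otimes>\<^sub>M M))"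
    by (simp add: sq split_beta')
  also have "\<dots> = (\<Sum>i<n. (\<integral>(r, \<omega>). (indicator {a..s} r * indicator {\<tau> i<..\<tau> (Suc i)} r) * (indicator A \<omega> * (\<eta> i \<omega>)\<^sup>2) \<partial>(lborel \<Otimes>\<^sub>M M)))"
    by (intro Bochner_Integration.integral_sum prod.integrable_tensor(1) ind A\<eta>) auto
  also have "\<dots> = (\<Sum>i<n. (c (Suc i) - c i) * (\<integral>\<omega>. indicator A \<omega> * (\<eta> i \<omega>)\<^sup>2 \<partial>M))"
    by (intro sum.cong refl) (simp add: prod.integrable_tensor(2) ind A\<eta> len)
  \<comment> \<open>Where \<open>\<eta>'\<close> differs from \<open>\<eta>\<close>, the clipped
    interval has length zero.\<close>
  also have "\<dots> = (\<Sum>i<n. (\<integral>\<omega>. indicator A \<omega> * (\<eta>' i \<omega>)\<^sup>2 \<partial>M) * (c (Suc i) - c i))"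
  proof (intro sum.cong refl)
    fix i assume "i \<in> {..<n}"
    then show "(c (Suc i) - c i) * (\<integral>\<omega>. indicator A \<omega> * (\<eta> i \<omega>)\<^sup>2 \<partial>M)
      = (\<integral>\<omega>. indicator A \<omega> * (\<eta>' i \<omega>)\<^sup>2 \<partial>M) * (c (Suc i) - c i)"
      using step[of i] by (cases "\<tau> i \<le> s") (auto simp: \<eta>'_def c_def)
  qed
  also have "\<dots> = (\<integral>\<omega>. indicator A \<omega> * (?S \<omega>)\<^sup>2 \<partial>M)"
    using mt(4)[OF a0] A by simp
  finally show "(\<integral>\<omega>. indicator A \<omega> * (simple_integral W n \<tau> \<eta> s \<omega> - simple_integral W n \<tau> \<eta> a \<omega>)\<^sup>2 \<partial>M)
      = (\<integral>(r, \<omega>). indicator A \<omega> * indicator {a..s} r * (simple_value n \<tau> \<eta> r \<omega>)\<^sup>2 \<partial>(lborel \<Otimes>\<^sub>M M))"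
    unfolding S by simp
qed

section \<open>Progressive processes on the product space\<close>

lemma square_integrable_tensor:
  fixes f :: "real \<Rightarrow> real"
  assumes f: "square_integrable lborel f" and g: "square_integrable M g"
  shows "square_integrable (lborel \<Otimes>\<^sub>M M) (\<lambda>(r, \<omega>). f r * g \<omega>)"
proof -
  have [measurable]: "f \<in> borel_measurable lborel" "g \<in> borel_measurable M"
    using f g by (auto simp: square_integrable_def)
  have "integrable (lborel \<Otimes>\<^sub>M M) (\<lambda>(r, \<omega>). (f r)\<^sup>2 * (g \<omega>)\<^sup>2)"
    using prod.integrable_tensor(1)[of "\<lambda>r. (f r)\<^sup>2" "\<lambda>\<omega>. (g \<omega>)\<^sup>2"] f g
    by (simp add: square_integrable_def)
  then show ?thesis
    by (auto simp: square_integrable_def split_beta' power_mult_distrib)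
qed

lemma square_integrable_indicator_Icc: "square_integrable lborel (indicator {a..b::real})"
proof -
  have "(indicator {a..b} x :: real)\<^sup>2 = indicator {a..b} x" for x by (simp split: split_indicator)
  then show ?thesis using integrable_indicator_lborel[of a b] by (simp add: square_integrable_def)
qed

text \<open>The time interval in progressive measurability is closed on the right, so the slice at
  \<open>s\<close> itself can be taken.\<close>

lemma L2_prog_section:
  assumes "\<phi> \<in> L2_prog M F t T" "s \<in> {t..T}"
  shows "\<phi> s \<in> borel_measurable (F s)"
proof -
  have "(\<lambda>(r, \<omega>). \<phi> r \<omega>) \<in> borel_measurable (restrict_space borel {t..s} \<Otimes>\<^sub>M F s)"
    using assms by (auto simp: L2_prog_def progressively_measurable_def)
  from measurable_compose[OF measurable_Pair1'[of s "restrict_space borel {t..s}" "F s"] this]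
  show ?thesis using assms(2) by (simp add: space_restrict_space)
qed

text \<open>A process is controlled on \<open>{t..T}\<close> only. The indicator extends it by zero
  to the whole line, which makes Fubini with \<open>lborel\<close> applicable.\<close>

lemma L2_prog_cut:
  assumes \<phi>: "\<phi> \<in> L2_prog M F t T" and tT: "t \<le> T"
  shows "square_integrable (lborel \<Otimes>\<^sub>M M) (\<lambda>(r, \<omega>). indicator {t..T} r * \<phi> r \<omega>)"
proof (rule square_integrable_nn)
  have 1: "(\<lambda>(r, \<omega>). \<phi> r \<omega>) \<in> borel_measurable (restrict_space borel {t..T} \<Otimes>\<^sub>M F T)"
    using assms by (auto simp: L2_prog_def progressively_measurable_def)
  \<comment> \<open>Clamping time to \<open>[t, T]\<close> maps the full product measurably into the
    restricted one; the indicator then hides the altered values outside the interval.\<close>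
  have 2: "(\<lambda>(r, \<omega>). (max t (min T r), \<omega>)) \<in> measurable (borel \<Otimes>\<^sub>M M) (restrict_space borel {t..T} \<Otimes>\<^sub>M F T)"
  proof -
    have "(\<lambda>r. max t (min T r)) \<in> measurable borel (restrict_space borel {t..T})"
      using tT by (intro measurable_restrict_space2) auto
    moreover have "(\<lambda>\<omega>. \<omega>) \<in> measurable M (F T)"
      using F_sub by (auto simp: measurable_def)
    ultimately show ?thesis
      unfolding split_beta'
      by (intro measurable_Pair measurable_compose[OF measurable_fst] measurable_compose[OF measurable_snd])
  qed
  have "(\<lambda>(r, \<omega>). \<phi> (max t (min T r)) \<omega>) \<in> borel_measurable (borel \<Otimes>\<^sub>M M)"
    using measurable_compose[OF 2 1] by (simp add: split_beta')
  then have "(\<lambda>(r, \<omega>). indicator {t..T} r * \<phi> (max t (min T r)) \<omega>) \<in> borel_measurable (borel \<Otimes>\<^sub>M M)"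
    unfolding split_beta' by measurable
  also have "(\<lambda>(r, \<omega>). indicator {t..T} r * \<phi> (max t (min T r)) \<omega>) = (\<lambda>(r, \<omega>). indicator {t..T} r * \<phi> r \<omega>)"
    by (auto simp: indicator_def max_def min_def)
  also have "borel_measurable (borel \<Otimes>\<^sub>M M) = borel_measurable (lborel \<Otimes>\<^sub>M M)"
    by (intro measurable_cong_sets sets_pair_measure_cong) auto
  finally show meas: "(\<lambda>(r, \<omega>). indicator {t..T} r * \<phi> r \<omega>) \<in> borel_measurable (lborel \<Otimes>\<^sub>M M)" .
  have "(\<integral>\<^sup>+x. ennreal ((case x of (r, \<omega>) \<Rightarrow> indicator {t..T} r * \<phi> r \<omega>)\<^sup>2) \<partial>(lborel \<Otimes>\<^sub>M M))
      = (\<integral>\<^sup>+\<omega>. (\<integral>\<^sup>+r. ennreal ((indicator {t..T} r * \<phi> r \<omega>)\<^sup>2) \<partial>lborel) \<partial>M)"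
    using meas by (subst prod.nn_integral_snd[symmetric]) (auto simp: split_beta')
  also have "\<dots> = (\<integral>\<^sup>+\<omega>. (\<integral>\<^sup>+s\<in>{t..T}. ennreal ((\<phi> s \<omega>)\<^sup>2) \<partial>lborel) \<partial>M)"
    by (intro nn_integral_cong) (auto simp: indicator_def)
  also have "\<dots> < \<infinity>" using \<phi> by (simp add: L2_prog_def)
  finally show "(\<integral>\<^sup>+x. ennreal ((case x of (r, \<omega>) \<Rightarrow> indicator {t..T} r * \<phi> r \<omega>)\<^sup>2) \<partial>(lborel \<Otimes>\<^sub>M M)) < \<infinity>" .
qed

lemma simple_integral_start:
  assumes "simple_process M F t T n \<tau> \<eta>"
  shows "simple_integral W n \<tau> \<eta> t = (\<lambda>\<omega>. 0)"
  using simple_process_partition(2)[OF assms]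
  by (intro ext) (auto simp: simple_integral_def min_absorb2 intro!: sum.neutral)

lemma simple_value_cut:
  assumes sp: "simple_process M F t T n \<tau> \<eta>"
  shows "square_integrable (lborel \<Otimes>\<^sub>M M) (\<lambda>(r, \<omega>). indicator {t..T} r * simple_value n \<tau> \<eta> r \<omega>)"
proof -
  have "square_integrable (lborel \<Otimes>\<^sub>M M) (\<lambda>x. \<Sum>i<n. case x of (r, \<omega>) \<Rightarrow> (indicator {\<tau> i<..\<tau> (Suc i)} r * indicator {t..T} r) * \<eta> i \<omega>)"
  proof (rule square_integrable_sum, rule square_integrable_tensor)
    fix i assume "i \<in> {..<n}"
    then have \<eta>: "\<eta> i \<in> borel_measurable (F (\<tau> i))" "bounded (\<eta> i ` space M)"
      using sp by (auto simp: simple_process_def)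
    obtain B where B: "\<And>\<omega>. \<omega> \<in> space M \<Longrightarrow> \<bar>\<eta> i \<omega>\<bar> \<le> B"
      using \<eta>(2) by (auto simp: bounded_iff)
    show "square_integrable M (\<eta> i)"
      using square_integrable_bounded_mult[OF square_integrable_const[of 1] measurable_F[OF \<eta>(1)] B] by simp
    show "square_integrable lborel (\<lambda>r. indicator {\<tau> i<..\<tau> (Suc i)} r * indicator {t..T} r)"
      by (rule square_integrable_bounded_mult[OF square_integrable_indicator_Icc, where B = 1]) (auto simp: indicator_def)
  qed
  then show ?thesis
    by (simp only: simple_value_def sum_distrib_left split_beta' mult_ac)
qed

text \<open>All these facts are limits along the one approximating sequence of the definition. The
  test variable or event from \<open>F a\<close> stays fixed while \<open>k\<close> grows, which is
  why the simple integrals were treated between arbitrary times \<open>a\<close> and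
  \<open>s\<close>.\<close>

lemma
  assumes ito: "has_ito_integral M F W t T \<phi> I" and t: "0 \<le> t" "t \<le> T"
  shows ito_square_integrable: "\<And>s. s \<in> {t..T} \<Longrightarrow> square_integrable M (I s)"
    and ito_start: "AE \<omega> in M. I t \<omega> = 0"
    and ito_martingale: "\<And>a s Z. t \<le> a \<Longrightarrow> a \<le> s \<Longrightarrow> s \<le> T \<Longrightarrow> Z \<in> borel_measurable (F a) \<Longrightarrow> square_integrable M Z \<Longrightarrow>
      (\<integral>\<omega>. Z \<omega> * (I s \<omega> - I a \<omega>) \<partial>M) = 0"
    and ito_isometry: "\<And>a s A. t \<le> a \<Longrightarrow> a \<le> s \<Longrightarrow> s \<le> T \<Longrightarrow> A \<in> sets (F a) \<Longrightarrow>
      (\<integral>\<omega>. indicator A \<omega> * (I s \<omega> - I a \<omega>)\<^sup>2 \<partial>M)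
      = (\<integral>(r, \<omega>). indicator A \<omega> * indicator {a..s} r * (\<phi> r \<omega>)\<^sup>2 \<partial>(lborel \<Otimes>\<^sub>M M))"
proof -
  obtain n \<tau> \<eta> where sp: "\<And>k::nat. simple_process M F t T (n k) (\<tau> k) (\<eta> k)"
    and lim\<phi>: "(\<lambda>k. \<integral>\<^sup>+\<omega>. (\<integral>\<^sup>+s\<in>{t..T}. ennreal ((simple_value (n k) (\<tau> k) (\<eta> k) s \<omega> - \<phi> s \<omega>)\<^sup>2) \<partial>lborel) \<partial>M)
          \<longlonglongrightarrow> 0"
    and limI: "\<And>s. s \<in> {t..T} \<Longrightarrow> (\<lambda>k. \<integral>\<^sup>+\<omega>. ennreal ((simple_integral W (n k) (\<tau> k) (\<eta> k) s \<omega> - I s \<omega>)\<^sup>2) \<partial>M) \<longlonglongrightarrow> 0"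
    and \<phi>: "\<phi> \<in> L2_prog M F t T" and I: "\<And>s. s \<in> {t..T} \<Longrightarrow> I s \<in> borel_measurable (F s)"
    using ito unfolding has_ito_integral_def by blast
  define S where "S = (\<lambda>k. simple_integral W (n k) (\<tau> k) (\<eta> k))"
  define v where "v = (\<lambda>k (r, \<omega>). indicator {t..T} r * simple_value (n k) (\<tau> k) (\<eta> k) r \<omega>)"
  define f where "f = (\<lambda>(r, \<omega>). indicator {t..T} r * \<phi> r \<omega>)"
  have S: "square_integrable M (S k s)" if "s \<in> {t..T}" for k s
    using simple_integral_facts(1)[OF sp[of k], of t s] simple_integral_start[OF sp[of k]] that t
    by (simp add: S_def)
  have v: "square_integrable (lborel \<Otimes>\<^sub>M M) (v k)" for k
    unfolding v_def by (rule simple_value_cut[OF sp])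
  have f: "square_integrable (lborel \<Otimes>\<^sub>M M) f"
    unfolding f_def by (rule L2_prog_cut[OF \<phi> t(2)])
  show Isq: "square_integrable M (I s)" if s: "s \<in> {t..T}" for s
    using L2_limit_square_integrable[of M "\<lambda>k. S k s" "I s", OF S[OF s] measurable_F[OF I[OF s]]] limI[OF s]
    by (simp add: S_def)
  \<comment> \<open>Simple integrals vanish at \<open>t\<close>, so the second moment of
    \<open>I t\<close> is the constant value of a sequence tending to zero.\<close>
  have "(\<lambda>k::nat. \<integral>\<^sup>+\<omega>. ennreal ((I t \<omega>)\<^sup>2) \<partial>M) \<longlonglongrightarrow> 0"
    using limI[of t] t simple_integral_start[OF sp] by simp
  then have "(\<integral>\<^sup>+\<omega>. ennreal ((I t \<omega>)\<^sup>2) \<partial>M) = 0"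
    by (simp add: LIMSEQ_const_iff)
  then show "AE \<omega> in M. I t \<omega> = 0"
    using measurable_F[OF I[of t]] t by (subst (asm) nn_integral_0_iff_AE) auto
  have limd: "(\<lambda>k. \<integral>\<^sup>+\<omega>. ennreal (((S k s \<omega> - S k a \<omega>) - (I s \<omega> - I a \<omega>))\<^sup>2) \<partial>M) \<longlonglongrightarrow> 0"
    if s: "s \<in> {t..T}" and a: "a \<in> {t..T}" for s a
  proof -
    have [measurable]: "I s \<in> borel_measurable M" "I a \<in> borel_measurable M"
      "\<And>k. S k s \<in> borel_measurable M" "\<And>k. S k a \<in> borel_measurable M"
      using Isq[OF s] Isq[OF a] S[OF s] S[OF a] by (auto simp: square_integrable_def)
    let ?e = "\<lambda>s k. \<integral>\<^sup>+\<omega>. ennreal ((S k s \<omega> - I s \<omega>)\<^sup>2) \<partial>M"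
    have lim: "(\<lambda>k. 2 * ?e s k + 2 * ?e a k) \<longlonglongrightarrow> 2 * 0 + 2 * 0"
      using limI[OF s] limI[OF a] by (intro tendsto_intros) (auto simp: S_def)
    have "(\<integral>\<^sup>+\<omega>. ennreal (((S k s \<omega> - S k a \<omega>) - (I s \<omega> - I a \<omega>))\<^sup>2) \<partial>M) \<le> 2 * ?e s k + 2 * ?e a k" for k
    proof -
      have ineq: "((p - q) - (p' - q'))\<^sup>2 \<le> 2 * (p - p')\<^sup>2 + 2 * (q - q')\<^sup>2" for p q p' q' :: real
        using zero_le_power2[of "(p - p') + (q - q')"] by (simp add: power2_eq_square algebra_simps)
      have "(\<integral>\<^sup>+\<omega>. ennreal (((S k s \<omega> - S k a \<omega>) - (I s \<omega> - I a \<omega>))\<^sup>2) \<partial>M)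
        \<le> (\<integral>\<^sup>+\<omega>. 2 * ennreal ((S k s \<omega> - I s \<omega>)\<^sup>2) + 2 * ennreal ((S k a \<omega> - I a \<omega>)\<^sup>2) \<partial>M)"
      proof (rule nn_integral_mono)
        fix \<omega>
        show "ennreal (((S k s \<omega> - S k a \<omega>) - (I s \<omega> - I a \<omega>))\<^sup>2)
          \<le> 2 * ennreal ((S k s \<omega> - I s \<omega>)\<^sup>2) + 2 * ennreal ((S k a \<omega> - I a \<omega>)\<^sup>2)"
          using ennreal_leI[OF ineq[of "S k s \<omega>" "S k a \<omega>" "I s \<omega>" "I a \<omega>"]]
          by (simp add: ennreal_plus ennreal_mult)
      qed
      also have "\<dots> = 2 * ?e s k + 2 * ?e a k"
        by (subst nn_integral_add) (auto simp: nn_integral_cmult)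
      finally show ?thesis .
    qed
    then show ?thesis
      by (intro tendsto_sandwich[OF _ _ tendsto_const lim[simplified]]) auto
  qed
  \<comment> \<open>The definition integrates over time inside and over \<open>M\<close> outside;
    Tonelli turns this into one squared distance on the product.\<close>
  have limf: "(\<lambda>k. \<integral>\<^sup>+x. ennreal ((v k x - f x)\<^sup>2) \<partial>(lborel \<Otimes>\<^sub>M M)) \<longlonglongrightarrow> 0"
  proof -
    have "(\<integral>\<^sup>+x. ennreal ((v k x - f x)\<^sup>2) \<partial>(lborel \<Otimes>\<^sub>M M))
      = (\<integral>\<^sup>+\<omega>. (\<integral>\<^sup>+s\<in>{t..T}. ennreal ((simple_value (n k) (\<tau> k) (\<eta> k) s \<omega> - \<phi> s \<omega>)\<^sup>2) \<partial>lborel) \<partial>M)" for k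
    proof -
      have "(\<integral>\<^sup>+x. ennreal ((v k x - f x)\<^sup>2) \<partial>(lborel \<Otimes>\<^sub>M M)) = (\<integral>\<^sup>+\<omega>. (\<integral>\<^sup>+r. ennreal ((v k (r, \<omega>) - f (r, \<omega>))\<^sup>2) \<partial>lborel) \<partial>M)"
        using v[of k] f by (intro prod.nn_integral_snd[symmetric]) (auto simp: square_integrable_def)
      also have "\<dots> = (\<integral>\<^sup>+\<omega>. (\<integral>\<^sup>+s\<in>{t..T}. ennreal ((simple_value (n k) (\<tau> k) (\<eta> k) s \<omega> - \<phi> s \<omega>)\<^sup>2) \<partial>lborel) \<partial>M)"
        by (intro nn_integral_cong) (auto simp: indicator_def v_def f_def)
      finally show ?thesis .
    qed
    with lim\<phi> show ?thesis by simp
  qed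
  fix a s assume as: "t \<le> a" "a \<le> s" "s \<le> T"
  then have ins: "s \<in> {t..T}" "a \<in> {t..T}" using t by auto
  note dS = square_integrable_diff[OF S[OF ins(1)] S[OF ins(2)]]
  note dI = square_integrable_diff[OF Isq[OF ins(1)] Isq[OF ins(2)]]
  show "(\<integral>\<omega>. Z \<omega> * (I s \<omega> - I a \<omega>) \<partial>M) = 0" if Z: "Z \<in> borel_measurable (F a)" "square_integrable M Z" for Z
  proof -
    have "(\<lambda>k. \<integral>\<omega>. Z \<omega> * (S k s \<omega> - S k a \<omega>) \<partial>M) \<longlonglongrightarrow> (\<integral>\<omega>. Z \<omega> * (I s \<omega> - I a \<omega>) \<partial>M)"
      by (rule L2_tendsto_integral_mult[OF Z(2) dS dI limd[OF ins]])
    moreover have "(\<integral>\<omega>. Z \<omega> * (S k s \<omega> - S k a \<omega>) \<partial>M) = 0" for k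
      unfolding S_def using simple_integral_facts(2)[OF sp _ _ _ Z] as t by simp
    ultimately show ?thesis by (simp add: LIMSEQ_const_iff)
  qed
  fix A assume A: "A \<in> sets (F a)"
  then have AM [measurable]: "A \<in> sets M" using F_sub by auto
  let ?c = "\<lambda>(r, \<omega>). indicator A \<omega> * indicator {a..s} r :: real"
  have 1: "(\<lambda>k. \<integral>\<omega>. indicator A \<omega> * (S k s \<omega> - S k a \<omega>)\<^sup>2 \<partial>M) \<longlonglongrightarrow> (\<integral>\<omega>. indicator A \<omega> * (I s \<omega> - I a \<omega>)\<^sup>2 \<partial>M)"
    by (rule L2_tendsto_integral_square[OF dS dI limd[OF ins]]) (auto simp: indicator_def)
  have 2: "(\<lambda>k. \<integral>x. ?c x * (v k x)\<^sup>2 \<partial>(lborel \<Otimes>\<^sub>M M)) \<longlonglongrightarrow> (\<integral>x. ?c x * (f x)\<^sup>2 \<partial>(lborel \<Otimes>\<^sub>M M))"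
    by (rule L2_tendsto_integral_square[OF v f limf]) (auto simp: indicator_def split_beta')
  have 3: "(\<integral>\<omega>. indicator A \<omega> * (S k s \<omega> - S k a \<omega>)\<^sup>2 \<partial>M) = (\<integral>x. ?c x * (v k x)\<^sup>2 \<partial>(lborel \<Otimes>\<^sub>M M))" for k
    unfolding S_def simple_integral_facts(3)[OF sp t(1) as(1,2) A]
    using as by (intro Bochner_Integration.integral_cong) (auto simp: v_def indicator_def)
  have "(\<integral>\<omega>. indicator A \<omega> * (I s \<omega> - I a \<omega>)\<^sup>2 \<partial>M) = (\<integral>x. ?c x * (f x)\<^sup>2 \<partial>(lborel \<Otimes>\<^sub>M M))"
    using LIMSEQ_unique[OF 1 2[folded 3]] .
  also have "\<dots> = (\<integral>(r, \<omega>). indicator A \<omega> * indicator {a..s} r * (\<phi> r \<omega>)\<^sup>2 \<partial>(lborel \<Otimes>\<^sub>M M))"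
    using as by (intro Bochner_Integration.integral_cong) (auto simp: f_def indicator_def)
  finally show "(\<integral>\<omega>. indicator A \<omega> * (I s \<omega> - I a \<omega>)\<^sup>2 \<partial>M)
      = (\<integral>(r, \<omega>). indicator A \<omega> * indicator {a..s} r * (\<phi> r \<omega>)\<^sup>2 \<partial>(lborel \<Otimes>\<^sub>M M))" .
qed

section \<open>The energy identity\<close>

lemma AE_square_integrable_path:
  fixes B :: "real \<times> 'a \<Rightarrow> real"
  assumes B: "square_integrable (lborel \<Otimes>\<^sub>M M) B"
  shows "AE \<omega> in M. square_integrable lborel (\<lambda>r. B (r, \<omega>))"
    and "AE r in lborel. square_integrable M (\<lambda>\<omega>. B (r, \<omega>))"
    and "integrable M (\<lambda>\<omega>. \<integral>r. (B (r, \<omega>))\<^sup>2 \<partial>lborel)"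
proof -
  have [measurable]: "B \<in> borel_measurable (lborel \<Otimes>\<^sub>M M)" using B by (simp add: square_integrable_def)
  have int: "integrable (lborel \<Otimes>\<^sub>M M) (case_prod (\<lambda>r \<omega>. (B (r, \<omega>))\<^sup>2))"
    using B by (simp add: square_integrable_def split_beta')
  have "AE \<omega> in M. integrable lborel (\<lambda>r. (B (r, \<omega>))\<^sup>2)"
    using prod.AE_integrable_snd[OF int] by simp
  then show "AE \<omega> in M. square_integrable lborel (\<lambda>r. B (r, \<omega>))"
    using AE_space by eventually_elim (auto simp: square_integrable_def)
  have "AE r in lborel. integrable M (\<lambda>\<omega>. (B (r, \<omega>))\<^sup>2)"
    using prod.AE_integrable_fst[OF int] by simp
  then show "AE r in lborel. square_integrable M (\<lambda>\<omega>. B (r, \<omega>))"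
    by eventually_elim (auto simp: square_integrable_def)
  show "integrable M (\<lambda>\<omega>. \<integral>r. (B (r, \<omega>))\<^sup>2 \<partial>lborel)"
    using prod.integrable_snd[OF int] by simp
qed

lemma AE_prod_snd:
  assumes "AE \<omega> in M. Q \<omega>"
  shows "AE x in (lborel :: real measure) \<Otimes>\<^sub>M M. Q (snd x)"
proof -
  obtain N where N: "{\<omega> \<in> space M. \<not> Q \<omega>} \<subseteq> N" "N \<in> null_sets M"
    using assms by (auto simp: eventually_ae_filter)
  have [measurable]: "N \<in> sets M" using N(2) by auto
  have "AE x in (lborel :: real measure) \<Otimes>\<^sub>M M. snd x \<notin> N"
  proof (rule prod.AE_pair_measure)
    show "{x \<in> space ((lborel :: real measure) \<Otimes>\<^sub>M M). snd x \<notin> N} \<in> sets (lborel \<Otimes>\<^sub>M M)" by measurable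
  qed (use AE_not_in[OF N(2)] in auto)
  then show ?thesis
    using AE_space by eventually_elim (use N(1) in \<open>auto simp: space_pair_measure\<close>)
qed

text \<open>One random variable dominates all primitives: \<open>H\<close>, the path integral of the
  absolute value of \<open>B\<close>, whose square is at most the interval length times the integral
  of \<open>B^2\<close> by Cauchy-Schwarz. As \<open>H\<close> does not depend on the upper limit,
  it also gives a bound on the product space.\<close>

lemma square_integrable_primitive:
  fixes B :: "real \<times> 'a \<Rightarrow> real"
  assumes B: "square_integrable (lborel \<Otimes>\<^sub>M M) B" and supp: "\<And>r \<omega>. r \<notin> {t..T} \<Longrightarrow> B (r, \<omega>) = 0"
    and \<xi>: "square_integrable M \<xi>"
  shows "square_integrable (lborel \<Otimes>\<^sub>M M) (\<lambda>(r, \<omega>). indicator {t..T} r * (\<xi> \<omega> + (\<integral>q. indicator {..r} q * B (q, \<omega>) \<partial>lborel)))"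
    and "AE \<omega> in M. integrable lborel (\<lambda>r. B (r, \<omega>))"
    and "square_integrable M (\<lambda>\<omega>. \<integral>q. indicator {..s} q * B (q, \<omega>) \<partial>lborel)"
proof -
  have Bm [measurable]: "B \<in> borel_measurable (lborel \<Otimes>\<^sub>M M)" and [measurable]: "\<xi> \<in> borel_measurable M"
    using B \<xi> by (auto simp: square_integrable_def)
  have ind: "square_integrable lborel (indicator {t..T} :: real \<Rightarrow> real)" by (rule square_integrable_indicator_Icc)
  have ind2: "(\<integral>r. (indicator {t..T} r :: real)\<^sup>2 \<partial>lborel) \<le> \<bar>T - t\<bar>"
  proof -
    have "(indicator {t..T} x :: real)\<^sup>2 = indicator {t..T} x" for x by (simp split: split_indicator)
    then show ?thesis by (cases "t \<le> T") auto
  qed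
  have cut: "B (r, \<omega>) = indicator {t..T} r * B (r, \<omega>)" for r \<omega>
    using supp[of r \<omega>] by (auto simp: indicator_def)
  define H where "H = (\<lambda>\<omega>. \<integral>q. \<bar>B (q, \<omega>)\<bar> \<partial>lborel)"
  have [measurable]: "H \<in> borel_measurable M" unfolding H_def by measurable
  have absB: "square_integrable lborel (\<lambda>r. \<bar>B (r, \<omega>)\<bar>)" if "square_integrable lborel (\<lambda>r. B (r, \<omega>))" for \<omega>
    using that by (auto simp: square_integrable_def)
  have int: "integrable lborel (\<lambda>r. B (r, \<omega>))" if "square_integrable lborel (\<lambda>r. B (r, \<omega>))" for \<omega>
    using square_integrable_mult_integrable[OF ind that] by (simp add: cut[symmetric])
  show AEint: "AE \<omega> in M. integrable lborel (\<lambda>r. B (r, \<omega>))"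
    using AE_square_integrable_path(1)[OF B] by eventually_elim (rule int)
  have Hbound: "AE \<omega> in M. norm ((H \<omega>)\<^sup>2) \<le> norm (\<bar>T - t\<bar> * (\<integral>r. (B (r, \<omega>))\<^sup>2 \<partial>lborel))"
    using AE_square_integrable_path(1)[OF B]
  proof eventually_elim
    case (elim \<omega>)
    have "H \<omega> = (\<integral>r. indicator {t..T} r * \<bar>B (r, \<omega>)\<bar> \<partial>lborel)"
      unfolding H_def by (subst cut) (simp add: abs_mult)
    then have "(H \<omega>)\<^sup>2 \<le> (\<integral>r. (indicator {t..T} r :: real)\<^sup>2 \<partial>lborel) * (\<integral>r. (\<bar>B (r, \<omega>)\<bar>)\<^sup>2 \<partial>lborel)"
      using Cauchy_Schwarz_integral[OF ind absB[OF elim]] by simp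
    also have "\<dots> \<le> \<bar>T - t\<bar> * (\<integral>r. (\<bar>B (r, \<omega>)\<bar>)\<^sup>2 \<partial>lborel)"
      by (rule mult_right_mono[OF ind2]) simp
    finally show ?case by (simp add: abs_mult)
  qed
  then have H: "square_integrable M H"
    unfolding square_integrable_def
    by (intro conjI Bochner_Integration.integrable_bound[OF _ _ Hbound])
      (auto intro!: AE_square_integrable_path(3)[OF B])
  have le: "\<bar>\<integral>q. indicator {..s} q * B (q, \<omega>) \<partial>lborel\<bar> \<le> H \<omega>" if "integrable lborel (\<lambda>r. B (r, \<omega>))" for s \<omega>
  proof -
    have "\<bar>\<integral>q. indicator {..s} q * B (q, \<omega>) \<partial>lborel\<bar> \<le> (\<integral>q. \<bar>indicator {..s} q * B (q, \<omega>)\<bar> \<partial>lborel)"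
      by (rule integral_abs_bound)
    also have "\<dots> \<le> H \<omega>"
      unfolding H_def using integrable_abs[OF that] integrable_mult_indicator[of "{..s}", OF _ integrable_abs[OF that]]
      by (intro integral_mono) (auto simp: abs_mult indicator_def)
    finally show ?thesis .
  qed
  show "square_integrable M (\<lambda>\<omega>. \<integral>q. indicator {..s} q * B (q, \<omega>) \<partial>lborel)"
  proof (rule square_integrable_bound[OF H])
    show "AE \<omega> in M. \<bar>\<integral>q. indicator {..s} q * B (q, \<omega>) \<partial>lborel\<bar> \<le> \<bar>H \<omega>\<bar>"
      using AEint by eventually_elim (rule order_trans[OF le abs_ge_self])
  qed measurable
  let ?V = "\<lambda>(r, \<omega>). indicator {t..T} r * (\<xi> \<omega> + (\<integral>q. indicator {..r} q * B (q, \<omega>) \<partial>lborel))"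
  \<comment> \<open>Written as the comparison \<open>q \<le> r\<close>, the indicator of
    \<open>{..r}\<close> is visibly measurable jointly in both times.\<close>
  have "?V = (\<lambda>(r, \<omega>). indicator {t..T} r * (\<xi> \<omega> + (\<integral>q. (if q \<le> r then 1 else 0) * B (q, \<omega>) \<partial>lborel)))"
    by (auto simp: indicator_def of_bool_def intro!: ext)
  also have "\<dots> \<in> borel_measurable (lborel \<Otimes>\<^sub>M M)"
    by measurable
  finally have Vm: "?V \<in> borel_measurable (lborel \<Otimes>\<^sub>M M)" .
  show "square_integrable (lborel \<Otimes>\<^sub>M M) ?V"
  proof (rule square_integrable_bound[OF _ Vm])
    show "square_integrable (lborel \<Otimes>\<^sub>M M) (\<lambda>(r, \<omega>). indicator {t..T} r * (\<bar>\<xi> \<omega>\<bar> + H \<omega>))"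
      using \<xi> H by (intro square_integrable_tensor ind square_integrable_add) (auto simp: square_integrable_def)
    have "AE x in (lborel :: real measure) \<Otimes>\<^sub>M M. integrable lborel (\<lambda>r. B (r, snd x))"
      by (rule AE_prod_snd[OF AEint])
    then show "AE x in lborel \<Otimes>\<^sub>M M. \<bar>?V x\<bar> \<le> \<bar>case x of (r, \<omega>) \<Rightarrow> indicator {t..T} r * (\<bar>\<xi> \<omega>\<bar> + H \<omega>)\<bar>"
    proof eventually_elim
      case (elim x)
      show ?case
        using le[OF elim, of "fst x"] by (auto simp: split_beta' abs_mult indicator_def)
    qed
  qed
qed

text \<open>With \<open>x = V + K\<close>, where \<open>V\<close> is the initial value plus the
  drift, the pathwise product rule yields \<open>2 B V\<close> from \<open>V^2\<close>. In
  \<open>2 V K\<close> the value \<open>K s\<close> is traded for \<open>K q = x - V\<close> at the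
  time \<open>q\<close> of the drift, which yields \<open>2 B (x - V)\<close>. The terms with
  \<open>V\<close> cancel and \<open>2 B x\<close> remains.\<close>

lemma second_moment_identity:
  fixes B x :: "real \<times> 'a \<Rightarrow> real" and K :: "real \<Rightarrow> 'a \<Rightarrow> real"
  assumes t: "0 \<le> t" "t \<le> s" "s \<le> T" and A: "A \<in> sets (F t)"
    and B: "square_integrable (lborel \<Otimes>\<^sub>M M) B" and supp: "\<And>r \<omega>. r \<notin> {t..T} \<Longrightarrow> B (r, \<omega>) = 0"
    and Badapted: "\<And>r. r \<in> {t..s} \<Longrightarrow> (\<lambda>\<omega>. B (r, \<omega>)) \<in> borel_measurable (F r)"
    and x: "square_integrable (lborel \<Otimes>\<^sub>M M) x"
    and \<xi>: "\<xi> \<in> borel_measurable (F t)" "square_integrable M \<xi>"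
    and K: "\<And>r. r \<in> {t..s} \<Longrightarrow> square_integrable M (K r)"
    and mart: "\<And>r Z. r \<in> {t..s} \<Longrightarrow> Z \<in> borel_measurable (F r) \<Longrightarrow> square_integrable M Z \<Longrightarrow>
      (\<integral>\<omega>. Z \<omega> * (K s \<omega> - K r \<omega>) \<partial>M) = 0"
    and Kt: "AE \<omega> in M. K t \<omega> = 0"
    and dec: "\<And>r. r \<in> {t..s} \<Longrightarrow> AE \<omega> in M. x (r, \<omega>) = \<xi> \<omega> + (\<integral>q. indicator {..r} q * B (q, \<omega>) \<partial>lborel) + K r \<omega>"
  shows "(\<integral>\<omega>. indicator A \<omega> * (x (s, \<omega>))\<^sup>2 \<partial>M) = (\<integral>\<omega>. indicator A \<omega> * (\<xi> \<omega>)\<^sup>2 \<partial>M)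
      + (\<integral>(r, \<omega>). indicator A \<omega> * indicator {..s} r * (2 * B (r, \<omega>) * x (r, \<omega>)) \<partial>(lborel \<Otimes>\<^sub>M M))
      + (\<integral>\<omega>. indicator A \<omega> * (K s \<omega>)\<^sup>2 \<partial>M)"
proof -
  let ?P = "(lborel :: real measure) \<Otimes>\<^sub>M M"
  have AM [measurable]: "A \<in> sets M" using A F_sub by auto
  have [measurable]: "B \<in> borel_measurable ?P" "x \<in> borel_measurable ?P" "\<xi> \<in> borel_measurable M"
    using B x \<xi> by (auto simp: square_integrable_def)
  have s: "s \<in> {t..s}" "t \<in> {t..s}" using t by auto
  define V where "V = (\<lambda>r \<omega>. \<xi> \<omega> + (\<integral>q. indicator {..r} q * B (q, \<omega>) \<partial>lborel))"
  \<comment> \<open>The cutoff is square integrable on the product and agrees with \<open>V\<close>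
    wherever \<open>B\<close> is nonzero, so it may replace \<open>V\<close> in every product with
    \<open>B\<close>.\<close>
  define v where "v = (\<lambda>(r, \<omega>). indicator {t..T} r * V r \<omega>)"
  note prim = square_integrable_primitive[OF B supp \<xi>(2)]
  have v: "square_integrable ?P v"
    unfolding v_def V_def by (rule prim(1))
  have [measurable]: "v \<in> borel_measurable ?P" using v by (simp add: square_integrable_def)
  have V: "square_integrable M (V r)" for r
    unfolding V_def by (rule square_integrable_add[OF \<xi>(2) prim(3)])
  have Bv: "B (r, \<omega>) * V r \<omega> = B (r, \<omega>) * v (r, \<omega>)" for r \<omega>
    using supp[of r \<omega>] by (auto simp: v_def indicator_def)
  define cB where "cB = (\<lambda>(r, \<omega>). (indicator A \<omega> * indicator {..s} r) * B (r, \<omega>))"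
  have cB: "square_integrable ?P cB"
    unfolding cB_def split_beta'
    by (simp only: prod.collapse, rule square_integrable_bounded_mult[OF B, where B = 1]) (auto simp: indicator_def)
  have [measurable]: "cB \<in> borel_measurable ?P" using cB by (simp add: square_integrable_def)
  have intv: "integrable ?P (\<lambda>z. cB z * v z)" and intx: "integrable ?P (\<lambda>z. cB z * x z)"
    by (rule square_integrable_mult_integrable[OF cB v], rule square_integrable_mult_integrable[OF cB x])
  have AE_int: "AE \<omega> in M. integrable lborel (\<lambda>r. B (r, \<omega>))" by (rule prim(2))

  have cBv: "integrable M (\<lambda>\<omega>. \<integral>r. cB (r, \<omega>) * v (r, \<omega>) \<partial>lborel)"
    using prod.integrable_snd[of "\<lambda>r \<omega>. cB (r, \<omega>) * v (r, \<omega>)"] intv by (simp add: split_beta')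
  have "AE \<omega> in M. indicator A \<omega> * (V s \<omega>)\<^sup>2 = indicator A \<omega> * (\<xi> \<omega>)\<^sup>2 + 2 * (\<integral>r. cB (r, \<omega>) * v (r, \<omega>) \<partial>lborel)"
    using AE_int
  proof eventually_elim
    case (elim \<omega>)
    have "V s \<omega> * V s \<omega> = \<xi> \<omega> * \<xi> \<omega> + (\<integral>r. indicator {..s} r * (B (r, \<omega>) * V r \<omega> + V r \<omega> * B (r, \<omega>)) \<partial>lborel)"
      unfolding V_def by (rule absolutely_continuous_product[OF elim elim])
    also have "(\<integral>r. indicator {..s} r * (B (r, \<omega>) * V r \<omega> + V r \<omega> * B (r, \<omega>)) \<partial>lborel)
        = (\<integral>r. 2 * (indicator {..s} r * (B (r, \<omega>) * v (r, \<omega>))) \<partial>lborel)"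
    proof (intro Bochner_Integration.integral_cong refl)
      fix r
      have "B (r, \<omega>) * V r \<omega> + V r \<omega> * B (r, \<omega>) = 2 * (B (r, \<omega>) * v (r, \<omega>))"
        using Bv[of r \<omega>] by simp
      then show "indicator {..s} r * (B (r, \<omega>) * V r \<omega> + V r \<omega> * B (r, \<omega>)) = 2 * (indicator {..s} r * (B (r, \<omega>) * v (r, \<omega>)))"
        by (simp only: mult.left_commute)
    qed
    finally have "V s \<omega> * V s \<omega> = \<xi> \<omega> * \<xi> \<omega> + 2 * (\<integral>r. indicator {..s} r * (B (r, \<omega>) * v (r, \<omega>)) \<partial>lborel)"
      by simp
    then show ?case by (cases "\<omega> \<in> A") (simp_all add: cB_def power2_eq_square mult.assoc)
  qed
  then have "(\<integral>\<omega>. indicator A \<omega> * (V s \<omega>)\<^sup>2 \<partial>M) = (\<integral>\<omega>. indicator A \<omega> * (\<xi> \<omega>)\<^sup>2 + 2 * (\<integral>r. cB (r, \<omega>) * v (r, \<omega>) \<partial>lborel) \<partial>M)"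
    using square_integrableD(1)[OF V[of s]] borel_measurable_integrable[OF cBv]
    by (intro integral_cong_AE; (assumption | measurable))
  also have "\<dots> = (\<integral>\<omega>. indicator A \<omega> * (\<xi> \<omega>)\<^sup>2 \<partial>M) + 2 * (\<integral>\<omega>. (\<integral>r. cB (r, \<omega>) * v (r, \<omega>) \<partial>lborel) \<partial>M)"
    using square_integrable_mult_integrable[OF square_integrable_indicator[OF AM \<xi>(2)] \<xi>(2)]
      cBv
    by (simp add: power2_eq_square mult.assoc)
  also have "(\<integral>\<omega>. (\<integral>r. cB (r, \<omega>) * v (r, \<omega>) \<partial>lborel) \<partial>M) = (\<integral>z. cB z * v z \<partial>?P)"
    using prod.integral_snd[of "\<lambda>r \<omega>. cB (r, \<omega>) * v (r, \<omega>)"] intv by (simp add: split_beta')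
  finally have EV: "(\<integral>\<omega>. indicator A \<omega> * (V s \<omega>)\<^sup>2 \<partial>M) = (\<integral>\<omega>. indicator A \<omega> * (\<xi> \<omega>)\<^sup>2 \<partial>M) + 2 * (\<integral>z. cB z * v z \<partial>?P)" .

  note Ks = K[OF s(1)]
  have [measurable]: "K s \<in> borel_measurable M" using Ks by (simp add: square_integrable_def)
  have A\<xi>: "square_integrable M (\<lambda>\<omega>. indicator A \<omega> * \<xi> \<omega>)"
    by (rule square_integrable_indicator[OF AM \<xi>(2)])
  \<comment> \<open>As \<open>K\<close> starts at zero, the initial value is orthogonal to
    \<open>K s\<close>.\<close>
  have "(\<integral>\<omega>. (indicator A \<omega> * \<xi> \<omega>) * (K s \<omega> - K t \<omega>) \<partial>M) = 0"
    using A \<xi>(1) by (intro mart[OF s(2) _ A\<xi>] borel_measurable_times borel_measurable_indicator)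
  also have "(\<integral>\<omega>. (indicator A \<omega> * \<xi> \<omega>) * (K s \<omega> - K t \<omega>) \<partial>M) = (\<integral>\<omega>. (indicator A \<omega> * \<xi> \<omega>) * K s \<omega> \<partial>M)"
    using Kt square_integrableD(1)[OF K[OF s(2)]] by (intro integral_cong_AE) auto
  finally have E\<xi>K: "(\<integral>\<omega>. (indicator A \<omega> * \<xi> \<omega>) * K s \<omega> \<partial>M) = 0" .

  define h where "h = (\<lambda>q \<omega>. cB (q, \<omega>) * K s \<omega>)"
  have h: "integrable ?P (case_prod h)"
  proof -
    have "square_integrable ?P (\<lambda>(r, \<omega>). indicator {t..T} r * K s \<omega>)"
      by (rule square_integrable_tensor[OF square_integrable_indicator_Icc Ks])
    from square_integrable_mult_integrable[OF cB this]
    have "integrable ?P (\<lambda>z. cB z * (case z of (r, \<omega>) \<Rightarrow> indicator {t..T} r * K s \<omega>))" .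
    also have "(\<lambda>z. cB z * (case z of (r, \<omega>) \<Rightarrow> indicator {t..T} r * K s \<omega>)) = case_prod h"
    proof
      fix z :: "real \<times> 'a"
      show "cB z * (case z of (r, \<omega>) \<Rightarrow> indicator {t..T} r * K s \<omega>) = case_prod h z"
        using supp[of "fst z" "snd z"] by (cases z) (auto simp: h_def cB_def indicator_def)
    qed
    finally show ?thesis .
  qed
  \<comment> \<open>This is \<open>h\<close> with \<open>K s\<close> replaced by
    \<open>x - v\<close>, the value of \<open>K\<close> at time \<open>q\<close>.\<close>
  define h' where "h' = (\<lambda>q \<omega>. cB (q, \<omega>) * x (q, \<omega>) - cB (q, \<omega>) * v (q, \<omega>))"
  have h': "integrable ?P (case_prod h')"
    using intx intv by (simp add: h'_def split_beta')
  \<comment> \<open>Slices of \<open>B\<close> are square integrable for almost every time only, so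
    the martingale property is used for almost every \<open>q\<close>. For \<open>q\<close> outside
    \<open>{t..s}\<close> both sides vanish.\<close>
  have "AE q in lborel. (\<integral>\<omega>. h q \<omega> \<partial>M) = (\<integral>\<omega>. h' q \<omega> \<partial>M)"
    using AE_square_integrable_path(2)[OF B]
  proof eventually_elim
    case (elim q)
    show ?case
    proof (cases "q \<in> {t..s}")
      case True
      have Aq: "A \<in> sets (F q)" using A F_mono[of t q] True by auto
      have Z: "square_integrable M (\<lambda>\<omega>. indicator A \<omega> * B (q, \<omega>))"
        by (rule square_integrable_indicator[OF AM elim])
      have Kq: "square_integrable M (K q)" by (rule K[OF True])
      then have [measurable]: "K q \<in> borel_measurable M" by (simp add: square_integrable_def)
      have "(\<integral>\<omega>. (indicator A \<omega> * B (q, \<omega>)) * (K s \<omega> - K q \<omega>) \<partial>M) = 0"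
        using Badapted[OF True] Aq by (intro mart[OF True _ Z] borel_measurable_times borel_measurable_indicator)
      then have "(\<integral>\<omega>. (indicator A \<omega> * B (q, \<omega>)) * K s \<omega> \<partial>M) = (\<integral>\<omega>. (indicator A \<omega> * B (q, \<omega>)) * K q \<omega> \<partial>M)"
        using square_integrable_mult_integrable[OF Z Ks] square_integrable_mult_integrable[OF Z Kq]
        by (simp add: right_diff_distrib)
      also have "\<dots> = (\<integral>\<omega>. (indicator A \<omega> * B (q, \<omega>)) * (x (q, \<omega>) - v (q, \<omega>)) \<partial>M)"
      proof (rule integral_cong_AE)
        show "AE \<omega> in M. (indicator A \<omega> * B (q, \<omega>)) * K q \<omega> = (indicator A \<omega> * B (q, \<omega>)) * (x (q, \<omega>) - v (q, \<omega>))"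
          using dec[OF True] by eventually_elim (use True t in \<open>simp add: v_def V_def\<close>)
      qed measurable
      finally show ?thesis
        using True by (simp add: h_def h'_def cB_def right_diff_distrib)
    next
      case False
      then have "cB (q, \<omega>) = 0" for \<omega>
        using supp[of q \<omega>] by (auto simp: cB_def indicator_def)
      then show ?thesis by (simp add: h_def h'_def)
    qed
  qed
  then have hh': "(\<integral>q. (\<integral>\<omega>. h q \<omega> \<partial>M) \<partial>lborel) = (\<integral>q. (\<integral>\<omega>. h' q \<omega> \<partial>M) \<partial>lborel)"
    using prod.integrable_fst[OF h] prod.integrable_fst[OF h'] by (intro integral_cong_AE) auto
  have "AE \<omega> in M. (indicator A \<omega> * V s \<omega>) * K s \<omega> = (indicator A \<omega> * \<xi> \<omega>) * K s \<omega> + (\<integral>q. h q \<omega> \<partial>lborel)"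
  proof (rule AE_I2)
    fix \<omega>
    have "(\<integral>q. h q \<omega> \<partial>lborel) = (\<integral>q. (indicator A \<omega> * K s \<omega>) * (indicator {..s} q * B (q, \<omega>)) \<partial>lborel)"
      by (intro Bochner_Integration.integral_cong) (auto simp: h_def cB_def)
    then show "(indicator A \<omega> * V s \<omega>) * K s \<omega> = (indicator A \<omega> * \<xi> \<omega>) * K s \<omega> + (\<integral>q. h q \<omega> \<partial>lborel)"
      by (simp add: V_def algebra_simps)
  qed
  then have "(\<integral>\<omega>. (indicator A \<omega> * V s \<omega>) * K s \<omega> \<partial>M) = (\<integral>\<omega>. (indicator A \<omega> * \<xi> \<omega>) * K s \<omega> + (\<integral>q. h q \<omega> \<partial>lborel) \<partial>M)"
    using square_integrableD(1)[OF V[of s]] borel_measurable_integrable[OF prod.integrable_snd[OF h]]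
    by (intro integral_cong_AE; (assumption | measurable))
  also have "\<dots> = (\<integral>\<omega>. (\<integral>q. h q \<omega> \<partial>lborel) \<partial>M)"
    using square_integrable_mult_integrable[OF A\<xi> Ks] prod.integrable_snd[OF h] E\<xi>K by simp
  also have "\<dots> = (\<integral>z. cB z * x z \<partial>?P) - (\<integral>z. cB z * v z \<partial>?P)"
    unfolding prod.Fubini_integral[OF h] hh' unfolding prod.integral_fst[OF h']
    using intx intv by (simp add: h'_def split_beta')
  finally have EVK: "(\<integral>\<omega>. (indicator A \<omega> * V s \<omega>) * K s \<omega> \<partial>M) = (\<integral>z. cB z * x z \<partial>?P) - (\<integral>z. cB z * v z \<partial>?P)" .

  note AV = square_integrable_indicator[OF AM V[of s]]
  have "AE \<omega> in M. indicator A \<omega> * (x (s, \<omega>))\<^sup>2 = (indicator A \<omega> * V s \<omega>) * V s \<omega>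
      + 2 * ((indicator A \<omega> * V s \<omega>) * K s \<omega>) + (indicator A \<omega> * K s \<omega>) * K s \<omega>"
    using dec[OF s(1)] by eventually_elim (simp add: V_def power2_eq_square algebra_simps)
  then have "(\<integral>\<omega>. indicator A \<omega> * (x (s, \<omega>))\<^sup>2 \<partial>M) = (\<integral>\<omega>. (indicator A \<omega> * V s \<omega>) * V s \<omega>
      + 2 * ((indicator A \<omega> * V s \<omega>) * K s \<omega>) + (indicator A \<omega> * K s \<omega>) * K s \<omega> \<partial>M)"
    using square_integrableD(1)[OF V[of s]] by (intro integral_cong_AE; (assumption | measurable))
  also have "\<dots> = (\<integral>\<omega>. (indicator A \<omega> * V s \<omega>) * V s \<omega> \<partial>M)
      + 2 * (\<integral>\<omega>. (indicator A \<omega> * V s \<omega>) * K s \<omega> \<partial>M) + (\<integral>\<omega>. (indicator A \<omega> * K s \<omega>) * K s \<omega> \<partial>M)"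
    using square_integrable_mult_integrable[OF AV V[of s]] square_integrable_mult_integrable[OF AV Ks]
      square_integrable_mult_integrable[OF square_integrable_indicator[OF AM Ks] Ks]
    by simp
  also have "(\<integral>\<omega>. (indicator A \<omega> * V s \<omega>) * V s \<omega> \<partial>M) = (\<integral>\<omega>. indicator A \<omega> * (\<xi> \<omega>)\<^sup>2 \<partial>M) + 2 * (\<integral>z. cB z * v z \<partial>?P)"
    using EV by (simp add: power2_eq_square mult.assoc)
  also note EVK
  finally have "(\<integral>\<omega>. indicator A \<omega> * (x (s, \<omega>))\<^sup>2 \<partial>M) = (\<integral>\<omega>. indicator A \<omega> * (\<xi> \<omega>)\<^sup>2 \<partial>M) + 2 * (\<integral>z. cB z * x z \<partial>?P)
      + (\<integral>\<omega>. indicator A \<omega> * (K s \<omega>)\<^sup>2 \<partial>M)"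
    by (simp add: power2_eq_square mult.assoc)
  also have "2 * (\<integral>z. cB z * x z \<partial>?P)
      = (\<integral>(r, \<omega>). indicator A \<omega> * indicator {..s} r * (2 * B (r, \<omega>) * x (r, \<omega>)) \<partial>?P)"
    by (subst integral_mult_right_zero[symmetric], intro Bochner_Integration.integral_cong)
      (auto simp: cB_def)
  finally show ?thesis .
qed

section \<open>The state equation between intermediate times\<close>

lemma L2_prog_cut_from:
  assumes \<phi>: "\<phi> \<in> L2_prog M F t0 T" and t: "t0 \<le> t" "t \<le> T"
  shows "square_integrable (lborel \<Otimes>\<^sub>M M) (\<lambda>(r, \<omega>). indicator {t..T} r * \<phi> r \<omega>)"
proof -
  have "square_integrable (lborel \<Otimes>\<^sub>M M) (\<lambda>z. indicator {t..T} (fst z) * (case z of (r, \<omega>) \<Rightarrow> indicator {t0..T} r * \<phi> r \<omega>))"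
    using t by (intro square_integrable_bounded_mult[OF L2_prog_cut[OF \<phi>], where B = 1]) (auto simp: indicator_def)
  also have "(\<lambda>z. indicator {t..T} (fst z) * (case z of (r, \<omega>) \<Rightarrow> indicator {t0..T} r * \<phi> r \<omega>))
      = (\<lambda>(r, \<omega>). indicator {t..T} r * \<phi> r \<omega>)"
    using t by (auto simp: indicator_def)
  finally show ?thesis .
qed

lemma L2_prog_weighted_integrable:
  assumes \<phi>: "\<phi> \<in> L2_prog M F t0 T" and \<psi>: "\<psi> \<in> L2_prog M F t0 T" and A: "A \<in> sets M"
    and ab: "t0 \<le> a" "b \<le> T" "a \<le> b" and c: "continuous_on {a..b} c"
  shows "integrable (lborel \<Otimes>\<^sub>M M) (\<lambda>(r, \<omega>). indicator A \<omega> * indicator {a..b} r * (c r * (\<phi> r \<omega> * \<psi> r \<omega>)))"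
proof -
  have t0T: "t0 \<le> T" using ab by simp
  have [measurable]: "(\<lambda>r. indicator {a..b} r * c r) \<in> borel_measurable borel"
    using borel_measurable_continuous_on_indicator[OF _ c] by simp
  obtain C where C: "\<forall>r\<in>{a..b}. \<bar>c r\<bar> \<le> C"
    using compact_imp_bounded[OF compact_continuous_image[OF c compact_Icc]] by (auto simp: bounded_iff)
  have "square_integrable (lborel \<Otimes>\<^sub>M M) (\<lambda>z. (indicator A (snd z) * (indicator {a..b} (fst z) * c (fst z)))
      * (case z of (r, \<omega>) \<Rightarrow> indicator {t0..T} r * \<phi> r \<omega>))"
  proof (rule square_integrable_bounded_mult[OF L2_prog_cut[OF \<phi> t0T], where B = "\<bar>C\<bar>"])
    show "(\<lambda>z. indicator A (snd z) * (indicator {a..b} (fst z) * c (fst z))) \<in> borel_measurable (lborel \<Otimes>\<^sub>M M)"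
      using A by measurable
    show "\<bar>indicator A (snd z) * (indicator {a..b} (fst z) * c (fst z))\<bar> \<le> \<bar>C\<bar>" for z :: "real \<times> 'a"
      using C by (cases "fst z \<in> {a..b}") (auto simp: indicator_def intro: order_trans[OF _ abs_ge_self])
  qed
  from square_integrable_mult_integrable[OF this L2_prog_cut[OF \<psi> t0T]]
  have "integrable (lborel \<Otimes>\<^sub>M M) (\<lambda>z. (indicator A (snd z) * (indicator {a..b} (fst z) * c (fst z)))
      * (case z of (r, \<omega>) \<Rightarrow> indicator {t0..T} r * \<phi> r \<omega>) * (case z of (r, \<omega>) \<Rightarrow> indicator {t0..T} r * \<psi> r \<omega>))" .
  also have "(\<lambda>z. (indicator A (snd z) * (indicator {a..b} (fst z) * c (fst z)))
      * (case z of (r, \<omega>) \<Rightarrow> indicator {t0..T} r * \<phi> r \<omega>) * (case z of (r, \<omega>) \<Rightarrow> indicator {t0..T} r * \<psi> r \<omega>))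
    = (\<lambda>(r, \<omega>). indicator A \<omega> * indicator {a..b} r * (c r * (\<phi> r \<omega> * \<psi> r \<omega>)))"
    using ab by (auto simp: indicator_def)
  finally show ?thesis .
qed

text \<open>\<open>Xbar\<close> starts at time 0 but is used from \<open>t\<close> on, so the
  equation is differenced between two times, with one integral process \<open>I\<close> for all of
  them. Membership in \<open>L2_prog\<close> controls almost every time; the equation itself gives
  square integrability at each fixed time, the terminal one included.\<close>

lemma state_process_decomposition:
  assumes sp: "state_process M F W T \<sigma> t0 \<xi> u1 u2 X" and t0: "0 \<le> t0"
  obtains I where "has_ito_integral M F W t0 T (\<lambda>s \<omega>. \<sigma> * X s \<omega>) I"
    and "\<And>t s. t0 \<le> t \<Longrightarrow> t \<le> s \<Longrightarrow> s \<le> T \<Longrightarrow> AE \<omega> in M. X s \<omega> = X t \<omega>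
      + (\<integral>q. indicator {..s} q * (indicator {t..T} q * (u1 q \<omega> + u2 q \<omega>)) \<partial>lborel) + (I s \<omega> - I t \<omega>)"
    and "\<And>s. t0 \<le> s \<Longrightarrow> s \<le> T \<Longrightarrow> square_integrable M (X s)"
    and "t0 \<le> T \<Longrightarrow> AE \<omega> in M. X t0 \<omega> = \<xi> \<omega>"
proof -
  have u: "u1 \<in> L2_prog M F t0 T" "u2 \<in> L2_prog M F t0 T" and X: "X \<in> L2_prog M F t0 T"
    and \<xi>: "\<xi> \<in> borel_measurable (F t0)" "integrable M (\<lambda>\<omega>. (\<xi> \<omega>)\<^sup>2)"
    using sp by (auto simp: state_process_def)
  obtain I where I: "has_ito_integral M F W t0 T (\<lambda>s \<omega>. \<sigma> * X s \<omega>) I"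
    and eq: "AE \<omega> in M. \<forall>s\<in>{t0..T}. X s \<omega> = \<xi> \<omega> + (LBINT r:{t0..s}. u1 r \<omega> + u2 r \<omega>) + I s \<omega>"
    using sp unfolding state_process_def by blast
  define B where "B = (\<lambda>(r, \<omega>). indicator {t0..T} r * (u1 r \<omega> + u2 r \<omega>))"
  have \<xi>sq: "square_integrable M \<xi>"
    using \<xi> by (auto simp: square_integrable_def intro: measurable_F)
  have B: "square_integrable (lborel \<Otimes>\<^sub>M M) B" if "t0 \<le> T"
    using square_integrable_add[OF L2_prog_cut[OF u(1) that] L2_prog_cut[OF u(2) that]]
    by (simp add: B_def split_beta' distrib_left)
  have supp: "B (r, \<omega>) = 0" if "r \<notin> {t0..T}" for r \<omega> using that by (simp add: B_def)
  have LB: "(LBINT r:{t0..s}. u1 r \<omega> + u2 r \<omega>) = (\<integral>q. indicator {..s} q * B (q, \<omega>) \<partial>lborel)" if "s \<le> T" for s \<omega>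
    unfolding set_lebesgue_integral_def using that
    by (intro Bochner_Integration.integral_cong) (auto simp: B_def indicator_def)
  show thesis
  proof
    show "has_ito_integral M F W t0 T (\<lambda>s \<omega>. \<sigma> * X s \<omega>) I" by fact
    show "AE \<omega> in M. X s \<omega> = X t \<omega>
      + (\<integral>q. indicator {..s} q * (indicator {t..T} q * (u1 q \<omega> + u2 q \<omega>)) \<partial>lborel) + (I s \<omega> - I t \<omega>)"
      if ts: "t0 \<le> t" "t \<le> s" "s \<le> T" for t s
    proof -
      have T: "t0 \<le> T" using ts by simp
      have "AE \<omega> in M. integrable lborel (\<lambda>r. B (r, \<omega>))"
        by (rule square_integrable_primitive(2)[OF B[OF T] _ \<xi>sq, of t0 T]) (rule supp)
      from this eq
      show ?thesis
      proof eventually_elim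
        case (elim \<omega>)
        have i: "integrable lborel (\<lambda>q. indicator {..r} q * B (q, \<omega>))" for r
          using integrable_mult_indicator[OF _ elim(1), of "{..r}"] by simp
        have "(\<integral>q. indicator {..s} q * B (q, \<omega>) \<partial>lborel) - (\<integral>q. indicator {..t} q * B (q, \<omega>) \<partial>lborel)
          = (\<integral>q. indicator {..s} q * B (q, \<omega>) - indicator {..t} q * B (q, \<omega>) \<partial>lborel)"
          using i by simp
        also have "\<dots> = (\<integral>q. indicator {..s} q * (indicator {t..T} q * (u1 q \<omega> + u2 q \<omega>)) \<partial>lborel)"
        proof (rule integral_cong_AE)
          have "(\<lambda>q. indicator {..s} q * (indicator {t..T} q * (u1 q \<omega> + u2 q \<omega>))) = (\<lambda>q. indicator {..s} q * (indicator {t..T} q * B (q, \<omega>)))"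
            using ts by (auto simp: B_def indicator_def)
          also have "\<dots> \<in> borel_measurable lborel"
            using borel_measurable_integrable[OF elim(1)] by measurable
          finally show "(\<lambda>q. indicator {..s} q * (indicator {t..T} q * (u1 q \<omega> + u2 q \<omega>))) \<in> borel_measurable lborel" .
          \<comment> \<open>The difference of the two primitives lives on \<open>(t, s]\<close>, the
            right-hand side on \<open>[t, s]\<close>.\<close>
          show "AE q in lborel. indicator {..s} q * B (q, \<omega>) - indicator {..t} q * B (q, \<omega>)
              = indicator {..s} q * (indicator {t..T} q * (u1 q \<omega> + u2 q \<omega>))"
            using AE_lborel_singleton[of t] by eventually_elim (use ts in \<open>auto simp: B_def indicator_def\<close>)
        qed (use i in \<open>auto dest: borel_measurable_integrable\<close>)
        finally have d: "(LBINT r:{t0..s}. u1 r \<omega> + u2 r \<omega>) - (LBINT r:{t0..t}. u1 r \<omega> + u2 r \<omega>)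
            = (\<integral>q. indicator {..s} q * (indicator {t..T} q * (u1 q \<omega> + u2 q \<omega>)) \<partial>lborel)"
          using ts LB[of s \<omega>] LB[of t \<omega>] by simp
        have "X s \<omega> = \<xi> \<omega> + (LBINT r:{t0..s}. u1 r \<omega> + u2 r \<omega>) + I s \<omega>"
          "X t \<omega> = \<xi> \<omega> + (LBINT r:{t0..t}. u1 r \<omega> + u2 r \<omega>) + I t \<omega>"
          using elim(2) ts by auto
        with d show ?case by linarith
      qed
    qed
    show "square_integrable M (X s)" if s: "t0 \<le> s" "s \<le> T" for s
    proof -
      have T: "t0 \<le> T" using s by simp
      have "square_integrable M (\<lambda>\<omega>. (\<xi> \<omega> + (\<integral>q. indicator {..s} q * B (q, \<omega>) \<partial>lborel)) + I s \<omega>)"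
        using s by (intro square_integrable_add \<xi>sq square_integrable_primitive(3)[OF B[OF T] _ \<xi>sq, of t0 T]
            ito_square_integrable[OF I t0 T] supp) auto
      then show ?thesis
      proof (rule square_integrable_cong_AE)
        show "X s \<in> borel_measurable M"
          using L2_prog_section[OF X, of s] s by (auto intro: measurable_F)
        show "AE \<omega> in M. X s \<omega> = (\<xi> \<omega> + (\<integral>q. indicator {..s} q * B (q, \<omega>) \<partial>lborel)) + I s \<omega>"
          using eq by eventually_elim (use s LB in auto)
      qed
    qed
    show "AE \<omega> in M. X t0 \<omega> = \<xi> \<omega>" if T: "t0 \<le> T"
      using eq ito_start[OF I t0 T]
    proof eventually_elim
      case (elim \<omega>)
      have "(LBINT r:{t0..t0}. u1 r \<omega> + u2 r \<omega>) = 0"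
        unfolding set_lebesgue_integral_def
        by (rule integral_eq_zero_AE, use AE_lborel_singleton[of t0] in eventually_elim) auto
      then show ?case using elim T by auto
    qed
  qed
qed

text \<open>An instance of \<open>second_moment_identity\<close> in which the Ito integral is
  measured from its value at \<open>t\<close>; the isometry then converts its second moment into the
  time integral of \<open>\<sigma>^2 X^2\<close>.\<close>

lemma state_second_moment:
  assumes sp: "state_process M F W T \<sigma> t0 \<xi> u1 u2 X" and t: "0 \<le> t0" "t0 \<le> t" "t \<le> s" "s \<le> T"
    and A: "A \<in> sets (F t)"
  shows "(\<integral>\<omega>. indicator A \<omega> * (X s \<omega>)\<^sup>2 \<partial>M) = (\<integral>\<omega>. indicator A \<omega> * (X t \<omega>)\<^sup>2 \<partial>M)
    + (\<integral>(r, \<omega>). indicator A \<omega> * indicator {t..s} r *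
        (2 * (u1 r \<omega> + u2 r \<omega>) * X r \<omega> + \<sigma>\<^sup>2 * (X r \<omega>)\<^sup>2) \<partial>(lborel \<Otimes>\<^sub>M M))"
proof -
  let ?P = "(lborel :: real measure) \<Otimes>\<^sub>M M"
  have u: "u1 \<in> L2_prog M F t0 T" "u2 \<in> L2_prog M F t0 T" and X: "X \<in> L2_prog M F t0 T"
    using sp by (auto simp: state_process_def)
  obtain I where I: "has_ito_integral M F W t0 T (\<lambda>s \<omega>. \<sigma> * X s \<omega>) I"
    and dec: "\<And>t s. t0 \<le> t \<Longrightarrow> t \<le> s \<Longrightarrow> s \<le> T \<Longrightarrow> AE \<omega> in M. X s \<omega> = X t \<omega>
      + (\<integral>q. indicator {..s} q * (indicator {t..T} q * (u1 q \<omega> + u2 q \<omega>)) \<partial>lborel) + (I s \<omega> - I t \<omega>)"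
    and Xsq: "\<And>s. t0 \<le> s \<Longrightarrow> s \<le> T \<Longrightarrow> square_integrable M (X s)"
    by (rule state_process_decomposition[OF sp t(1)]) (rule that; assumption)
  have T: "t0 \<le> T" "t \<le> T" "0 \<le> t" using t by auto
  have AM: "A \<in> sets M" using A F_sub by auto
  define B where "B = (\<lambda>(r, \<omega>). indicator {t..T} r * (u1 r \<omega> + u2 r \<omega>))"
  define x where "x = (\<lambda>(r, \<omega>). indicator {t..T} r * X r \<omega>)"
  have B: "square_integrable ?P B"
    using square_integrable_add[OF L2_prog_cut_from[OF u(1) t(2) T(2)] L2_prog_cut_from[OF u(2) t(2) T(2)]]
    by (simp add: B_def split_beta' distrib_left)
  have x: "square_integrable ?P x"
    unfolding x_def by (rule L2_prog_cut_from[OF X t(2) T(2)])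
  have ineq: "r \<in> {t..s} \<Longrightarrow> r \<in> {t0..T}" for r using t by auto
  have main: "(\<integral>\<omega>. indicator A \<omega> * (x (s, \<omega>))\<^sup>2 \<partial>M) = (\<integral>\<omega>. indicator A \<omega> * (X t \<omega>)\<^sup>2 \<partial>M)
      + (\<integral>(r, \<omega>). indicator A \<omega> * indicator {..s} r * (2 * B (r, \<omega>) * x (r, \<omega>)) \<partial>?P)
      + (\<integral>\<omega>. indicator A \<omega> * (I s \<omega> - I t \<omega>)\<^sup>2 \<partial>M)"
  proof (rule second_moment_identity[OF T(3) t(3,4) A B _ _ x])
    show "B (r, \<omega>) = 0" if "r \<notin> {t..T}" for r \<omega> using that by (simp add: B_def)
    show "(\<lambda>\<omega>. B (r, \<omega>)) \<in> borel_measurable (F r)" if "r \<in> {t..s}" for r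
      using L2_prog_section[OF u(1) ineq[OF that]] L2_prog_section[OF u(2) ineq[OF that]]
      by (simp add: B_def)
    show "X t \<in> borel_measurable (F t)" using L2_prog_section[OF X, of t] t by auto
    show "square_integrable M (X t)" using Xsq[of t] t by auto
    show "square_integrable M (\<lambda>\<omega>. I r \<omega> - I t \<omega>)" if "r \<in> {t..s}" for r
      using that t by (intro square_integrable_diff ito_square_integrable[OF I t(1) T(1)]) auto
    show "(\<integral>\<omega>. Z \<omega> * (I s \<omega> - I t \<omega> - (I r \<omega> - I t \<omega>)) \<partial>M) = 0"
      if "r \<in> {t..s}" "Z \<in> borel_measurable (F r)" "square_integrable M Z" for r Z
      using ito_martingale[OF I t(1) T(1), of r s Z] that t by simp
    show "AE \<omega> in M. x (r, \<omega>) = X t \<omega> + (\<integral>q. indicator {..r} q * B (q, \<omega>) \<partial>lborel) + (I r \<omega> - I t \<omega>)"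
      if "r \<in> {t..s}" for r
      using dec[of t r] that t by (simp add: x_def B_def)
  qed simp
  have "(\<integral>(r, \<omega>). indicator A \<omega> * indicator {..s} r * (2 * B (r, \<omega>) * x (r, \<omega>)) \<partial>?P)
      = (\<integral>(r, \<omega>). indicator A \<omega> * indicator {t..s} r * (2 * (u1 r \<omega> * X r \<omega>)) + indicator A \<omega> * indicator {t..s} r * (2 * (u2 r \<omega> * X r \<omega>)) \<partial>?P)"
    using t by (intro Bochner_Integration.integral_cong) (auto simp: B_def x_def indicator_def algebra_simps)
  moreover have "(\<integral>\<omega>. indicator A \<omega> * (I s \<omega> - I t \<omega>)\<^sup>2 \<partial>M)
      = (\<integral>(r, \<omega>). indicator A \<omega> * indicator {t..s} r * (\<sigma>\<^sup>2 * (X r \<omega> * X r \<omega>)) \<partial>?P)"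
    unfolding ito_isometry[OF I t(1) T(1) t(2,3,4) A] by (simp add: power_mult_distrib power2_eq_square mult_ac)
  moreover note L2_prog_weighted_integrable[OF u(1) X AM t(2,4,3) continuous_on_const[of _ 2]]
    L2_prog_weighted_integrable[OF u(2) X AM t(2,4,3) continuous_on_const[of _ 2]]
    L2_prog_weighted_integrable[OF X X AM t(2,4,3) continuous_on_const[of _ "\<sigma>\<^sup>2"]]
  moreover have "(indicator A \<omega> * indicator {t..s} r * (2 * (u1 r \<omega> + u2 r \<omega>) * X r \<omega> + \<sigma>\<^sup>2 * (X r \<omega>)\<^sup>2) :: real)
    = (indicator A \<omega> * indicator {t..s} r * (2 * (u1 r \<omega> * X r \<omega>)) + indicator A \<omega> * indicator {t..s} r * (2 * (u2 r \<omega> * X r \<omega>)))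
      + indicator A \<omega> * indicator {t..s} r * (\<sigma>\<^sup>2 * (X r \<omega> * X r \<omega>))" for r \<omega>
    by (simp add: power2_eq_square algebra_simps)
  moreover have "x (s, \<omega>) = X s \<omega>" for \<omega> using t by (simp add: x_def)
  ultimately show ?thesis using main by (simp add: split_beta')
qed

text \<open>The four weights cover the derivative of \<open>p X^2\<close> as well as the running
  payoff, so later integrability claims are instances.\<close>

lemma L2_prog_quadratic_integrable:
  assumes u: "u1 \<in> L2_prog M F t0 T" "u2 \<in> L2_prog M F t0 T" and X: "X \<in> L2_prog M F t0 T" and A: "A \<in> sets M"
    and ab: "t0 \<le> a" "b \<le> T" "a \<le> b"
    and c: "continuous_on {a..b} c1" "continuous_on {a..b} c2" "continuous_on {a..b} c3" "continuous_on {a..b} c4"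
  shows "integrable (lborel \<Otimes>\<^sub>M M) (\<lambda>(r, \<omega>). indicator A \<omega> * indicator {a..b} r *
    (c1 r * (X r \<omega>)\<^sup>2 + c2 r * (2 * (u1 r \<omega> + u2 r \<omega>) * X r \<omega> + \<sigma>\<^sup>2 * (X r \<omega>)\<^sup>2)
      + c3 r * (u1 r \<omega>)\<^sup>2 + c4 r * (u2 r \<omega>)\<^sup>2))"
proof -
  note i = L2_prog_weighted_integrable[OF _ _ A ab]
  have "integrable (lborel \<Otimes>\<^sub>M M) (\<lambda>z.
      (case z of (r, \<omega>) \<Rightarrow> indicator A \<omega> * indicator {a..b} r * ((c1 r + c2 r * \<sigma>\<^sup>2) * (X r \<omega> * X r \<omega>)))
    + (case z of (r, \<omega>) \<Rightarrow> indicator A \<omega> * indicator {a..b} r * ((2 * c2 r) * (u1 r \<omega> * X r \<omega>)))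
    + (case z of (r, \<omega>) \<Rightarrow> indicator A \<omega> * indicator {a..b} r * ((2 * c2 r) * (u2 r \<omega> * X r \<omega>)))
    + (case z of (r, \<omega>) \<Rightarrow> indicator A \<omega> * indicator {a..b} r * (c3 r * (u1 r \<omega> * u1 r \<omega>)))
    + (case z of (r, \<omega>) \<Rightarrow> indicator A \<omega> * indicator {a..b} r * (c4 r * (u2 r \<omega> * u2 r \<omega>))))"
    by (intro Bochner_Integration.integrable_add i u X continuous_intros c)
  also have "(\<lambda>z.
      (case z of (r, \<omega>) \<Rightarrow> indicator A \<omega> * indicator {a..b} r * ((c1 r + c2 r * \<sigma>\<^sup>2) * (X r \<omega> * X r \<omega>)))
    + (case z of (r, \<omega>) \<Rightarrow> indicator A \<omega> * indicator {a..b} r * ((2 * c2 r) * (u1 r \<omega> * X r \<omega>)))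
    + (case z of (r, \<omega>) \<Rightarrow> indicator A \<omega> * indicator {a..b} r * ((2 * c2 r) * (u2 r \<omega> * X r \<omega>)))
    + (case z of (r, \<omega>) \<Rightarrow> indicator A \<omega> * indicator {a..b} r * (c3 r * (u1 r \<omega> * u1 r \<omega>)))
    + (case z of (r, \<omega>) \<Rightarrow> indicator A \<omega> * indicator {a..b} r * (c4 r * (u2 r \<omega> * u2 r \<omega>))))
    = (\<lambda>(r, \<omega>). indicator A \<omega> * indicator {a..b} r *
    (c1 r * (X r \<omega>)\<^sup>2 + c2 r * (2 * (u1 r \<omega> + u2 r \<omega>) * X r \<omega> + \<sigma>\<^sup>2 * (X r \<omega>)\<^sup>2)
      + c3 r * (u1 r \<omega>)\<^sup>2 + c4 r * (u2 r \<omega>)\<^sup>2))"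
    by (intro ext) (simp add: power2_eq_square algebra_simps split_beta')
  finally show ?thesis .
qed

text \<open>The product rule is applied to two deterministic functions, \<open>p\<close> and the
  second moment \<open>f\<close> on the event \<open>A\<close>. Both are primitives of integrable
  functions, the latter by \<open>state_second_moment\<close>.\<close>

lemma weighted_second_moment:
  assumes sp: "state_process M F W T \<sigma> t0 \<xi> u1 u2 X" and t: "0 \<le> t0" "t0 \<le> t" "t \<le> s" "s \<le> T"
    and A: "A \<in> sets (F t)"
    and p: "\<And>r. r \<in> {t..s} \<Longrightarrow> (p has_real_derivative p' r) (at r within {t..s})"
    and p': "continuous_on {t..s} p'"
  shows "p s * (\<integral>\<omega>. indicator A \<omega> * (X s \<omega>)\<^sup>2 \<partial>M) = p t * (\<integral>\<omega>. indicator A \<omega> * (X t \<omega>)\<^sup>2 \<partial>M)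
    + (\<integral>(r, \<omega>). indicator A \<omega> * indicator {t..s} r *
        (p' r * (X r \<omega>)\<^sup>2 + p r * (2 * (u1 r \<omega> + u2 r \<omega>) * X r \<omega> + \<sigma>\<^sup>2 * (X r \<omega>)\<^sup>2)) \<partial>(lborel \<Otimes>\<^sub>M M))"
proof -
  let ?P = "(lborel :: real measure) \<Otimes>\<^sub>M M"
  have u: "u1 \<in> L2_prog M F t0 T" "u2 \<in> L2_prog M F t0 T" and X: "X \<in> L2_prog M F t0 T"
    using sp by (auto simp: state_process_def)
  have AM: "A \<in> sets M" using A F_sub by auto
  have pc: "continuous_on {t..s} p"
    using p DERIV_continuous by (force simp: continuous_on_eq_continuous_within)
  note quad = L2_prog_quadratic_integrable[OF u X AM, where \<sigma> = \<sigma>]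
  define b where "b = (\<lambda>r \<omega>. 2 * (u1 r \<omega> + u2 r \<omega>) * X r \<omega> + \<sigma>\<^sup>2 * (X r \<omega>)\<^sup>2)"
  define w where "w = (\<lambda>r \<omega>. indicator A \<omega> * indicator {t..s} r * b r \<omega>)"
  define G where "G = (\<lambda>r \<omega>. indicator A \<omega> * indicator {t..s} r * (p' r * (X r \<omega>)\<^sup>2 + p r * b r \<omega>))"
  define g where "g = (\<lambda>r. \<integral>\<omega>. w r \<omega> \<partial>M)"
  define f where "f = (\<lambda>r. \<integral>\<omega>. indicator A \<omega> * (X r \<omega>)\<^sup>2 \<partial>M)"
  define p1 where "p1 = (\<lambda>r. indicator {t..s} r * p' r)"
  have w: "integrable ?P (case_prod w)"
    using quad[of t s "\<lambda>_. 0" "\<lambda>_. 1" "\<lambda>_. 0" "\<lambda>_. 0"] t by (simp add: w_def b_def)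
  have G: "integrable ?P (case_prod G)"
    using quad[of t s p' p "\<lambda>_. 0" "\<lambda>_. 0"] t p' pc by (simp add: G_def b_def)
  have g: "integrable lborel g"
    unfolding g_def by (rule prod.integrable_fst[OF w])
  have p1: "integrable lborel p1"
    using borel_integrable_atLeastAtMost'[OF p'] by (simp add: p1_def set_integrable_def)
  have fr: "f r = f t + (\<integral>q. indicator {..r} q * g q \<partial>lborel)" if r: "r \<in> {t..s}" for r
  proof -
    have wr: "indicator A \<omega> * indicator {t..r} q * b q \<omega> = indicator {..r} q * w q \<omega>" for q \<omega>
      using r by (auto simp: w_def indicator_def)
    have "integrable ?P (\<lambda>(q, \<omega>). indicator A \<omega> * indicator {t..r} q * b q \<omega>)"
      using quad[of t r "\<lambda>_. 0" "\<lambda>_. 1" "\<lambda>_. 0" "\<lambda>_. 0"] t r by (simp add: b_def)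
    from prod.integral_fst[OF this]
    have "(\<integral>(q, \<omega>). indicator A \<omega> * indicator {t..r} q * b q \<omega> \<partial>?P) = (\<integral>q. indicator {..r} q * g q \<partial>lborel)"
      by (simp add: wr g_def)
    then show ?thesis
      using state_second_moment[OF sp t(1,2) _ _ A, of r] r t by (simp add: f_def b_def)
  qed
  have pr: "p r = p t + (\<integral>q. indicator {..r} q * p1 q \<partial>lborel)" if r: "r \<in> {t..s}" for r
  proof -
    have "(\<integral>q. indicator {t..r} q *\<^sub>R p' q \<partial>lborel) = p r - p t"
    proof (intro integral_FTC_atLeastAtMost continuous_on_subset[OF p'])
      fix q assume "t \<le> q" "q \<le> r"
      then show "(p has_vector_derivative p' q) (at q within {t..r})"
        using DERIV_subset[OF p[of q], of "{t..r}"] r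
        by (auto simp: has_real_derivative_iff_has_vector_derivative)
    qed (use r in auto)
    also have "(\<integral>q. indicator {t..r} q *\<^sub>R p' q \<partial>lborel) = (\<integral>q. indicator {..r} q * p1 q \<partial>lborel)"
      using r by (intro Bochner_Integration.integral_cong) (auto simp: p1_def indicator_def)
    finally show ?thesis by simp
  qed
  have sin: "s \<in> {t..s}" using t by simp
  have "p s * f s = p t * f t + (\<integral>r. indicator {..s} r * (p1 r * (f t + (\<integral>q. indicator {..r} q * g q \<partial>lborel))
      + (p t + (\<integral>q. indicator {..r} q * p1 q \<partial>lborel)) * g r) \<partial>lborel)"
    unfolding fr[OF sin] pr[OF sin] by (rule absolutely_continuous_product[OF p1 g])
  also have "(\<integral>r. indicator {..s} r * (p1 r * (f t + (\<integral>q. indicator {..r} q * g q \<partial>lborel))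
      + (p t + (\<integral>q. indicator {..r} q * p1 q \<partial>lborel)) * g r) \<partial>lborel)
    = (\<integral>r. (\<integral>\<omega>. G r \<omega> \<partial>M) \<partial>lborel)"
  proof (rule integral_cong_AE)
    have [measurable]: "g \<in> borel_measurable borel" "p1 \<in> borel_measurable borel"
      using g p1 by (auto dest: borel_measurable_integrable)
    have "(\<integral>q. indicator {..r} q * h q \<partial>lborel) = (\<integral>q. (if q \<le> r then 1 else 0) * h q \<partial>lborel)" for h :: "real \<Rightarrow> real" and r
      by (intro Bochner_Integration.integral_cong) auto
    then show "(\<lambda>r. indicator {..s} r * (p1 r * (f t + (\<integral>q. indicator {..r} q * g q \<partial>lborel))
      + (p t + (\<integral>q. indicator {..r} q * p1 q \<partial>lborel)) * g r)) \<in> borel_measurable lborel"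
      by simp
    show "(\<lambda>r. \<integral>\<omega>. G r \<omega> \<partial>M) \<in> borel_measurable lborel"
      using prod.integrable_fst[OF G] by (rule borel_measurable_integrable)
    \<comment> \<open>Fubini makes \<open>w r\<close> integrable for almost every \<open>r\<close>,
      which is enough to split the inner expectation.\<close>
    show "AE r in lborel. indicator {..s} r * (p1 r * (f t + (\<integral>q. indicator {..r} q * g q \<partial>lborel))
      + (p t + (\<integral>q. indicator {..r} q * p1 q \<partial>lborel)) * g r) = (\<integral>\<omega>. G r \<omega> \<partial>M)"
      using prod.AE_integrable_fst[OF w]
    proof eventually_elim
      case (elim r)
      show ?case
      proof (cases "r \<in> {t..s}")
        case True
        have "square_integrable M (X r)"
          by (rule state_process_decomposition[OF sp t(1)]) (use True t in auto)
        from square_integrable_mult_integrable[OF square_integrable_indicator[OF AM this] this]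
        have i: "integrable M (\<lambda>\<omega>. indicator A \<omega> * (X r \<omega>)\<^sup>2)" by (simp add: power2_eq_square mult.assoc)
        have "(\<integral>\<omega>. G r \<omega> \<partial>M) = (\<integral>\<omega>. p' r * (indicator A \<omega> * (X r \<omega>)\<^sup>2) + p r * w r \<omega> \<partial>M)"
          using True by (intro Bochner_Integration.integral_cong) (auto simp: G_def w_def indicator_def algebra_simps)
        also have "\<dots> = p' r * f r + p r * g r"
          using i elim by (simp add: f_def g_def)
        also have "\<dots> = indicator {..s} r * (p1 r * (f t + (\<integral>q. indicator {..r} q * g q \<partial>lborel))
            + (p t + (\<integral>q. indicator {..r} q * p1 q \<partial>lborel)) * g r)"
          unfolding fr[OF True, symmetric] pr[OF True, symmetric] using True by (simp add: p1_def)
        finally show ?thesis by simp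
      next
        case False
        then show ?thesis by (simp add: p1_def g_def w_def G_def)
      qed
    qed
  qed
  also have "(\<integral>r. (\<integral>\<omega>. G r \<omega> \<partial>M) \<partial>lborel) = (\<integral>z. case_prod G z \<partial>?P)"
    by (rule prod.integral_fst[OF G])
  finally show ?thesis by (simp add: f_def G_def b_def)
qed

section \<open>The payoff tested against events\<close>

text \<open>The weight \<open>p\<close> is arbitrary here; the Riccati equation enters later through
  \<open>p'\<close>. The running payoff joins the drift of \<open>p X^2\<close> in \<open>Q\<close>.
  The start \<open>t0\<close> of the state may precede \<open>t\<close>, as it does for
  \<open>Xbar\<close>.\<close>

lemma payoff_expectation:
  fixes R :: real
  assumes sp: "state_process M F W T \<sigma> t0 \<xi> u1 u2 X" and t: "0 \<le> t0" "t0 \<le> t" "t \<le> T"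
    and p_ball: "\<forall>r\<in>{t..T}. (p has_real_derivative p' r) (at r within {t..T})"
    and p': "continuous_on {t..T} p'" and a: "continuous_on {t..T} a"
  defines "Y \<equiv> \<lambda>\<omega>. p T * (X T \<omega>)\<^sup>2 + (LBINT r:{t..T}. a r * (- (u1 r \<omega>)\<^sup>2 + R * (u2 r \<omega>)\<^sup>2))"
    and "Q \<equiv> \<lambda>r \<omega>. p' r * (X r \<omega>)\<^sup>2 + p r * (2 * (u1 r \<omega> + u2 r \<omega>) * X r \<omega> + \<sigma>\<^sup>2 * (X r \<omega>)\<^sup>2)
      + a r * (- (u1 r \<omega>)\<^sup>2 + R * (u2 r \<omega>)\<^sup>2)"
  shows "integrable M Y"
    and "\<And>A. A \<in> sets (F t) \<Longrightarrow> integrable (lborel \<Otimes>\<^sub>M M) (\<lambda>(r, \<omega>). indicator A \<omega> * indicator {t..T} r * Q r \<omega>)"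
    and "\<And>A. A \<in> sets (F t) \<Longrightarrow> (\<integral>\<omega>. indicator A \<omega> * Y \<omega> \<partial>M) = p t * (\<integral>\<omega>. indicator A \<omega> * (X t \<omega>)\<^sup>2 \<partial>M)
      + (\<integral>(r, \<omega>). indicator A \<omega> * indicator {t..T} r * Q r \<omega> \<partial>(lborel \<Otimes>\<^sub>M M))"
proof -
  let ?P = "(lborel :: real measure) \<Otimes>\<^sub>M M"
  have u: "u1 \<in> L2_prog M F t0 T" "u2 \<in> L2_prog M F t0 T" and X: "X \<in> L2_prog M F t0 T"
    using sp by (auto simp: state_process_def)
  have p: "(p has_real_derivative p' r) (at r within {t..T})" if "r \<in> {t..T}" for r
    using p_ball that by blast
  have pc: "continuous_on {t..T} p"
    using p DERIV_continuous by (force simp: continuous_on_eq_continuous_within)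
  note quad = L2_prog_quadratic_integrable[OF u X _ t(2) order.refl t(3), where \<sigma> = \<sigma>]
  define k where "k = (\<lambda>r \<omega>. a r * (- (u1 r \<omega>)\<^sup>2 + R * (u2 r \<omega>)\<^sup>2))"
  have k: "integrable ?P (\<lambda>(r, \<omega>). indicator A \<omega> * indicator {t..T} r * k r \<omega>)" if "A \<in> sets M" for A
    using quad[OF that, of "\<lambda>_. 0" "\<lambda>_. 0" "\<lambda>r. - a r" "\<lambda>r. a r * R"] a
    by (simp add: k_def continuous_intros algebra_simps)
  have h: "integrable ?P (\<lambda>(r, \<omega>). indicator A \<omega> * indicator {t..T} r *
      (p' r * (X r \<omega>)\<^sup>2 + p r * (2 * (u1 r \<omega> + u2 r \<omega>) * X r \<omega> + \<sigma>\<^sup>2 * (X r \<omega>)\<^sup>2)))" if "A \<in> sets M" for A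
    using quad[OF that, of p' p "\<lambda>_. 0" "\<lambda>_. 0"] p' pc by simp
  have Q: "indicator A \<omega> * indicator {t..T} r * Q r \<omega> = indicator A \<omega> * indicator {t..T} r *
      (p' r * (X r \<omega>)\<^sup>2 + p r * (2 * (u1 r \<omega> + u2 r \<omega>) * X r \<omega> + \<sigma>\<^sup>2 * (X r \<omega>)\<^sup>2))
      + indicator A \<omega> * indicator {t..T} r * k r \<omega>" for A r \<omega>
    by (simp add: Q_def k_def distrib_left)
  have XT: "square_integrable M (X T)"
    by (rule state_process_decomposition[OF sp t(1)]) (use t in auto)
  have L: "integrable M (\<lambda>\<omega>. LBINT r:{t..T}. k r \<omega>)"
  proof -
    have "integrable M (\<lambda>\<omega>. \<integral>r. indicator (space M) \<omega> * indicator {t..T} r * k r \<omega> \<partial>lborel)"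
      by (rule prod.integrable_snd[OF k]) auto
    also have "?this \<longleftrightarrow> ?thesis"
      by (intro Bochner_Integration.integrable_cong refl) (simp add: set_lebesgue_integral_def)
    finally show ?thesis .
  qed
  show "integrable M Y"
    unfolding Y_def using L XT by (simp add: k_def square_integrable_def)
  fix A assume A: "A \<in> sets (F t)"
  then have AM: "A \<in> sets M" using F_sub by auto
  show "integrable ?P (\<lambda>(r, \<omega>). indicator A \<omega> * indicator {t..T} r * Q r \<omega>)"
    unfolding Q split_beta' using h[OF AM] k[OF AM] by (simp add: split_beta')
  have "(\<integral>\<omega>. indicator A \<omega> * Y \<omega> \<partial>M) = p T * (\<integral>\<omega>. indicator A \<omega> * (X T \<omega>)\<^sup>2 \<partial>M) + (\<integral>\<omega>. indicator A \<omega> * (LBINT r:{t..T}. k r \<omega>) \<partial>M)"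
  proof -
    have "integrable M (\<lambda>\<omega>. indicator A \<omega> * (X T \<omega>)\<^sup>2)" "integrable M (\<lambda>\<omega>. indicator A \<omega> * (LBINT r:{t..T}. k r \<omega>))"
      using integrable_mult_indicator[OF AM L] integrable_mult_indicator[OF AM square_integrableD(2)[OF XT]] by auto
    moreover have "indicator A \<omega> * Y \<omega> = p T * (indicator A \<omega> * (X T \<omega>)\<^sup>2) + indicator A \<omega> * (LBINT r:{t..T}. k r \<omega>)" for \<omega>
      by (simp add: Y_def k_def distrib_left mult_ac)
    ultimately show ?thesis by simp
  qed
  also have "(\<integral>\<omega>. indicator A \<omega> * (LBINT r:{t..T}. k r \<omega>) \<partial>M) = (\<integral>\<omega>. (\<integral>r. indicator A \<omega> * indicator {t..T} r * k r \<omega> \<partial>lborel) \<partial>M)"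
    by (simp add: set_lebesgue_integral_def mult.assoc)
  also have "\<dots> = (\<integral>(r, \<omega>). indicator A \<omega> * indicator {t..T} r * k r \<omega> \<partial>?P)"
    by (rule prod.integral_snd[OF k[OF AM]])
  also have "p T * (\<integral>\<omega>. indicator A \<omega> * (X T \<omega>)\<^sup>2 \<partial>M) = p t * (\<integral>\<omega>. indicator A \<omega> * (X t \<omega>)\<^sup>2 \<partial>M)
    + (\<integral>(r, \<omega>). indicator A \<omega> * indicator {t..T} r *
        (p' r * (X r \<omega>)\<^sup>2 + p r * (2 * (u1 r \<omega> + u2 r \<omega>) * X r \<omega> + \<sigma>\<^sup>2 * (X r \<omega>)\<^sup>2)) \<partial>?P)"
    by (rule weighted_second_moment[OF sp t order.refl A p p'])
  finally show "(\<integral>\<omega>. indicator A \<omega> * Y \<omega> \<partial>M) = p t * (\<integral>\<omega>. indicator A \<omega> * (X t \<omega>)\<^sup>2 \<partial>M)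
      + (\<integral>(r, \<omega>). indicator A \<omega> * indicator {t..T} r * Q r \<omega> \<partial>?P)"
    unfolding Q split_beta' using h[OF AM] k[OF AM] by (simp add: split_beta')
qed

text \<open>In the derivative of \<open>p X^2\<close> the term \<open>- K p X^2\<close> absorbs the
  growth and \<open>- exp (- K (r - t)) X^2\<close> is left over. As \<open>p\<close> vanishes at
  the right end, the time integral of \<open>X^2\<close> is bounded at once, without a Gronwall
  argument. The control is integrated over all of \<open>{t..T}\<close> so that its contribution is
  independent of \<epsilon>.\<close>

lemma short_time_energy:
  assumes sp: "state_process M F W T \<sigma> t \<xi> u1 u2 X" and t: "0 \<le> t" "0 < \<epsilon>" "t + \<epsilon> \<le> T"
    and A: "A \<in> sets (F t)" and u: "u \<in> L2_prog M F t T"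
    and \<theta>: "\<And>r. r \<in> {t..<t + \<epsilon>} \<Longrightarrow> \<bar>\<theta> r\<bar> \<le> C"
    and drift: "\<And>r \<omega>. r \<in> {t..<t + \<epsilon>} \<Longrightarrow> u1 r \<omega> + u2 r \<omega> = u r \<omega> + \<theta> r * X r \<omega>"
  shows "(\<integral>(r, \<omega>). indicator A \<omega> * indicator {t..t + \<epsilon>} r * (X r \<omega>)\<^sup>2 \<partial>(lborel \<Otimes>\<^sub>M M))
    \<le> \<epsilon> * exp ((1 + 2 * C + \<sigma>\<^sup>2) * \<epsilon>) * ((\<integral>\<omega>. indicator A \<omega> * (X t \<omega>)\<^sup>2 \<partial>M)
      + (\<integral>(r, \<omega>). indicator A \<omega> * indicator {t..T} r * (u r \<omega>)\<^sup>2 \<partial>(lborel \<Otimes>\<^sub>M M)))"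
proof -
  let ?P = "(lborel :: real measure) \<Otimes>\<^sub>M M"
  \<comment> \<open>The \<open>1\<close> pays for \<open>2 u X \<le> u^2 + X^2\<close>, the
    \<open>2 * C\<close> for the feedback, and \<open>\<sigma>\<^sup>2\<close> for the
    diffusion.\<close>
  define K where "K = 1 + 2 * C + \<sigma>\<^sup>2"
  \<comment> \<open>Equal to \<epsilon> at \<open>t\<close>, whence the factor in the claim, and to
    zero at \<open>t + \<epsilon>\<close>, which removes the terminal moment.\<close>
  define p where "p = (\<lambda>r. exp (- K * (r - t)) * (t + \<epsilon> - r))"
  define p' where "p' = (\<lambda>r. - K * p r - exp (- K * (r - t)))"
  define b where "b = (\<lambda>r \<omega>. 2 * (u1 r \<omega> + u2 r \<omega>) * X r \<omega> + \<sigma>\<^sup>2 * (X r \<omega>)\<^sup>2)"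
  have AM: "A \<in> sets M" using A F_sub by auto
  have u12: "u1 \<in> L2_prog M F t T" "u2 \<in> L2_prog M F t T" and X: "X \<in> L2_prog M F t T"
    using sp by (auto simp: state_process_def)
  have "C \<ge> 0" using \<theta>[of t] t by auto
  then have K: "K \<ge> 0" by (simp add: K_def)
  have p: "(p has_real_derivative p' r) (at r within S)" for r S
    unfolding p_def p'_def by (auto intro!: derivative_eq_intros simp: algebra_simps)
  have p'c: "continuous_on S p'" and pc: "continuous_on S p" for S
    unfolding p'_def p_def by (intro continuous_intros)+
  have lt: "t \<le> t + \<epsilon>" using t by simp
  have eq: "0 = \<epsilon> * (\<integral>\<omega>. indicator A \<omega> * (X t \<omega>)\<^sup>2 \<partial>M)
      + (\<integral>(r, \<omega>). indicator A \<omega> * indicator {t..t + \<epsilon>} r * (p' r * (X r \<omega>)\<^sup>2 + p r * b r \<omega>) \<partial>?P)"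
    using weighted_second_moment[OF sp t(1) order.refl lt t(3) A p p'c] by (simp add: p_def b_def)
  \<comment> \<open>The minimum of the exponential over the interval; its inverse is the exponential
    factor of the claim.\<close>
  define e where "e = exp (- K * \<epsilon>)"
  have iG: "integrable ?P (\<lambda>(r, \<omega>). indicator A \<omega> * indicator {t..t + \<epsilon>} r * (p' r * (X r \<omega>)\<^sup>2 + p r * b r \<omega>))"
    using L2_prog_quadratic_integrable[OF u12 X AM order.refl t(3) lt p'c pc, of "\<lambda>_. 0" "\<lambda>_. 0" \<sigma>] by (simp add: b_def)
  have iX: "integrable ?P (\<lambda>(r, \<omega>). indicator A \<omega> * indicator {t..t + \<epsilon>} r * (X r \<omega>)\<^sup>2)"
    using L2_prog_weighted_integrable[OF X X AM order.refl t(3) lt continuous_on_const[of _ 1]] by (simp add: power2_eq_square)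
  have iu: "integrable ?P (\<lambda>(r, \<omega>). indicator A \<omega> * indicator {t..T} r * (u r \<omega>)\<^sup>2)"
    using L2_prog_weighted_integrable[OF u u AM order.refl order.refl _ continuous_on_const[of _ 1]] t by (simp add: power2_eq_square)
  have le: "indicator A \<omega> * indicator {t..t + \<epsilon>} r * (p' r * (X r \<omega>)\<^sup>2 + p r * b r \<omega>)
     \<le> \<epsilon> * (indicator A \<omega> * indicator {t..T} r * (u r \<omega>)\<^sup>2) - e * (indicator A \<omega> * indicator {t..t + \<epsilon>} r * (X r \<omega>)\<^sup>2)" for r \<omega>
  proof (cases "r \<in> {t..t + \<epsilon>} \<and> \<omega> \<in> A")
    case True
    have e1: "e \<le> exp (- K * (r - t))" "exp (- K * (r - t)) \<le> 1"
      using True K by (auto simp: e_def intro!: mult_left_mono)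
    have p0: "0 \<le> p r" using True by (simp add: p_def)
    have p1: "p r \<le> \<epsilon>"
      unfolding p_def using True e1(2) mult_mono[OF e1(2), of "t + \<epsilon> - r" \<epsilon>] by auto
    have b: "p r * b r \<omega> \<le> p r * ((u r \<omega>)\<^sup>2 + K * (X r \<omega>)\<^sup>2)"
    \<comment> \<open>The drift is prescribed on the half-open interval; at its right end
      \<open>p\<close> is zero.\<close>
    proof (cases "r = t + \<epsilon>")
      case False
      then have r: "r \<in> {t..<t + \<epsilon>}" using True by auto
      have "2 * u r \<omega> * X r \<omega> \<le> (u r \<omega>)\<^sup>2 + (X r \<omega>)\<^sup>2" by (rule sum_squares_bound)
      moreover have "\<theta> r * (X r \<omega>)\<^sup>2 \<le> C * (X r \<omega>)\<^sup>2"
        using \<theta>[OF r] by (intro mult_right_mono) auto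
      moreover have "b r \<omega> = 2 * u r \<omega> * X r \<omega> + 2 * (\<theta> r * (X r \<omega>)\<^sup>2) + \<sigma>\<^sup>2 * (X r \<omega>)\<^sup>2"
        unfolding b_def drift[OF r] by (simp add: power2_eq_square algebra_simps)
      ultimately have "b r \<omega> \<le> (u r \<omega>)\<^sup>2 + K * (X r \<omega>)\<^sup>2"
        by (simp add: K_def distrib_right)
      then show ?thesis using p0 by (rule mult_left_mono)
    qed (simp add: p_def)
    have "p' r * (X r \<omega>)\<^sup>2 + p r * b r \<omega> \<le> p r * (u r \<omega>)\<^sup>2 - exp (- K * (r - t)) * (X r \<omega>)\<^sup>2"
      using b by (simp add: p'_def algebra_simps)
    also have "\<dots> \<le> \<epsilon> * (u r \<omega>)\<^sup>2 - e * (X r \<omega>)\<^sup>2"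
      using p1 e1(1) by (intro diff_mono mult_right_mono) auto
    finally show ?thesis using True t by simp
  next
    case False
    then show ?thesis using t by (auto simp: indicator_def)
  qed
  have "(\<integral>(r, \<omega>). indicator A \<omega> * indicator {t..t + \<epsilon>} r * (p' r * (X r \<omega>)\<^sup>2 + p r * b r \<omega>) \<partial>?P)
    \<le> (\<integral>z. \<epsilon> * (case z of (r, \<omega>) \<Rightarrow> indicator A \<omega> * indicator {t..T} r * (u r \<omega>)\<^sup>2)
      - e * (case z of (r, \<omega>) \<Rightarrow> indicator A \<omega> * indicator {t..t + \<epsilon>} r * (X r \<omega>)\<^sup>2) \<partial>?P)"
    using le by (intro integral_mono iG Bochner_Integration.integrable_diff integrable_mult_right iu iX) auto
  also have "\<dots> = \<epsilon> * (\<integral>(r, \<omega>). indicator A \<omega> * indicator {t..T} r * (u r \<omega>)\<^sup>2 \<partial>?P)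
      - e * (\<integral>(r, \<omega>). indicator A \<omega> * indicator {t..t + \<epsilon>} r * (X r \<omega>)\<^sup>2 \<partial>?P)"
    using iu iX by simp
  finally have "e * (\<integral>(r, \<omega>). indicator A \<omega> * indicator {t..t + \<epsilon>} r * (X r \<omega>)\<^sup>2 \<partial>?P)
    \<le> \<epsilon> * ((\<integral>\<omega>. indicator A \<omega> * (X t \<omega>)\<^sup>2 \<partial>M)
      + (\<integral>(r, \<omega>). indicator A \<omega> * indicator {t..T} r * (u r \<omega>)\<^sup>2 \<partial>?P))"
    using eq by (simp add: distrib_left)
  from mult_left_mono[OF this, OF exp_ge_zero[of "K * \<epsilon>"]]
  have scaled: "(exp (K * \<epsilon>) * e) * (\<integral>(r, \<omega>). indicator A \<omega> * indicator {t..t + \<epsilon>} r * (X r \<omega>)\<^sup>2 \<partial>?P)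
    \<le> \<epsilon> * exp (K * \<epsilon>) * ((\<integral>\<omega>. indicator A \<omega> * (X t \<omega>)\<^sup>2 \<partial>M)
      + (\<integral>(r, \<omega>). indicator A \<omega> * indicator {t..T} r * (u r \<omega>)\<^sup>2 \<partial>?P))"
    by (simp only: mult_ac)
  have one: "exp (K * \<epsilon>) * e = 1" by (simp add: e_def exp_add[symmetric])
  show ?thesis using scaled unfolding one mult_1 by (simp only: K_def)
qed

text \<open>On the event where the conditional expectation \<open>d\<close> of
  \<open>sg * (Y - Z) - c * B\<close> is positive, the hypothesis makes its integral at most zero,
  so this event is null. The sign \<open>sg\<close> will be \<open>1\<close> for the maximizing and
  \<open>- 1\<close> for the minimizing player.\<close>

lemma real_cond_exp_le:
  fixes c sg :: real
  assumes Y: "integrable M Y" and Z: "integrable M Z" and B: "integrable M B"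
    and le: "\<And>A. A \<in> sets (F t) \<Longrightarrow> sg * (\<integral>\<omega>. indicator A \<omega> * Y \<omega> \<partial>M)
      \<le> sg * (\<integral>\<omega>. indicator A \<omega> * Z \<omega> \<partial>M) + c * (\<integral>\<omega>. indicator A \<omega> * B \<omega> \<partial>M)"
  shows "AE \<omega> in M. sg * (real_cond_exp M (F t) Y \<omega> - real_cond_exp M (F t) Z \<omega>) \<le> c * real_cond_exp M (F t) B \<omega>"
proof -
  interpret S: finite_measure_subalgebra M "F t" by (rule finite_measure_subalgebra_F)
  define D where "D = (\<lambda>\<omega>. sg * (Y \<omega> - Z \<omega>) - c * B \<omega>)"
  have D: "integrable M D" using Y Z B by (simp add: D_def)
  define d where "d = real_cond_exp M (F t) D"
  have d: "integrable M d" unfolding d_def by (rule S.real_cond_exp_int(1)[OF D])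
  have dF [measurable]: "d \<in> borel_measurable (F t)" unfolding d_def by simp
  define A where "A = {\<omega> \<in> space M. d \<omega> > 0}"
  have "{\<omega> \<in> space (F t). d \<omega> > 0} \<in> sets (F t)" by measurable
  then have A: "A \<in> sets (F t)" by (simp add: A_def)
  then have AM: "A \<in> sets M" using F_sub by auto
  have i: "integrable M (\<lambda>\<omega>. indicator A \<omega> * f \<omega>)" if "integrable M f" for f :: "'a \<Rightarrow> real"
    using integrable_mult_indicator[OF AM that] by simp
  have "(\<integral>\<omega>. indicator A \<omega> * d \<omega> \<partial>M) = (\<integral>\<omega>. indicator A \<omega> * D \<omega> \<partial>M)"
    using S.real_cond_exp_intA[OF D A] by (simp add: d_def set_lebesgue_integral_def)
  also have "(\<lambda>\<omega>. indicator A \<omega> * D \<omega>) = (\<lambda>\<omega>. sg * (indicator A \<omega> * Y \<omega> - indicator A \<omega> * Z \<omega>) - c * (indicator A \<omega> * B \<omega>))"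
    by (auto simp: D_def algebra_simps)
  also have "(\<integral>\<omega>. sg * (indicator A \<omega> * Y \<omega> - indicator A \<omega> * Z \<omega>) - c * (indicator A \<omega> * B \<omega>) \<partial>M) \<le> 0"
    using le[OF A] i[OF Y] i[OF Z] i[OF B] by (simp add: right_diff_distrib)
  finally have "(\<integral>\<omega>. indicator A \<omega> * d \<omega> \<partial>M) \<le> 0" .
  moreover have nn: "AE \<omega> in M. 0 \<le> indicator A \<omega> * d \<omega>"
    by (auto simp: A_def indicator_def)
  ultimately have "(\<integral>\<omega>. indicator A \<omega> * d \<omega> \<partial>M) = 0"
    using integral_nonneg_AE[OF nn] by simp
  then have "AE \<omega> in M. indicator A \<omega> * d \<omega> = 0"
    using integral_nonneg_eq_0_iff_AE[OF i[OF d] nn] by simp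
  moreover have "AE \<omega> in M. d \<omega> = real_cond_exp M (F t) (\<lambda>\<omega>. sg * (Y \<omega> - Z \<omega>)) \<omega> - real_cond_exp M (F t) (\<lambda>\<omega>. c * B \<omega>) \<omega>"
    unfolding d_def D_def using Y Z B by (intro S.real_cond_exp_diff) auto
  moreover have "AE \<omega> in M. real_cond_exp M (F t) (\<lambda>\<omega>. sg * (Y \<omega> - Z \<omega>)) \<omega> = sg * real_cond_exp M (F t) (\<lambda>\<omega>. Y \<omega> - Z \<omega>) \<omega>"
    using Y Z by (intro S.real_cond_exp_cmult) auto
  moreover have "AE \<omega> in M. real_cond_exp M (F t) (\<lambda>\<omega>. Y \<omega> - Z \<omega>) \<omega> = real_cond_exp M (F t) Y \<omega> - real_cond_exp M (F t) Z \<omega>"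
    by (rule S.real_cond_exp_diff[OF Y Z])
  moreover have "AE \<omega> in M. real_cond_exp M (F t) (\<lambda>\<omega>. c * B \<omega>) \<omega> = c * real_cond_exp M (F t) B \<omega>"
    by (rule S.real_cond_exp_cmult[OF B])
  ultimately show ?thesis
    using AE_space by eventually_elim (auto simp: A_def indicator_def split: if_splits)
qed

end

section \<open>The perturbation estimate\<close>

lemma limsup_nonpos_of_bound:
  fixes d b :: "nat \<Rightarrow> real"
  assumes "b \<longlonglongrightarrow> 0" "\<And>n. d n \<le> b n"
  shows "limsup (\<lambda>n. ereal (d n)) \<le> 0"
proof -
  have "limsup (\<lambda>n. ereal (d n)) \<le> limsup (\<lambda>n. ereal (b n))"
    using assms(2) by (intro Limsup_mono always_eventually) auto
  also have "\<dots> = 0"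
    using assms(1) by (intro lim_imp_Limsup) (auto simp: zero_ereal_def)
  finally show ?thesis .
qed

lemma limsup_nonneg_of_bound:
  fixes d b :: "nat \<Rightarrow> real"
  assumes "b \<longlonglongrightarrow> 0" "\<And>n. - d n \<le> b n"
  shows "limsup (\<lambda>n. ereal (d n)) \<ge> 0"
proof -
  have "0 = limsup (\<lambda>n. ereal (- b n))"
    using tendsto_minus[OF assms(1)] by (intro lim_imp_Limsup[symmetric]) (auto simp: zero_ereal_def)
  also have "\<dots> \<le> limsup (\<lambda>n. ereal (d n))"
    using assms(2) by (intro Limsup_mono always_eventually) (auto simp: minus_le_iff)
  finally show ?thesis .
qed

context brownian_space
begin

text \<open>One estimate for both players: \<open>sg\<close> fixes the direction, \<open>u\<close>
  is the deviation, and \<open>\<theta>\<close> the feedback of the player who does not deviate.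
  \<open>Z\<close> will be the equilibrium payoff before conditioning; its integrals over events
  equal the leading term of every perturbed payoff. The null sequence \<open>b\<close> depends on
  \<open>\<omega>\<close>, which an almost sure upper limit permits.\<close>

lemma perturbation_bound:
  fixes sg R :: real
  assumes t: "0 \<le> t" "t < T"
    and p: "\<And>r. r \<in> {t..T} \<Longrightarrow> (p has_real_derivative p' r) (at r within {t..T})"
    and p': "continuous_on {t..T} p'" and a: "continuous_on {t..T} a"
    and h: "continuous_on {t..T} h" "h t = 0"
    and \<theta>: "\<And>r. r \<in> {t..T} \<Longrightarrow> \<bar>\<theta> r\<bar> \<le> C" and u: "u \<in> L2_prog M F t T"
    and sp: "\<And>\<epsilon>. \<epsilon> \<in> {0<..<T - t} \<Longrightarrow> state_process M F W T \<sigma> t \<xi> (v1 \<epsilon>) (v2 \<epsilon>) (X \<epsilon>)"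
    and drift: "\<And>\<epsilon> r \<omega>. \<epsilon> \<in> {0<..<T - t} \<Longrightarrow> r \<in> {t..<t + \<epsilon>} \<Longrightarrow>
      v1 \<epsilon> r \<omega> + v2 \<epsilon> r \<omega> = u r \<omega> + \<theta> r * X \<epsilon> r \<omega>"
    and Qle: "\<And>\<epsilon> r \<omega>. \<epsilon> \<in> {0<..<T - t} \<Longrightarrow> r \<in> {t..T} \<Longrightarrow>
      sg * (p' r * (X \<epsilon> r \<omega>)\<^sup>2 + p r * (2 * (v1 \<epsilon> r \<omega> + v2 \<epsilon> r \<omega>) * X \<epsilon> r \<omega> + \<sigma>\<^sup>2 * (X \<epsilon> r \<omega>)\<^sup>2)
        + a r * (- (v1 \<epsilon> r \<omega>)\<^sup>2 + R * (v2 \<epsilon> r \<omega>)\<^sup>2))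
      \<le> indicator {t..<t + \<epsilon>} r * (h r * (X \<epsilon> r \<omega>)\<^sup>2)"
    and Z: "integrable M Z" "\<And>A. A \<in> sets (F t) \<Longrightarrow> (\<integral>\<omega>. indicator A \<omega> * Z \<omega> \<partial>M) = p t * (\<integral>\<omega>. indicator A \<omega> * (\<xi> \<omega>)\<^sup>2 \<partial>M)"
    and e: "\<And>n. e n \<in> {0<..<T - t}" "e \<longlonglongrightarrow> 0"
  defines "Y \<equiv> \<lambda>\<epsilon> \<omega>. p T * (X \<epsilon> T \<omega>)\<^sup>2 + (LBINT r:{t..T}. a r * (- (v1 \<epsilon> r \<omega>)\<^sup>2 + R * (v2 \<epsilon> r \<omega>)\<^sup>2))"
  shows "AE \<omega> in M. \<exists>b. b \<longlonglongrightarrow> 0 \<and>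
    (\<forall>n. sg * ((real_cond_exp M (F t) (Y (e n)) \<omega> - real_cond_exp M (F t) Z \<omega>) / e n) \<le> b n)"
proof -
  let ?P = "(lborel :: real measure) \<Otimes>\<^sub>M M"
  have tT: "t \<le> T" using t by simp
  have p_ball: "\<forall>r\<in>{t..T}. (p has_real_derivative p' r) (at r within {t..T})"
    using p by blast
  define K where "K = 1 + 2 * C + \<sigma>\<^sup>2"
  define U where "U = (\<lambda>\<omega>. \<integral>r. indicator (space M) \<omega> * indicator {t..T} r * (u r \<omega>)\<^sup>2 \<partial>lborel)"
  \<comment> \<open>The part of the energy bound that is common to all \<epsilon>; its conditional
    expectation is the random constant in \<open>b\<close>.\<close>
  define B where "B = (\<lambda>\<omega>. (\<xi> \<omega>)\<^sup>2 + U \<omega>)"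
  have iu: "integrable ?P (\<lambda>(r, \<omega>). indicator A \<omega> * indicator {t..T} r * (u r \<omega>)\<^sup>2)" if "A \<in> sets M" for A
    using L2_prog_weighted_integrable[OF u u that order.refl order.refl tT continuous_on_const[of _ 1]]
    by (simp add: power2_eq_square)
  have U: "integrable M U"
    unfolding U_def by (rule prod.integrable_snd[OF iu]) auto
  have \<xi>: "integrable M (\<lambda>\<omega>. (\<xi> \<omega>)\<^sup>2)"
    using sp[OF e(1)] by (auto simp: state_process_def)
  have B: "integrable M B" using U \<xi> by (simp add: B_def)
  have EB: "(\<integral>\<omega>. indicator A \<omega> * B \<omega> \<partial>M) = (\<integral>\<omega>. indicator A \<omega> * (\<xi> \<omega>)\<^sup>2 \<partial>M)
      + (\<integral>(r, \<omega>). indicator A \<omega> * indicator {t..T} r * (u r \<omega>)\<^sup>2 \<partial>?P)" if "A \<in> sets M" for A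
  proof -
    have "(\<integral>\<omega>. indicator A \<omega> * B \<omega> \<partial>M) = (\<integral>\<omega>. indicator A \<omega> * (\<xi> \<omega>)\<^sup>2 \<partial>M) + (\<integral>\<omega>. indicator A \<omega> * U \<omega> \<partial>M)"
      using integrable_mult_indicator[OF that U] integrable_mult_indicator[OF that \<xi>]
      by (simp add: B_def distrib_left)
    also have "(\<integral>\<omega>. indicator A \<omega> * U \<omega> \<partial>M) = (\<integral>\<omega>. (\<integral>r. indicator A \<omega> * indicator {t..T} r * (u r \<omega>)\<^sup>2 \<partial>lborel) \<partial>M)"
      by (intro Bochner_Integration.integral_cong refl) (simp add: U_def mult.assoc)
    also have "\<dots> = (\<integral>(r, \<omega>). indicator A \<omega> * indicator {t..T} r * (u r \<omega>)\<^sup>2 \<partial>?P)"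
      by (rule prod.integral_snd[OF iu[OF that]])
    finally show ?thesis .
  qed
  \<comment> \<open>A maximizer of \<open>h\<close> on the perturbation interval. It is squeezed to
    \<open>t\<close>, so the maxima \<open>\<delta> n\<close> tend to \<open>h t = 0\<close>; they
    are nonnegative because \<open>t\<close> competes.\<close>
  have "\<exists>s. s \<in> {t..t + e n} \<and> (\<forall>r\<in>{t..t + e n}. h r \<le> h s)" for n
    using continuous_attains_sup[of "{t..t + e n}" h] continuous_on_subset[OF h(1), of "{t..t + e n}"] e(1)[of n]
    by force
  then obtain s where s: "\<And>n. s n \<in> {t..t + e n}" and smax: "\<And>n r. r \<in> {t..t + e n} \<Longrightarrow> h r \<le> h (s n)"
    by metis
  define \<delta> where "\<delta> = (\<lambda>n. h (s n))"
  have \<delta>0: "0 \<le> \<delta> n" for n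
    using smax[of t n] e(1)[of n] h(2) by (simp add: \<delta>_def)
  have s_lim: "s \<longlonglongrightarrow> t"
  proof (rule tendsto_sandwich[OF _ _ tendsto_const])
    show "(\<lambda>n. t + e n) \<longlonglongrightarrow> t" using tendsto_add[OF tendsto_const[of t] e(2)] by simp
  qed (use s in auto)
  have \<delta>_lim: "\<delta> \<longlonglongrightarrow> 0"
  proof -
    have "s n \<in> {t..T}" for n using s[of n] e(1)[of n] by auto
    then have "(\<lambda>n. h (s n)) \<longlonglongrightarrow> h t"
      using continuous_on_tendsto_compose[OF h(1) s_lim] tT by auto
    then show ?thesis by (simp add: \<delta>_def h(2))
  qed
  have "AE \<omega> in M. sg * (real_cond_exp M (F t) (Y (e n)) \<omega> - real_cond_exp M (F t) Z \<omega>)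
      \<le> (\<delta> n * (e n * exp (K * e n))) * real_cond_exp M (F t) B \<omega>" for n
  proof (rule real_cond_exp_le[OF _ Z(1) B])
    let ?\<epsilon> = "e n"
    have \<epsilon>: "0 < ?\<epsilon>" "t + ?\<epsilon> \<le> T" using e(1)[of n] by auto
    note spn = sp[OF e(1)[of n]]
    have Xn: "X ?\<epsilon> \<in> L2_prog M F t T" using spn by (simp add: state_process_def)
    note pay = payoff_expectation[OF spn t(1) order.refl tT p_ball p' a, where R = R]
    show "integrable M (Y ?\<epsilon>)" using pay(1) by (simp add: Y_def)
    fix A assume A: "A \<in> sets (F t)"
    then have AM: "A \<in> sets M" using F_sub by auto
    let ?Q = "\<lambda>r \<omega>. p' r * (X ?\<epsilon> r \<omega>)\<^sup>2 + p r * (2 * (v1 ?\<epsilon> r \<omega> + v2 ?\<epsilon> r \<omega>) * X ?\<epsilon> r \<omega> + \<sigma>\<^sup>2 * (X ?\<epsilon> r \<omega>)\<^sup>2)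
        + a r * (- (v1 ?\<epsilon> r \<omega>)\<^sup>2 + R * (v2 ?\<epsilon> r \<omega>)\<^sup>2)"
    have AX: "AE \<omega> in M. X ?\<epsilon> t \<omega> = \<xi> \<omega>"
      by (rule state_process_decomposition[OF spn t(1)]) (use tT in auto)
    have Xtm: "X ?\<epsilon> t \<in> borel_measurable M"
      by (rule measurable_F[OF L2_prog_section[OF Xn]]) (use tT in auto)
    have \<xi>m: "\<xi> \<in> borel_measurable M"
      using spn by (auto simp: state_process_def intro: measurable_F)
    have X\<xi>: "(\<integral>\<omega>. indicator A \<omega> * (X ?\<epsilon> t \<omega>)\<^sup>2 \<partial>M) = (\<integral>\<omega>. indicator A \<omega> * (\<xi> \<omega>)\<^sup>2 \<partial>M)"
      using AX Xtm \<xi>m AM by (intro integral_cong_AE) auto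
    have iX: "integrable ?P (\<lambda>(r, \<omega>). indicator A \<omega> * indicator {t..t + ?\<epsilon>} r * (X ?\<epsilon> r \<omega>)\<^sup>2)"
      using L2_prog_weighted_integrable[OF Xn Xn AM order.refl \<epsilon>(2) _ continuous_on_const[of _ 1]] \<epsilon>
      by (simp add: power2_eq_square)
    have "sg * (\<integral>(r, \<omega>). indicator A \<omega> * indicator {t..T} r * ?Q r \<omega> \<partial>?P)
      = (\<integral>(r, \<omega>). sg * (indicator A \<omega> * indicator {t..T} r * ?Q r \<omega>) \<partial>?P)"
      by (simp add: split_beta')
    also have "\<dots> \<le> (\<integral>(r, \<omega>). \<delta> n * (indicator A \<omega> * indicator {t..t + ?\<epsilon>} r * (X ?\<epsilon> r \<omega>)\<^sup>2) \<partial>?P)"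
    proof (rule integral_mono)
      show "integrable ?P (\<lambda>(r, \<omega>). sg * (indicator A \<omega> * indicator {t..T} r * ?Q r \<omega>))"
        using integrable_mult_right[OF pay(2)[OF A], of sg] by (simp add: split_beta')
      show "integrable ?P (\<lambda>(r, \<omega>). \<delta> n * (indicator A \<omega> * indicator {t..t + ?\<epsilon>} r * (X ?\<epsilon> r \<omega>)\<^sup>2))"
        using integrable_mult_right[OF iX, of "\<delta> n"] by (simp add: split_beta')
      have "sg * (indicator A \<omega> * indicator {t..T} r * ?Q r \<omega>) \<le> \<delta> n * (indicator A \<omega> * indicator {t..t + ?\<epsilon>} r * (X ?\<epsilon> r \<omega>)\<^sup>2)" for r \<omega>
      proof (cases "r \<in> {t..T} \<and> \<omega> \<in> A")
        case True
        then have "sg * ?Q r \<omega> \<le> indicator {t..<t + ?\<epsilon>} r * (h r * (X ?\<epsilon> r \<omega>)\<^sup>2)" using Qle[OF e(1)] by auto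
        \<comment> \<open>Nonnegativity of \<open>\<delta> n\<close> covers the added end point,
          where the left side is zero.\<close>
        also have "\<dots> \<le> indicator {t..t + ?\<epsilon>} r * (\<delta> n * (X ?\<epsilon> r \<omega>)\<^sup>2)"
          using smax[of r n] \<delta>0[of n] by (auto simp: \<delta>_def indicator_def intro!: mult_right_mono)
        finally show ?thesis using True by (simp add: mult_ac)
      next
        case False
        then show ?thesis using \<delta>0[of n] by (auto simp: indicator_def)
      qed
      then show "(case z of (r, \<omega>) \<Rightarrow> sg * (indicator A \<omega> * indicator {t..T} r * ?Q r \<omega>))
          \<le> (case z of (r, \<omega>) \<Rightarrow> \<delta> n * (indicator A \<omega> * indicator {t..t + ?\<epsilon>} r * (X ?\<epsilon> r \<omega>)\<^sup>2))" for z
        by (simp add: split_beta')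
    qed
    also have "\<dots> = \<delta> n * (\<integral>(r, \<omega>). indicator A \<omega> * indicator {t..t + ?\<epsilon>} r * (X ?\<epsilon> r \<omega>)\<^sup>2 \<partial>?P)"
      by (simp add: split_beta')
    also have "\<dots> \<le> \<delta> n * (?\<epsilon> * exp (K * ?\<epsilon>) * (\<integral>\<omega>. indicator A \<omega> * B \<omega> \<partial>M))"
      using short_time_energy[OF spn t(1) \<epsilon> A u, of \<theta> C] \<theta> \<epsilon> drift[OF e(1)] \<delta>0[of n]
      by (intro mult_left_mono) (auto simp: EB[OF AM] X\<xi> K_def)
    finally have "sg * (\<integral>(r, \<omega>). indicator A \<omega> * indicator {t..T} r * ?Q r \<omega> \<partial>?P)
      \<le> (\<delta> n * (?\<epsilon> * exp (K * ?\<epsilon>))) * (\<integral>\<omega>. indicator A \<omega> * B \<omega> \<partial>M)" by (simp add: mult.assoc)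
    moreover have "(\<integral>\<omega>. indicator A \<omega> * Y ?\<epsilon> \<omega> \<partial>M) = p t * (\<integral>\<omega>. indicator A \<omega> * (\<xi> \<omega>)\<^sup>2 \<partial>M)
      + (\<integral>(r, \<omega>). indicator A \<omega> * indicator {t..T} r * ?Q r \<omega> \<partial>?P)"
      using pay(3)[OF A] by (simp add: Y_def X\<xi>)
    ultimately show "sg * (\<integral>\<omega>. indicator A \<omega> * Y ?\<epsilon> \<omega> \<partial>M)
      \<le> sg * (\<integral>\<omega>. indicator A \<omega> * Z \<omega> \<partial>M) + (\<delta> n * (?\<epsilon> * exp (K * ?\<epsilon>))) * (\<integral>\<omega>. indicator A \<omega> * B \<omega> \<partial>M)"
      by (simp add: Z(2)[OF A] distrib_left)
  qed
  \<comment> \<open>Countably many perturbations leave a single exceptional null set.\<close>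
  then have "AE \<omega> in M. \<forall>n. sg * (real_cond_exp M (F t) (Y (e n)) \<omega> - real_cond_exp M (F t) Z \<omega>)
      \<le> (\<delta> n * (e n * exp (K * e n))) * real_cond_exp M (F t) B \<omega>"
    by (simp add: AE_all_countable)
  then show ?thesis
  proof eventually_elim
    case (elim \<omega>)
    \<comment> \<open>Division by \<open>e n\<close> uses up the interval length in the energy
      bound; the decay that remains comes from \<open>\<delta> n\<close>.\<close>
    let ?b = "\<lambda>n. \<delta> n * exp (K * e n) * real_cond_exp M (F t) B \<omega>"
    have "?b \<longlonglongrightarrow> 0 * exp (K * 0) * real_cond_exp M (F t) B \<omega>"
      by (intro tendsto_intros \<delta>_lim e(2))
    moreover have "sg * ((real_cond_exp M (F t) (Y (e n)) \<omega> - real_cond_exp M (F t) Z \<omega>) / e n) \<le> ?b n" for n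
      using elim[rule_format, of n] e(1)[of n] by (simp add: field_simps)
    ultimately show ?case by (intro exI[of _ ?b]) auto
  qed
qed

end

section \<open>Quadratic algebra of the two players\<close>

text \<open>The left side is concave in \<open>v\<close> with maximizer \<open>p x / a\<close>, and
  the slack is \<open>(a v - p x)^2 / a\<close>. The bound measures how far the feedback
  \<open>\<theta>1\<close> is from the optimal \<open>p / a\<close>. With \<open>- p\<close> and
  \<open>a R\<close> in place of \<open>p\<close> and \<open>a\<close> it serves the minimizing
  player as well.\<close>

lemma complete_square_maximizer:
  fixes a p v x \<theta>1 :: real
  assumes "a > 0"
  shows "2 * p * x * (v - \<theta>1 * x) - a * (v\<^sup>2 - \<theta>1\<^sup>2 * x\<^sup>2) \<le> (p - a * \<theta>1)\<^sup>2 / a * x\<^sup>2"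
proof -
  have "(p - a * \<theta>1)\<^sup>2 / a * x\<^sup>2 - (2 * p * x * (v - \<theta>1 * x) - a * (v\<^sup>2 - \<theta>1\<^sup>2 * x\<^sup>2)) = (a * v - p * x)\<^sup>2 / a"
    using assms by (simp add: field_simps power2_eq_square)
  moreover have "(a * v - p * x)\<^sup>2 / a \<ge> 0" using assms by simp
  ultimately show ?thesis by linarith
qed

text \<open>The first factor is the value that the Riccati equation dictates for \<open>p'\<close>.
  The diffusion terms cancel, and the rest splits into one bracket per player, each zero when that
  player follows the feedback.\<close>

lemma Riccati_integrand:
  fixes a p v1 v2 x \<theta>1 \<theta>2 \<sigma> R :: real
  shows "- (2 * p * (\<theta>1 + \<theta>2) + \<sigma>\<^sup>2 * p + a * (- \<theta>1\<^sup>2 + R * \<theta>2\<^sup>2)) * x\<^sup>2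
      + p * (2 * (v1 + v2) * x + \<sigma>\<^sup>2 * x\<^sup>2) + a * (- v1\<^sup>2 + R * v2\<^sup>2)
    = (2 * p * x * (v1 - \<theta>1 * x) - a * (v1\<^sup>2 - \<theta>1\<^sup>2 * x\<^sup>2))
      + (2 * p * x * (v2 - \<theta>2 * x) + a * R * (v2\<^sup>2 - \<theta>2\<^sup>2 * x\<^sup>2))"
  by (simp add: power2_eq_square algebra_simps)

lemma L2_interval_continuous:
  assumes "continuous_on {0..T} \<Theta>"
  shows "L2_interval T \<Theta>"
  using borel_measurable_continuous_on_indicator[OF _ assms]
    borel_integrable_atLeastAtMost'[OF continuous_on_power[OF assms, of 2]]
  by (simp add: L2_interval_def set_borel_measurable_def)

context brownian_space
begin

text \<open>Continuity of the discount and of \<open>P\<close> makes the defect \<open>h\<close>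
  continuous, positivity of the discount permits completing the square, and
  \<open>\<alpha> 0 = 1\<close> makes \<open>h\<close> vanish at \<open>t\<close>.\<close>

theorem Riccati_equilibrium_saddle_strategy:
  fixes \<alpha> :: "real \<Rightarrow> real"
  assumes R: "0 < R" and \<alpha>: "continuous_on UNIV \<alpha>" "\<And>r. \<alpha> r > 0" "\<alpha> 0 = 1"
    and ric: "riccati_solution T \<sigma> R \<alpha> \<Theta>1 \<Theta>2 P"
    and \<Theta>: "\<And>s. s \<in> {0..T} \<Longrightarrow> \<Theta>1 s = P s s" "\<And>s. s \<in> {0..T} \<Longrightarrow> \<Theta>2 s = - (P s s / R)"
  shows "equilibrium_saddle_strategy M F W T \<sigma> R \<alpha> \<Theta>1 \<Theta>2"
proof -
  have Pc: "continuous_on (Delta T) (\<lambda>(t, s). P t s)"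
    and PT: "\<And>t. t \<in> {0..T} \<Longrightarrow> P t T = \<alpha> (T - t)"
    using ric by (auto simp: riccati_solution_def)
  have Pd: "((\<lambda>s. P t s) has_real_derivative
      - (2 * P t s * (\<Theta>1 s + \<Theta>2 s) + \<sigma>\<^sup>2 * P t s + \<alpha> (s - t) * (- (\<Theta>1 s)\<^sup>2 + R * (\<Theta>2 s)\<^sup>2))) (at s within {t..T})"
    if "0 \<le> t" "s \<in> {t..T}" for t s
  proof -
    have "(t, s) \<in> Delta T" using that by (simp add: Delta_def)
    then obtain Ps where "((\<lambda>s. P t s) has_real_derivative Ps) (at s within {t..T})"
      "Ps + 2 * P t s * (\<Theta>1 s + \<Theta>2 s) + \<sigma>\<^sup>2 * P t s
          + \<alpha> (s - t) * (- (\<Theta>1 s)\<^sup>2 + R * (\<Theta>2 s)\<^sup>2) = 0"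
      using ric unfolding riccati_solution_def by blast
    moreover from this(2) have "Ps = - (2 * P t s * (\<Theta>1 s + \<Theta>2 s) + \<sigma>\<^sup>2 * P t s + \<alpha> (s - t) * (- (\<Theta>1 s)\<^sup>2 + R * (\<Theta>2 s)\<^sup>2))"
      by linarith
    ultimately show ?thesis by simp
  qed
  \<comment> \<open>The strategies inherit continuity from \<open>P\<close> on the diagonal, and
    with it the bounds that the energy estimate requires of a feedback.\<close>
  have "continuous_on {0..T} (\<lambda>s. case (s, s) of (t, s) \<Rightarrow> P t s)"
    by (rule continuous_on_compose2[OF Pc]) (auto simp: Delta_def intro!: continuous_intros)
  then have diag: "continuous_on {0..T} (\<lambda>s. P s s)" by simp
  have \<Theta>1c: "continuous_on {0..T} \<Theta>1"
    using diag by (rule continuous_on_eq) (simp add: \<Theta>)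
  have \<Theta>2c: "continuous_on {0..T} \<Theta>2"
    using R by (intro continuous_on_eq[OF continuous_on_minus[OF continuous_on_divide[OF diag continuous_on_const[of _ R]]]])
      (auto simp: \<Theta>)
  \<comment> \<open>This couples the players: it makes the defect of player 2 equal to that of
    player 1 up to sign.\<close>
  have \<Theta>21: "R * \<Theta>2 s = - \<Theta>1 s" if "s \<in> {0..T}" for s
    using \<Theta>[OF that] R by simp
  have saddle: "(\<forall>X. (\<forall>\<epsilon>\<in>{0<..<T - t}.
                 state_process M F W T \<sigma> t (Xbar t)
                   (perturbed_feedback t \<epsilon> u1 \<Theta>1 (X \<epsilon>)) (feedback \<Theta>2 (X \<epsilon>)) (X \<epsilon>)) \<longrightarrow>
              (\<forall>e. (\<forall>n. e n \<in> {0<..<T - t}) \<and> e \<longlonglongrightarrow> 0 \<longrightarrow>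
                (AE \<omega> in M. limsup (\<lambda>n. ereal (
                   (payoff M F T R \<alpha> t (X (e n))
                      (perturbed_feedback t (e n) u1 \<Theta>1 (X (e n))) (feedback \<Theta>2 (X (e n))) \<omega>
                    - payoff M F T R \<alpha> t Xbar (feedback \<Theta>1 Xbar) (feedback \<Theta>2 Xbar) \<omega>) / e n)) \<le> 0))) \<and>
         (\<forall>X. (\<forall>\<epsilon>\<in>{0<..<T - t}.
                 state_process M F W T \<sigma> t (Xbar t)
                   (feedback \<Theta>1 (X \<epsilon>)) (perturbed_feedback t \<epsilon> u2 \<Theta>2 (X \<epsilon>)) (X \<epsilon>)) \<longrightarrow>
              (\<forall>e. (\<forall>n. e n \<in> {0<..<T - t}) \<and> e \<longlonglongrightarrow> 0 \<longrightarrow>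
                (AE \<omega> in M. limsup (\<lambda>n. ereal (
                   (payoff M F T R \<alpha> t (X (e n))
                      (feedback \<Theta>1 (X (e n))) (perturbed_feedback t (e n) u2 \<Theta>2 (X (e n))) \<omega>
                    - payoff M F T R \<alpha> t Xbar (feedback \<Theta>1 Xbar) (feedback \<Theta>2 Xbar) \<omega>) / e n)) \<ge> 0)))"
    (is "(\<forall>X. ?sp1 X \<longrightarrow> (\<forall>e. ?seq e \<longrightarrow> ?lim1 X e)) \<and> (\<forall>X. ?sp2 X \<longrightarrow> (\<forall>e. ?seq e \<longrightarrow> ?lim2 X e))")
    if bar: "state_process M F W T \<sigma> 0 (\<lambda>_. x0) (feedback \<Theta>1 Xbar) (feedback \<Theta>2 Xbar) Xbar"
      and t: "t \<in> {0..<T}" and u1: "u1 \<in> L2_prog M F t T" and u2: "u2 \<in> L2_prog M F t T"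
    for x0 Xbar t u1 u2
  proof -
    have tT: "0 \<le> t" "t < T" "t \<le> T" using t by auto
    define p where "p = P t"
    define a where "a = (\<lambda>r. \<alpha> (r - t))"
    define p' where "p' = (\<lambda>r. - (2 * p r * (\<Theta>1 r + \<Theta>2 r) + \<sigma>\<^sup>2 * p r + a r * (- (\<Theta>1 r)\<^sup>2 + R * (\<Theta>2 r)\<^sup>2)))"
    have sub: "{t..T} \<subseteq> {0..T}" using tT by auto
    note cont1 = continuous_on_subset[OF \<Theta>1c sub] and cont2 = continuous_on_subset[OF \<Theta>2c sub]
    have p: "(p has_real_derivative p' r) (at r within {t..T})" if "r \<in> {t..T}" for r
      using Pd[OF tT(1) that] by (simp add: p_def p'_def a_def)
    then have p_ball: "\<forall>r\<in>{t..T}. (p has_real_derivative p' r) (at r within {t..T})" by blast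
    have pc: "continuous_on {t..T} p"
      using p DERIV_continuous by (force simp: continuous_on_eq_continuous_within)
    have ac: "continuous_on {t..T} a"
      unfolding a_def by (rule continuous_on_compose2[OF \<alpha>(1)]) (auto intro!: continuous_intros)
    have a_pos: "a r > 0" for r by (simp add: a_def \<alpha>)
    have p'c: "continuous_on {t..T} p'"
      unfolding p'_def by (intro continuous_intros pc ac cont1 cont2)
    have pT: "p T = \<alpha> (T - t)" using PT[of t] tT by (simp add: p_def)
    define Z where "Z = (\<lambda>\<omega>. p T * (Xbar T \<omega>)\<^sup>2
      + (LBINT r:{t..T}. a r * (- (feedback \<Theta>1 Xbar r \<omega>)\<^sup>2 + R * (feedback \<Theta>2 Xbar r \<omega>)\<^sup>2)))"
    have Zpay: "payoff M F T R \<alpha> t Xbar (feedback \<Theta>1 Xbar) (feedback \<Theta>2 Xbar) = real_cond_exp M (F t) Z"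
      by (simp add: payoff_def Z_def pT a_def)
    note pay = payoff_expectation[OF bar order.refl tT(1,3) p_ball p'c ac, where R = R]
    have Z: "integrable M Z" using pay(1) by (simp add: Z_def)
    \<comment> \<open>Along the feedback both brackets of \<open>Riccati_integrand\<close> vanish,
      so that the initial term alone survives.\<close>
    have EZ: "(\<integral>\<omega>. indicator A \<omega> * Z \<omega> \<partial>M) = p t * (\<integral>\<omega>. indicator A \<omega> * (Xbar t \<omega>)\<^sup>2 \<partial>M)" if "A \<in> sets (F t)" for A
      using pay(3)[OF that, unfolded p'_def Riccati_integrand]
      by (simp add: Z_def feedback_def power_mult_distrib split_beta')
    \<comment> \<open>The largest rate of gain per unit of \<open>X^2\<close> open to player 1. The
      numerator compares \<open>P t r\<close> with \<open>\<alpha> (r - t) * P r r\<close>, and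
      these agree at \<open>r = t\<close>.\<close>
    define h where "h = (\<lambda>r. (p r - a r * \<Theta>1 r)\<^sup>2 / a r)"
    have hc: "continuous_on {t..T} h"
      unfolding h_def using a_pos less_imp_neq[OF a_pos] by (intro continuous_intros pc ac cont1) (metis less_irrefl)
    have ht: "h t = 0" using \<Theta>(1)[of t] tT by (simp add: h_def p_def a_def \<alpha>)
    obtain C1 where C1: "\<And>r. r \<in> {t..T} \<Longrightarrow> \<bar>\<Theta>1 r\<bar> \<le> C1"
      using compact_imp_bounded[OF compact_continuous_image[OF cont1 compact_Icc]]
      unfolding bounded_iff by (metis imageI real_norm_def)
    obtain C2 where C2: "\<And>r. r \<in> {t..T} \<Longrightarrow> \<bar>\<Theta>2 r\<bar> \<le> C2"
      using compact_imp_bounded[OF compact_continuous_image[OF cont2 compact_Icc]]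
      unfolding bounded_iff by (metis imageI real_norm_def)
    show ?thesis
    proof (intro conjI allI impI)
      fix X e assume sp: "?sp1 X" and e: "?seq e"
      have "AE \<omega> in M. \<exists>b. b \<longlonglongrightarrow> 0 \<and> (\<forall>n. 1 * ((real_cond_exp M (F t) (\<lambda>\<omega>. p T * (X (e n) T \<omega>)\<^sup>2
          + (LBINT r:{t..T}. a r * (- (perturbed_feedback t (e n) u1 \<Theta>1 (X (e n)) r \<omega>)\<^sup>2 + R * (feedback \<Theta>2 (X (e n)) r \<omega>)\<^sup>2))) \<omega>
          - real_cond_exp M (F t) Z \<omega>) / e n) \<le> b n)"
      \<comment> \<open>Player 1 deviates, so the feedback that stays in the drift, bounded by
        \<open>C2\<close>, is that of player 2.\<close>
      proof (rule perturbation_bound[OF tT(1,2) p p'c ac hc ht C2 u1 _ _ _ Z EZ])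
        fix \<epsilon> r \<omega> assume \<epsilon>: "\<epsilon> \<in> {0<..<T - t}"
        show "state_process M F W T \<sigma> t (Xbar t) (perturbed_feedback t \<epsilon> u1 \<Theta>1 (X \<epsilon>)) (feedback \<Theta>2 (X \<epsilon>)) (X \<epsilon>)"
          using sp \<epsilon> by blast
        show "perturbed_feedback t \<epsilon> u1 \<Theta>1 (X \<epsilon>) r \<omega> + feedback \<Theta>2 (X \<epsilon>) r \<omega> = u1 r \<omega> + \<Theta>2 r * X \<epsilon> r \<omega>"
          if "r \<in> {t..<t + \<epsilon>}"
          using that by (simp add: perturbed_feedback_def feedback_def)
        show "1 * (p' r * (X \<epsilon> r \<omega>)\<^sup>2
            + p r * (2 * (perturbed_feedback t \<epsilon> u1 \<Theta>1 (X \<epsilon>) r \<omega> + feedback \<Theta>2 (X \<epsilon>) r \<omega>) * X \<epsilon> r \<omega> + \<sigma>\<^sup>2 * (X \<epsilon> r \<omega>)\<^sup>2)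
            + a r * (- (perturbed_feedback t \<epsilon> u1 \<Theta>1 (X \<epsilon>) r \<omega>)\<^sup>2 + R * (feedback \<Theta>2 (X \<epsilon>) r \<omega>)\<^sup>2))
          \<le> indicator {t..<t + \<epsilon>} r * (h r * (X \<epsilon> r \<omega>)\<^sup>2)" if "r \<in> {t..T}"
          unfolding p'_def Riccati_integrand
          using complete_square_maximizer[OF a_pos[of r], of "p r" "X \<epsilon> r \<omega>" "u1 r \<omega>" "\<Theta>1 r"] that
          by (simp add: perturbed_feedback_def feedback_def h_def power_mult_distrib)
      qed (use e in auto)
      then show "?lim1 X e"
      proof eventually_elim
        case (elim \<omega>)
        then obtain b where b: "b \<longlonglongrightarrow> 0" and le: "\<And>n. (payoff M F T R \<alpha> t (X (e n))
                      (perturbed_feedback t (e n) u1 \<Theta>1 (X (e n))) (feedback \<Theta>2 (X (e n))) \<omega>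
                    - payoff M F T R \<alpha> t Xbar (feedback \<Theta>1 Xbar) (feedback \<Theta>2 Xbar) \<omega>) / e n \<le> b n"
          unfolding Zpay by (auto simp: payoff_def pT a_def)
        show ?case by (rule limsup_nonpos_of_bound[OF b le])
      qed
    next
      fix X e assume sp: "?sp2 X" and e: "?seq e"
      \<comment> \<open>The control of player 2 enters with coefficient \<open>a R\<close>, so the
        same defect appears divided by \<open>R\<close>.\<close>
      have hc': "continuous_on {t..T} (\<lambda>r. h r / R)" and ht': "h t / R = 0"
        using hc ht R by (auto intro!: continuous_intros)
      have "AE \<omega> in M. \<exists>b. b \<longlonglongrightarrow> 0 \<and> (\<forall>n. (- 1) * ((real_cond_exp M (F t) (\<lambda>\<omega>. p T * (X (e n) T \<omega>)\<^sup>2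
          + (LBINT r:{t..T}. a r * (- (feedback \<Theta>1 (X (e n)) r \<omega>)\<^sup>2 + R * (perturbed_feedback t (e n) u2 \<Theta>2 (X (e n)) r \<omega>)\<^sup>2))) \<omega>
          - real_cond_exp M (F t) Z \<omega>) / e n) \<le> b n)"
      proof (rule perturbation_bound[OF tT(1,2) p p'c ac hc' ht' C1 u2 _ _ _ Z EZ])
        fix \<epsilon> r \<omega> assume \<epsilon>: "\<epsilon> \<in> {0<..<T - t}"
        show "state_process M F W T \<sigma> t (Xbar t) (feedback \<Theta>1 (X \<epsilon>)) (perturbed_feedback t \<epsilon> u2 \<Theta>2 (X \<epsilon>)) (X \<epsilon>)"
          using sp \<epsilon> by blast
        show "feedback \<Theta>1 (X \<epsilon>) r \<omega> + perturbed_feedback t \<epsilon> u2 \<Theta>2 (X \<epsilon>) r \<omega> = u2 r \<omega> + \<Theta>1 r * X \<epsilon> r \<omega>"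
          if "r \<in> {t..<t + \<epsilon>}"
          using that by (simp add: perturbed_feedback_def feedback_def)
        show "(- 1) * (p' r * (X \<epsilon> r \<omega>)\<^sup>2
            + p r * (2 * (feedback \<Theta>1 (X \<epsilon>) r \<omega> + perturbed_feedback t \<epsilon> u2 \<Theta>2 (X \<epsilon>) r \<omega>) * X \<epsilon> r \<omega> + \<sigma>\<^sup>2 * (X \<epsilon> r \<omega>)\<^sup>2)
            + a r * (- (feedback \<Theta>1 (X \<epsilon>) r \<omega>)\<^sup>2 + R * (perturbed_feedback t \<epsilon> u2 \<Theta>2 (X \<epsilon>) r \<omega>)\<^sup>2))
          \<le> indicator {t..<t + \<epsilon>} r * (h r / R * (X \<epsilon> r \<omega>)\<^sup>2)" if r: "r \<in> {t..T}"
        proof -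
          have "r \<in> {0..T}" using r tT by auto
          then have "- p r - a r * R * \<Theta>2 r = - (p r - a r * \<Theta>1 r)"
            using \<Theta>21[of r] by (simp add: mult.assoc)
          then have "(- p r - a r * R * \<Theta>2 r)\<^sup>2 = (p r - a r * \<Theta>1 r)\<^sup>2"
            by (simp only: power2_minus)
          then have "(- p r - a r * R * \<Theta>2 r)\<^sup>2 / (a r * R) = h r / R"
            by (simp only: h_def divide_divide_eq_left)
          \<comment> \<open>Minimizing means maximizing the negated bracket, whence
            \<open>- p\<close> and the concave coefficient \<open>a R\<close>.\<close>
          with complete_square_maximizer[of "a r * R" "- p r" "X \<epsilon> r \<omega>" "u2 r \<omega>" "\<Theta>2 r"] a_pos[of r] R
          have "- (2 * p r * X \<epsilon> r \<omega> * (u2 r \<omega> - \<Theta>2 r * X \<epsilon> r \<omega>)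
              + a r * R * ((u2 r \<omega>)\<^sup>2 - (\<Theta>2 r)\<^sup>2 * (X \<epsilon> r \<omega>)\<^sup>2)) \<le> h r / R * (X \<epsilon> r \<omega>)\<^sup>2"
            by simp
          then show ?thesis
            unfolding p'_def Riccati_integrand using r
            by (simp add: perturbed_feedback_def feedback_def power_mult_distrib)
        qed
      qed (use e in auto)
      then show "?lim2 X e"
      proof eventually_elim
        case (elim \<omega>)
        then obtain b where b: "b \<longlonglongrightarrow> 0" and le: "\<And>n. (- 1) * ((payoff M F T R \<alpha> t (X (e n))
                      (feedback \<Theta>1 (X (e n))) (perturbed_feedback t (e n) u2 \<Theta>2 (X (e n))) \<omega>
                    - payoff M F T R \<alpha> t Xbar (feedback \<Theta>1 Xbar) (feedback \<Theta>2 Xbar) \<omega>) / e n) \<le> b n"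
          unfolding Zpay by (auto simp: payoff_def pT a_def)
        show ?case by (rule limsup_nonneg_of_bound[OF b le[unfolded mult_minus1]])
      qed
    qed
  qed
  show ?thesis
    unfolding equilibrium_saddle_strategy_def
    using L2_interval_continuous[OF \<Theta>1c] L2_interval_continuous[OF \<Theta>2c] saddle by blast
qed

end

section \<open>The two-exponential discount\<close>

theorem theorem3:
  fixes M :: "'a measure" and W :: "real \<Rightarrow> 'a \<Rightarrow> real"
    and T \<sigma> R lam \<rho> \<gamma> :: real
    and P :: "real \<Rightarrow> real \<Rightarrow> real" and \<Theta>1 \<Theta>2 :: "real \<Rightarrow> real"
  assumes "prob_space M" and "complete_measure M" and "brownian_motion M W"
    and "T > 0" and "0 < R" and "R \<le> 1"
    and "\<gamma> > \<rho>" and "\<rho> > 0" and "0 < lam" and "lam < 1"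
    and "riccati_solution T \<sigma> R (discount lam \<rho> \<gamma>) \<Theta>1 \<Theta>2 P"
    and "\<forall>s\<in>{0..T}. \<Theta>1 s = P s s" and "\<forall>s\<in>{0..T}. \<Theta>2 s = - (P s s / R)"
  shows "equilibrium_saddle_strategy M (augmented_filtration M W) W T \<sigma> R
           (discount lam \<rho> \<gamma>) \<Theta>1 \<Theta>2"
proof -
  interpret brownian_space M W
    using assms by (intro brownian_space.intro brownian_space_axioms.intro)
  show ?thesis
  proof (rule Riccati_equilibrium_saddle_strategy[where P = P])
    show "continuous_on UNIV (discount lam \<rho> \<gamma>)"
      unfolding discount_def by (intro continuous_intros)
    show "discount lam \<rho> \<gamma> r > 0" for r
      using assms by (simp add: discount_def add_pos_pos)
    show "discount lam \<rho> \<gamma> 0 = 1" by (simp add: discount_def)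
  qed (use assms in auto)
qed

end
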